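(* Let $\Phi:\mathbb{B}(\mathscr{H})\to\mathbb{B}(\mathscr{K})$ be a unital positive linear map. Let $\alpha,\beta\geq 0$ and $\gamma>0$ satisfy $\min\{\alpha,\beta\}\leq\frac{\gamma}{2}$ and $\max\{\alpha,\beta\}\leq\gamma$. Then for every positive invertible operator $A\in\mathbb{B}(\mathscr{H})$ with $mI\leq A\leq MI$, where $m,M>0$, there exists a partial isometry $U$ such that $$\Phi(A^{\alpha+\beta+\gamma})\leq K\,U\left|\Phi(A^\alpha)\Phi(A^\beta)\Phi(A^\gamma)\right|U^*,$$ where, with $h=M/m$, $$K=\kappa(h^\alpha,2)^{1/2}\,\kappa(h^\beta,2)^{1/2}\,\kappa(h^\gamma,2\beta/\gamma)^{-1/2}\,\kappa(h^\gamma,2\alpha/\gamma)^{-1/2}\,\kappa\big(h^\gamma,1+(\alpha+\beta)/\gamma\big).$$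
   Context: $\mathbb{B}(\mathscr{H})$ is the $C^*$-algebra of bounded linear operators on a Hilbert space $\mathscr{H}$, and $\leq$ is the usual (Löwner) order on self-adjoint operators. A linear map $\Phi$ between such algebras is positive if it maps positive operators to positive operators, and unital if $\Phi(I)=I$. $|X|=(X^*X)^{1/2}$. Powers of positive operators are defined by the continuous functional calculus. The generalized Kantorovich constant is $$\kappa(h,p)=\frac{h^p-h}{(p-1)(h-1)}\left(\frac{p-1}{p}\,\frac{h^p-1}{h^p-h}\right)^p\qquad(h>0),$$ with the limiting values $\kappa(h,p)=1$ when $h=1$ or $p\in\{0,1\}$. *)

theory Defs
  imports "HOL-Analysis.Analysis" "HOL-Computational_Algebra.Polynomial"
begin

section \<open>Complex Hilbert spaces\<close>

class scaleC =
  fixes scaleC :: "complex \<Rightarrow> 'a \<Rightarrow> 'a"  (infixr "*\<^sub>C" 75)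

text \<open>
  The norm and the topology are those of the underlying real inner product space, whose inner
  product is the real part of \<^term>\<open>cinner\<close>; hence the norm of x is the square root
  of \<^term>\<open>cinner x x\<close>. The form is linear in its second argument.
  The zero space is not excluded.
\<close>

class chilbert_space = scaleC + real_inner + complete_space +
  fixes cinner :: "'a \<Rightarrow> 'a \<Rightarrow> complex"
  assumes scaleC_add_right: "c *\<^sub>C (x + y) = c *\<^sub>C x + c *\<^sub>C y"
    and scaleC_add_left: "(c + d) *\<^sub>C x = c *\<^sub>C x + d *\<^sub>C x"
    and scaleC_scaleC: "c *\<^sub>C d *\<^sub>C x = (c * d) *\<^sub>C x"
    and scaleR_scaleC: "r *\<^sub>R x = complex_of_real r *\<^sub>C x"
    and cinner_commute: "cinner x y = cnj (cinner y x)"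
    and cinner_add_right: "cinner x (y + z) = cinner x y + cinner x z"
    and cinner_scaleC_right: "cinner x (c *\<^sub>C y) = c * cinner x y"
    and inner_eq_Re_cinner: "x \<bullet> y = Re (cinner x y)"
lemma scaleC_one: "1 *\<^sub>C x = (x :: 'a::chilbert_space)"
  using scaleR_scaleC[of 1 x] by simp

lemma cinner_add_left: "cinner (x + y :: 'a::chilbert_space) z = cinner x z + cinner y z"
  by (metis cinner_add_right cinner_commute complex_cnj_add)

lemma cinner_zero_right: "cinner x (0 :: 'a::chilbert_space) = 0"
  using cinner_add_right[of x 0 0] by simp

lemma cinner_scaleC_left: "cinner (c *\<^sub>C x :: 'a::chilbert_space) y = cnj c * cinner x y"
  by (metis cinner_commute cinner_scaleC_right complex_cnj_mult)

lemma cinner_self: "cinner x (x :: 'a::chilbert_space) = complex_of_real (x \<bullet> x)"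
proof -
  have "Im (cinner x x) = 0"
    using cinner_commute[of x x] by (metis complex_cnj_cancel_iff Reals_cnj_iff complex_is_Real_iff)
  then show ?thesis
    by (simp add: complex_eq_iff inner_eq_Re_cinner)
qed

lemma norm_scaleC: "norm (c *\<^sub>C x) = cmod c * norm (x :: 'a::chilbert_space)"
proof -
  have "complex_of_real ((c *\<^sub>C x) \<bullet> (c *\<^sub>C x)) = (cnj c * c) * complex_of_real (x \<bullet> x)"
    by (metis cinner_self cinner_scaleC_left cinner_scaleC_right mult.assoc)
  also have "\<dots> = complex_of_real ((cmod c)\<^sup>2 * (x \<bullet> x))"
    by (metis complex_norm_square mult.commute of_real_mult)
  finally have "(c *\<^sub>C x) \<bullet> (c *\<^sub>C x) = (cmod c)\<^sup>2 * (x \<bullet> x)"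
    using of_real_eq_iff by blast
  then show ?thesis
    by (simp add: norm_eq_sqrt_inner real_sqrt_mult)
qed

lemma bounded_linear_scaleC: "bounded_linear ((*\<^sub>C) c :: 'a::chilbert_space \<Rightarrow> 'a)"
proof (rule bounded_linear_intro[where K = "cmod c"])
  show "c *\<^sub>C (x + y) = c *\<^sub>C x + c *\<^sub>C y" for x y :: 'a
    by (rule scaleC_add_right)
  show "c *\<^sub>C (r *\<^sub>R x) = r *\<^sub>R (c *\<^sub>C x)" for r and x :: 'a
    by (simp add: scaleR_scaleC scaleC_scaleC mult.commute)
  show "norm (c *\<^sub>C x) \<le> norm x * cmod c" for x :: 'a
    by (simp add: norm_scaleC mult.commute)
qed


section \<open>The algebra of bounded operators\<close>

text \<open>
  The elements are the bounded real-linear operators that commute with complex scalars; sums and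
  the operator norm are inherited, and the product is composition.
\<close>

typedef (overloaded) 'a bop =
  "{T :: 'a::chilbert_space \<Rightarrow>\<^sub>L 'a. \<forall>c x. blinfun_apply T (c *\<^sub>C x) = c *\<^sub>C blinfun_apply T x}"
  morphisms blinfun_of_bop bop_of_blinfun
  by (rule exI[of _ id_blinfun]) simp

setup_lifting type_definition_bop

lift_definition bop_apply :: "'a::chilbert_space bop \<Rightarrow> 'a \<Rightarrow> 'a" is blinfun_apply .

lemma bop_eqI: "(\<And>x. bop_apply S x = bop_apply T x) \<Longrightarrow> S = T"
  by transfer (rule blinfun_eqI)

instantiation bop :: (chilbert_space) real_normed_algebra
begin

lift_definition zero_bop :: "'a bop" is 0
  by (metis (no_types) blinfun.zero_left bounded_linear.linear bounded_linear_scaleC linear_0)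

lift_definition plus_bop :: "'a bop \<Rightarrow> 'a bop \<Rightarrow> 'a bop" is plus
  by (simp add: blinfun.add_left scaleC_add_right)

lift_definition uminus_bop :: "'a bop \<Rightarrow> 'a bop" is uminus
  by (simp add: blinfun.minus_left bounded_linear.linear[OF bounded_linear_scaleC] linear_neg)

lift_definition minus_bop :: "'a bop \<Rightarrow> 'a bop \<Rightarrow> 'a bop" is minus
  by (simp add: blinfun.diff_left bounded_linear.linear[OF bounded_linear_scaleC] linear_diff)

lift_definition scaleR_bop :: "real \<Rightarrow> 'a bop \<Rightarrow> 'a bop" is scaleR
  by (simp add: blinfun.scaleR_left scaleR_scaleC scaleC_scaleC mult.commute)

lift_definition times_bop :: "'a bop \<Rightarrow> 'a bop \<Rightarrow> 'a bop" is blinfun_compose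
  by simp

lift_definition norm_bop :: "'a bop \<Rightarrow> real" is norm .

definition dist_bop :: "'a bop \<Rightarrow> 'a bop \<Rightarrow> real"
  where "dist_bop S T = norm (S - T)"

definition sgn_bop :: "'a bop \<Rightarrow> 'a bop"
  where "sgn_bop T = inverse (norm T) *\<^sub>R T"

definition uniformity_bop :: "('a bop \<times> 'a bop) filter"
  where "uniformity_bop = (INF e\<in>{0<..}. principal {(S, T). dist S T < e})"

definition open_bop :: "'a bop set \<Rightarrow> bool"
  where "open_bop X = (\<forall>S\<in>X. \<forall>\<^sub>F (S', T) in uniformity. S' = S \<longrightarrow> T \<in> X)"

instance
proof
  fix R S T :: "'a bop" and a b :: real
  show "dist S T = norm (S - T)" by (rule dist_bop_def)
  show "sgn S = inverse (norm S) *\<^sub>R S" by (rule sgn_bop_def)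
  show "uniformity = (INF e\<in>{0<..}. principal {(S :: 'a bop, T). dist S T < e})"
    by (rule uniformity_bop_def)
  show "open X = (\<forall>S\<in>X. \<forall>\<^sub>F (S', T) in uniformity. S' = S \<longrightarrow> T \<in> X)" for X :: "'a bop set"
    by (rule open_bop_def)
  show "R + S + T = R + (S + T)" by transfer simp
  show "S + T = T + S" by transfer simp
  show "0 + S = S" by transfer simp
  show "- S + S = 0" by transfer simp
  show "S - T = S + - T" by transfer simp
  show "a *\<^sub>R (S + T) = a *\<^sub>R S + a *\<^sub>R T" by transfer (rule scaleR_add_right)
  show "(a + b) *\<^sub>R S = a *\<^sub>R S + b *\<^sub>R S" by transfer (rule scaleR_add_left)
  show "a *\<^sub>R b *\<^sub>R S = (a * b) *\<^sub>R S" by transfer simp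
  show "1 *\<^sub>R S = S" by transfer simp
  show "R * S * T = R * (S * T)" by transfer (rule blinfun_eqI, simp)
  show "(R + S) * T = R * T + S * T"
    by transfer (rule blinfun_eqI, simp add: blinfun.add_left)
  show "R * (S + T) = R * S + R * T"
    by transfer (rule blinfun_eqI, simp add: blinfun.add_left blinfun.add_right)
  show "a *\<^sub>R S * T = a *\<^sub>R (S * T)"
    by transfer (rule blinfun_eqI, simp add: blinfun.scaleR_left)
  show "S * a *\<^sub>R T = a *\<^sub>R (S * T)"
    by transfer (rule blinfun_eqI, simp add: blinfun.scaleR_left blinfun.scaleR_right)
  show "norm S = 0 \<longleftrightarrow> S = 0" by transfer simp
  show "norm (S + T) \<le> norm S + norm T" by transfer (rule norm_triangle_ineq)
  show "norm (a *\<^sub>R S) = \<bar>a\<bar> * norm S" by transfer simp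
  show "norm (S * T) \<le> norm S * norm T" by transfer (rule norm_blinfun_compose)
qed

end

instantiation bop :: (chilbert_space) monoid_mult
begin

lift_definition one_bop :: "'a bop" is id_blinfun
  by simp

instance
  by standard (transfer, rule blinfun_eqI, simp)+

end

instantiation bop :: (chilbert_space) scaleC
begin

lift_definition scaleC_bop :: "complex \<Rightarrow> 'a bop \<Rightarrow> 'a bop"
  is "\<lambda>c T. Blinfun ((*\<^sub>C) c) o\<^sub>L T"
  by (simp add: bounded_linear_Blinfun_apply[OF bounded_linear_scaleC] scaleC_scaleC mult.commute)

instance ..

end

lemma bop_apply_simps [simp]:
  fixes S T :: "'a::chilbert_space bop"
  shows "bop_apply 0 x = 0"
    and "bop_apply 1 x = x"
    and "bop_apply (S + T) x = bop_apply S x + bop_apply T x"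
    and "bop_apply (S - T) x = bop_apply S x - bop_apply T x"
    and "bop_apply (- T) x = - bop_apply T x"
    and "bop_apply (S * T) x = bop_apply S (bop_apply T x)"
    and "bop_apply (r *\<^sub>R T) x = r *\<^sub>R bop_apply T x"
    and "bop_apply (c *\<^sub>C T) x = c *\<^sub>C bop_apply T x"
  by (transfer; simp add: blinfun.bilinear_simps
      bounded_linear_Blinfun_apply[OF bounded_linear_scaleC])+

lemma bop_apply_add: "bop_apply T (x + y) = bop_apply T x + bop_apply T y"
  by transfer (rule blinfun.add_right)

lemma bop_apply_scaleC: "bop_apply T (c *\<^sub>C x) = c *\<^sub>C bop_apply T x"
  by transfer simp

definition invertible_op :: "'a::chilbert_space bop \<Rightarrow> bool"
  where "invertible_op T \<longleftrightarrow> (\<exists>S. S * T = 1 \<and> T * S = 1)"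

definition adj_op :: "'a::chilbert_space bop \<Rightarrow> 'a bop"
  where "adj_op T = (THE S. \<forall>x y. cinner (bop_apply T x) y = cinner x (bop_apply S y))"

text \<open>
  Over the complex numbers a real-valued quadratic form already forces self-adjointness.
\<close>

definition positive_op :: "'a::chilbert_space bop \<Rightarrow> bool"
  where "positive_op T \<longleftrightarrow>
    (\<forall>x. cinner x (bop_apply T x) \<in> \<real> \<and> 0 \<le> Re (cinner x (bop_apply T x)))"

lemma cinner_quadratic_form_eq_zero:
  fixes T :: "'a::chilbert_space bop"
  assumes "\<And>x. cinner x (bop_apply T x) = 0"
  shows "T = 0"
proof (rule bop_eqI)
  fix y
  have *: "cinner x (bop_apply T y) + cinner y (bop_apply T x) = 0" for x
    using assms[of "x + y"] assms[of x] assms[of y]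
    by (simp add: bop_apply_add cinner_add_left cinner_add_right add.commute)
  have "cinner x (bop_apply T y) = 0" for x
    using *[of x] *[of "\<i> *\<^sub>C x"]
    by (simp add: bop_apply_scaleC cinner_scaleC_left cinner_scaleC_right complex_eq_iff)
  then have "bop_apply T y \<bullet> bop_apply T y = 0"
    by (simp add: inner_eq_Re_cinner)
  then show "bop_apply T y = bop_apply 0 y"
    by simp
qed

text \<open>The Loewner order.\<close>

instantiation bop :: (chilbert_space) order
begin

definition less_eq_bop :: "'a bop \<Rightarrow> 'a bop \<Rightarrow> bool"
  where "S \<le> T \<longleftrightarrow> positive_op (T - S)"

definition less_bop :: "'a bop \<Rightarrow> 'a bop \<Rightarrow> bool"
  where "S < T \<longleftrightarrow> S \<le> T \<and> S \<noteq> (T :: 'a bop)"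

lemma positive_op_add:
  "positive_op S \<Longrightarrow> positive_op T \<Longrightarrow> positive_op (S + T :: 'a bop)"
  by (simp add: positive_op_def cinner_add_right)

lemma positive_op_antisym:
  fixes T :: "'a bop"
  assumes "positive_op T" "positive_op (- T)"
  shows "T = 0"
proof (rule cinner_quadratic_form_eq_zero)
  fix x
  have "cinner x (bop_apply T x) + cinner x (bop_apply (- T) x) = cinner x 0"
    by (simp flip: cinner_add_right)
  then show "cinner x (bop_apply T x) = 0"
    using assms cinner_zero_right[of x] unfolding positive_op_def complex_is_Real_iff complex_eq_iff
    by (smt (verit) plus_complex.simps zero_complex.simps)
qed

instance
proof
  fix R S T :: "'a bop"
  show refl: "S \<le> S" for S :: "'a bop"
    by (simp add: cinner_zero_right less_eq_bop_def positive_op_def)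
  show "R \<le> T" if "R \<le> S" "S \<le> T"
    using positive_op_add[of "T - S" "S - R"] that by (simp add: less_eq_bop_def)
  show antisym: "S = T" if "S \<le> T" "T \<le> S" for S T :: "'a bop"
    using positive_op_antisym[of "T - S"] that by (simp add: less_eq_bop_def)
  show "S < T \<longleftrightarrow> S \<le> T \<and> \<not> T \<le> S"
    using refl antisym by (auto simp: less_bop_def)
qed

end


section \<open>Functional calculus\<close>

definition spectrum :: "'a::chilbert_space bop \<Rightarrow> complex set"
  where "spectrum T = {z. \<not> invertible_op (T - z *\<^sub>C 1)}"

definition poly_op :: "real poly \<Rightarrow> 'a::chilbert_space bop \<Rightarrow> 'a bop"
  where "poly_op p T = (\<Sum>i\<le>degree p. coeff p i *\<^sub>R T ^ i)"

text \<open>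
  Continuous functional calculus of a self-adjoint operator (whose spectrum is real and compact)
  at a real function f that is continuous on the spectrum: the common norm limit of
  \<open>p n (T)\<close> over all sequences p of real polynomials converging to f uniformly on the
  spectrum.
\<close>

definition cfc :: "(real \<Rightarrow> real) \<Rightarrow> 'a::chilbert_space bop \<Rightarrow> 'a bop"
  where "cfc f T = (THE S. \<forall>p :: nat \<Rightarrow> real poly.
    uniform_limit {t. complex_of_real t \<in> spectrum T} (\<lambda>n. poly (p n)) f sequentially
      \<longrightarrow> (\<lambda>n. poly_op (p n) T) \<longlonglongrightarrow> S)"

text \<open>
  For positive T and positive a, or for positive invertible T and any real a.
  Since \<open>0 powr 0 = 0\<close>, the zeroth power of a non-invertible T is not the identity.
\<close>

definition powr_op :: "'a::chilbert_space bop \<Rightarrow> real \<Rightarrow> 'a bop"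
  where "powr_op T a = cfc (\<lambda>t. t powr a) T"

definition abs_op :: "'a::chilbert_space bop \<Rightarrow> 'a bop"
  where "abs_op T = powr_op (adj_op T * T) (1/2)"

text \<open>Isometric on the orthogonal complement of the kernel.\<close>

definition partial_isometry :: "'a::chilbert_space bop \<Rightarrow> bool"
  where "partial_isometry U \<longleftrightarrow>
    (\<forall>x. (\<forall>y. bop_apply U y = 0 \<longrightarrow> cinner y x = 0) \<longrightarrow> norm (bop_apply U x) = norm x)"


section \<open>Positive maps and the Kantorovich constant\<close>

definition linear_map :: "('a::chilbert_space bop \<Rightarrow> 'b::chilbert_space bop) \<Rightarrow> bool"
  where "linear_map \<Phi> \<longleftrightarrow>
    (\<forall>S T. \<Phi> (S + T) = \<Phi> S + \<Phi> T) \<and> (\<forall>c T. \<Phi> (c *\<^sub>C T) = c *\<^sub>C \<Phi> T)"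

definition positive_map :: "('a::chilbert_space bop \<Rightarrow> 'b::chilbert_space bop) \<Rightarrow> bool"
  where "positive_map \<Phi> \<longleftrightarrow> (\<forall>T. positive_op T \<longrightarrow> positive_op (\<Phi> T))"

definition unital_map :: "('a::chilbert_space bop \<Rightarrow> 'b::chilbert_space bop) \<Rightarrow> bool"
  where "unital_map \<Phi> \<longleftrightarrow> \<Phi> 1 = 1"

definition kantorovich :: "real \<Rightarrow> real \<Rightarrow> real"
  where "kantorovich h p =
    (if h = 1 \<or> p = 0 \<or> p = 1 then 1
     else (h powr p - h) / ((p - 1) * (h - 1))
       * ((p - 1) / p * ((h powr p - 1) / (h powr p - h))) powr p)"

end

theory Submission
  imports Defs "HOL-Computational_Algebra.Fundamental_Theorem_Algebra"
begin

text \<open>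
  Write \<open>X\<close>, \<open>S\<close>, \<open>T\<close> for the operators \<open>\<Phi> (A\<^sup>\<gamma>)\<close>, \<open>\<Phi> (A\<^sup>\<alpha>)\<close>, \<open>\<Phi> (A\<^sup>\<beta>)\<close>, scaled so that the
  spectrum of \<open>X\<close> lies in \<open>[e\<^sup>-\<^sup>u, e\<^sup>u]\<close>, and \<open>a = \<alpha> / \<gamma>\<close>, \<open>b = \<beta> / \<gamma>\<close>, \<open>p = 1 + a + b\<close>. Positivity of
  \<open>\<Phi>\<close> turns convexity and concavity of powers into operator inequalities: \<open>S\<close> and \<open>T\<close> dominate the
  chords of \<open>t\<^sup>a\<close> and \<open>t\<^sup>b\<close> at \<open>X\<close>, and the left-hand side is dominated by the chord of \<open>t\<^sup>p\<close>. Together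
  with \<open>S\<^sup>2 \<ge> 2 r S - r\<^sup>2\<close>, where \<open>r\<close> may depend on the level \<open>y\<close>, this bounds \<open>S T X\<close> from below on
  each spectral subspace \<open>X \<ge> y\<close>. A scalar inequality, strict except in trivial cases, says that \<open>K\<close> times
  the bound exceeds the chord of \<open>t\<^sup>p\<close>. The strictness leaves room to replace the chord by a step
  function, and a QR factorisation along the resulting finite nest of spectral subspaces produces \<open>U\<close>.
\<close>

section \<open>Bounded operators and their quadratic forms\<close>

text \<open>In finite dimension, a lower bound for \<open>S T X\<close> on every spectral subspace
  \<open>X \<ge> y\<close> compares eigenvalues by the min-max principle, and matching eigenvectors
  gives a unitary. Continuous spectrum offers no eigenvectors to match; finitely many levels can
  still be matched, at the price of an isometry \<open>W\<close> instead of a unitary.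
  \<open>U\<close> is the adjoint of \<open>W\<close>.

  Since \<open>S\<close> and \<open>X\<close> need not commute, a chord below \<open>S\<close> gives
  no squared chord below \<open>S^2\<close>, whereas \<open>2 r S - r^2\<close> works for every real
  \<open>r\<close>. The vector \<open>T X v\<close> fed to \<open>S\<close> may leave the spectral
  subspace, and outside it only \<open>S \<ge> e^(-a u)\<close> is available, which demands
  \<open>r \<le> 2 e^(-a u)\<close>. The value \<open>r = 1 / cosh (a u)\<close> is admissible, and
  multiplying by \<open>cosh (a u)^2\<close>, the Kantorovich constant for exponent 2, turns the
  chord of \<open>t^a\<close> into the chord of \<open>t^(2a)\<close>; hence the constants with
  exponents \<open>2a\<close> and \<open>2b\<close> in \<open>K\<close>. For \<open>2a > 1\<close>
  that chord lies below its scaled power, so at low levels \<open>r\<close> is taken to be the chord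
  value itself, which yields the full square.\<close>

instance chilbert_space \<subseteq> banach ..

lemma bounded_linear_bop_apply: "bounded_linear (bop_apply T)"
  by transfer (rule blinfun.bounded_linear_right)

lemma bop_apply_zero [simp]: "bop_apply T 0 = 0"
  by (rule linear_0[OF bounded_linear.linear[OF bounded_linear_bop_apply]])

lemma bop_apply_diff: "bop_apply T (x - y) = bop_apply T x - bop_apply T y"
  by (rule linear_diff[OF bounded_linear.linear[OF bounded_linear_bop_apply]])

lemma bop_apply_minus: "bop_apply T (- x) = - bop_apply T x"
  by (rule linear_neg[OF bounded_linear.linear[OF bounded_linear_bop_apply]])

lemma bop_apply_scaleR: "bop_apply T (r *\<^sub>R x) = r *\<^sub>R bop_apply T x"
  by (rule linear_scale[OF bounded_linear.linear[OF bounded_linear_bop_apply]])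

lemma sum_bop_apply: "bop_apply (sum f A) x = (\<Sum>i\<in>A. bop_apply (f i) x)"
  by (induction A rule: infinite_finite_induct) auto

lemma norm_bop_apply: "norm (bop_apply T x) \<le> norm T * norm x"
  by transfer (rule norm_blinfun)

lemma norm_bop_le:
  assumes "0 \<le> c" "\<And>x. norm (bop_apply T x) \<le> c * norm x"
  shows "norm T \<le> c"
  using assms by transfer (rule norm_blinfun_bound)

lemma norm_diff_scaleR_sq:
  fixes a v :: "'a::real_inner"
  shows "(norm (a - r *\<^sub>R v))\<^sup>2 = (norm a)\<^sup>2 - 2 * r * (a \<bullet> v) + r\<^sup>2 * (v \<bullet> v)"
  unfolding power2_norm_eq_inner
  by (simp add: inner_diff_left inner_diff_right inner_commute[of v a] power2_eq_square algebra_simps)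

lemma bop_exists:
  fixes f :: "'a::chilbert_space \<Rightarrow> 'a"
  assumes "bounded_linear f" "\<And>c x. f (c *\<^sub>C x) = c *\<^sub>C f x"
  shows "\<exists>T. \<forall>x. bop_apply T x = f x"
proof -
  have "bop_apply (bop_of_blinfun (Blinfun f)) x = f x" for x
    using assms by (simp add: bop_apply_def bop_of_blinfun_inverse bounded_linear_Blinfun_apply)
  then show ?thesis by blast
qed

lemma dist_blinfun_of_bop: "dist (blinfun_of_bop S) (blinfun_of_bop T) = dist S T"
  by (simp add: dist_norm minus_bop.rep_eq norm_bop.rep_eq)

lemma scaleC_diff_right: "c *\<^sub>C (x - y) = c *\<^sub>C x - c *\<^sub>C (y :: 'a::chilbert_space)"
  by (rule linear_diff[OF bounded_linear.linear[OF bounded_linear_scaleC]])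

text \<open>Completeness gives approximating polynomials a limit in \<open>cfc_tendsto\<close>.
  Complex linearity passes to the limit pointwise.\<close>

instance bop :: (chilbert_space) banach
proof
  fix X :: "nat \<Rightarrow> 'a bop"
  assume "Cauchy X"
  then have "Cauchy (\<lambda>n. blinfun_of_bop (X n))"
    by (simp add: Cauchy_def dist_blinfun_of_bop)
  then obtain L where L: "(\<lambda>n. blinfun_of_bop (X n)) \<longlonglongrightarrow> L"
    by (auto dest!: Cauchy_convergent simp: convergent_def)
  have L': "(\<lambda>n. blinfun_apply (blinfun_of_bop (X n)) x) \<longlonglongrightarrow> blinfun_apply L x" for x
    by (intro tendsto_intros L)
  have "blinfun_apply L (c *\<^sub>C x) = c *\<^sub>C blinfun_apply L x" for c x
  proof (rule LIMSEQ_unique[OF L'])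
    have "blinfun_apply (blinfun_of_bop (X n)) (c *\<^sub>C x) = c *\<^sub>C blinfun_apply (blinfun_of_bop (X n)) x" for n
      using blinfun_of_bop[of "X n"] by simp
    then show "(\<lambda>n. blinfun_apply (blinfun_of_bop (X n)) (c *\<^sub>C x)) \<longlonglongrightarrow> c *\<^sub>C blinfun_apply L x"
      using bounded_linear.tendsto[OF bounded_linear_scaleC L'] by simp
  qed
  then have "blinfun_of_bop (bop_of_blinfun L) = L"
    by (simp add: bop_of_blinfun_inverse)
  then have "X \<longlonglongrightarrow> bop_of_blinfun L"
    using L unfolding lim_sequentially by (metis dist_blinfun_of_bop)
  then show "convergent X" by (auto simp: convergent_def)
qed

subsection \<open>Adjoints and positivity\<close>

text \<open>The imaginary part is recovered by rotating one argument by \<open>\<i>\<close>. Hence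
  all later arguments can use the real inner product, and complex linearity of the operators carries
  them back.\<close>

lemma cinner_eq_inner: "cinner x y = Complex (x \<bullet> y) (- (x \<bullet> (\<i> *\<^sub>C y)))"
  by (simp add: complex_eq_iff inner_eq_Re_cinner cinner_scaleC_right)

lemma inner_scaleC_left: "(c *\<^sub>C x) \<bullet> y = (x :: 'a::chilbert_space) \<bullet> (cnj c *\<^sub>C y)"
  by (simp add: inner_eq_Re_cinner cinner_scaleC_left cinner_scaleC_right)

text \<open>A relation instead of a function: \<open>adj_op\<close> is a definite description, and
  carrying both members of the pair avoids proving that every bounded operator has an
  adjoint.\<close>

definition adjoint_pair :: "'a::chilbert_space bop \<Rightarrow> 'a bop \<Rightarrow> bool"
  where "adjoint_pair S T \<longleftrightarrow> (\<forall>x y. bop_apply S x \<bullet> y = x \<bullet> bop_apply T y)"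

abbreviation self_adjoint :: "'a::chilbert_space bop \<Rightarrow> bool"
  where "self_adjoint T \<equiv> adjoint_pair T T"

lemma adjoint_pairD: "adjoint_pair S T \<Longrightarrow> bop_apply S x \<bullet> y = x \<bullet> bop_apply T y"
  by (simp add: adjoint_pair_def)

lemma adjoint_pair_sym: "adjoint_pair S T \<Longrightarrow> adjoint_pair T S"
  by (simp add: adjoint_pair_def inner_commute)

lemma adj_op_eqI:
  assumes "adjoint_pair S T"
  shows "adj_op S = T"
  unfolding adj_op_def
proof (rule the_equality)
  show "\<forall>x y. cinner (bop_apply S x) y = cinner x (bop_apply T y)"
    using assms by (simp add: adjoint_pair_def cinner_eq_inner flip: bop_apply_scaleC)
  show "R = T" if R: "\<forall>x y. cinner (bop_apply S x) y = cinner x (bop_apply R y)" for R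
  proof (rule bop_eqI)
    fix y
    have "x \<bullet> bop_apply R y = x \<bullet> bop_apply T y" for x :: 'a
    proof -
      have "x \<bullet> bop_apply R y = bop_apply S x \<bullet> y"
        using R by (simp add: inner_eq_Re_cinner)
      then show ?thesis using adjoint_pairD[OF assms] by simp
    qed
    then show "bop_apply R y = bop_apply T y" using vector_eq_ldot[of "bop_apply R y" "bop_apply T y"] by blast
  qed
qed

lemma adjoint_pair_zero: "adjoint_pair 0 0"
  by (simp add: adjoint_pair_def)

lemma adjoint_pair_one: "adjoint_pair 1 1"
  by (simp add: adjoint_pair_def)

lemma adjoint_pair_add: "adjoint_pair S S' \<Longrightarrow> adjoint_pair T T' \<Longrightarrow> adjoint_pair (S + T) (S' + T')"
  by (simp add: adjoint_pair_def inner_add_left inner_add_right)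

lemma adjoint_pair_diff: "adjoint_pair S S' \<Longrightarrow> adjoint_pair T T' \<Longrightarrow> adjoint_pair (S - T) (S' - T')"
  by (simp add: adjoint_pair_def inner_diff_left inner_diff_right)

lemma adjoint_pair_mult: "adjoint_pair S S' \<Longrightarrow> adjoint_pair T T' \<Longrightarrow> adjoint_pair (S * T) (T' * S')"
  by (simp add: adjoint_pair_def)

lemma adjoint_pair_scaleR: "adjoint_pair S S' \<Longrightarrow> adjoint_pair (r *\<^sub>R S) (r *\<^sub>R S')"
  by (simp add: adjoint_pair_def)

lemma adjoint_pair_sum:
  "(\<And>i. i \<in> A \<Longrightarrow> adjoint_pair (S i) (T i)) \<Longrightarrow> adjoint_pair (sum S A) (sum T A)"
  by (induction A rule: infinite_finite_induct) (auto intro: adjoint_pair_zero adjoint_pair_add)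

lemma adjoint_pair_power: "adjoint_pair S T \<Longrightarrow> adjoint_pair (S ^ n) (T ^ n)"
proof (induction n)
  case (Suc n)
  then have "adjoint_pair (S * S ^ n) (T ^ n * T)" by (intro adjoint_pair_mult)
  then show ?case by (simp add: power_Suc2[symmetric] power_commutes)
qed (simp add: adjoint_pair_one)

lemmas adjoint_pair_intros = adjoint_pair_zero adjoint_pair_one adjoint_pair_add adjoint_pair_diff
  adjoint_pair_mult adjoint_pair_scaleR adjoint_pair_sum adjoint_pair_power

lemma adjoint_pair_tendsto:
  assumes "X \<longlonglongrightarrow> S" "Y \<longlonglongrightarrow> T" "\<And>n. adjoint_pair (X n) (Y n)"
  shows "adjoint_pair S T"
  unfolding adjoint_pair_def
proof (intro allI)
  fix x y
  have *: "(\<lambda>n. bop_apply (Z n) x) \<longlonglongrightarrow> bop_apply L x" if "Z \<longlonglongrightarrow> L" for Z and L :: "'a bop" and x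
  proof -
    have "(\<lambda>n. blinfun_of_bop (Z n)) \<longlonglongrightarrow> blinfun_of_bop L"
      using that by (simp add: lim_sequentially dist_blinfun_of_bop)
    then show ?thesis
      unfolding bop_apply.rep_eq by (intro tendsto_intros)
  qed
  have "(\<lambda>n. bop_apply (X n) x \<bullet> y) \<longlonglongrightarrow> bop_apply S x \<bullet> y" "(\<lambda>n. x \<bullet> bop_apply (Y n) y) \<longlonglongrightarrow> x \<bullet> bop_apply T y"
    by (intro tendsto_intros * assms)+
  then show "bop_apply S x \<bullet> y = x \<bullet> bop_apply T y"
    using assms(3) by (metis (no_types, lifting) LIMSEQ_unique adjoint_pair_def ext)
qed

text \<open>A real-valued complex form means that \<open>x\<close> is orthogonal to
  \<open>T (\<i> x)\<close> in the real inner product. Polarising this with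
  \<open>x + \<i> y\<close> gives symmetry.\<close>

lemma positive_op_iff: "positive_op T \<longleftrightarrow> self_adjoint T \<and> (\<forall>x. 0 \<le> x \<bullet> bop_apply T x)"
proof
  assume T: "positive_op T"
  have im: "x \<bullet> bop_apply T (\<i> *\<^sub>C x) = 0" for x
  proof -
    have "Im (cinner x (bop_apply T x)) = 0"
      using T by (simp add: positive_op_def complex_is_Real_iff)
    then show ?thesis by (simp add: cinner_eq_inner bop_apply_scaleC)
  qed
  have ii: "\<i> *\<^sub>C \<i> *\<^sub>C x = - x" for x :: 'a
    using scaleR_scaleC[of "-1" x] by (simp add: scaleC_scaleC)
  have "bop_apply T x \<bullet> y = x \<bullet> bop_apply T y" for x y
  proof -
    have "0 = (x + \<i> *\<^sub>C y) \<bullet> bop_apply T (\<i> *\<^sub>C (x + \<i> *\<^sub>C y))"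
      using im by metis
    also have "\<dots> = x \<bullet> bop_apply T (- y) + (\<i> *\<^sub>C y) \<bullet> bop_apply T (\<i> *\<^sub>C x)
        + x \<bullet> bop_apply T (\<i> *\<^sub>C x) + (\<i> *\<^sub>C y) \<bullet> bop_apply T (\<i> *\<^sub>C \<i> *\<^sub>C y)"
      by (simp add: scaleC_add_right ii inner_add_left inner_add_right bop_apply_add bop_apply_minus bop_apply_diff inner_diff_right)
    also have "\<dots> = - (x \<bullet> bop_apply T y) + y \<bullet> bop_apply T x"
      using im[of x] im[of "\<i> *\<^sub>C y"]
      by (simp add: bop_apply_minus inner_scaleC_left bop_apply_scaleC scaleC_scaleC scaleC_one)
    finally show ?thesis by (simp add: inner_commute)
  qed
  then show "self_adjoint T \<and> (\<forall>x. 0 \<le> x \<bullet> bop_apply T x)"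
    using T by (simp add: adjoint_pair_def positive_op_def inner_eq_Re_cinner)
next
  assume T: "self_adjoint T \<and> (\<forall>x. 0 \<le> x \<bullet> bop_apply T x)"
  have "x \<bullet> bop_apply T (\<i> *\<^sub>C x) = 0" for x
  proof -
    have "x \<bullet> bop_apply T (\<i> *\<^sub>C x) = bop_apply T x \<bullet> (\<i> *\<^sub>C x)"
      using T by (simp add: adjoint_pair_def)
    also have "\<dots> = - ((\<i> *\<^sub>C bop_apply T x) \<bullet> x)"
    proof -
      have "(- \<i>) *\<^sub>C x = - (\<i> *\<^sub>C x)"
        using scaleR_scaleC[of "-1" "\<i> *\<^sub>C x"] by (simp add: scaleC_scaleC)
      then show ?thesis by (simp add: inner_scaleC_left)
    qed
    finally show ?thesis by (simp add: bop_apply_scaleC inner_commute)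
  qed
  then show "positive_op T"
    using T by (simp add: positive_op_def complex_is_Real_iff cinner_eq_inner bop_apply_scaleC)
qed

lemma bop_le_iff:
  assumes "self_adjoint S" "self_adjoint T"
  shows "S \<le> T \<longleftrightarrow> (\<forall>x. x \<bullet> bop_apply S x \<le> x \<bullet> bop_apply T x)"
  using adjoint_pair_diff[OF assms(2) assms(1)]
  by (simp add: less_eq_bop_def positive_op_iff inner_diff_right adjoint_pair_diff)

lemma bop_leD: "S \<le> T \<Longrightarrow> x \<bullet> bop_apply S x \<le> x \<bullet> bop_apply T x"
  by (simp add: less_eq_bop_def positive_op_iff inner_diff_right)

lemma self_adjoint_norm_sq: "self_adjoint T \<Longrightarrow> (norm (bop_apply T x))\<^sup>2 = x \<bullet> bop_apply (T * T) x"
  by (simp add: dot_square_norm[symmetric] adjoint_pair_def)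

lemma positive_op_cauchy_schwarz:
  assumes "positive_op T"
  shows "(x \<bullet> bop_apply T y)\<^sup>2 \<le> (x \<bullet> bop_apply T x) * (y \<bullet> bop_apply T y)"
proof -
  let ?b = "\<lambda>x y. x \<bullet> bop_apply T y"
  have sym: "?b x y = ?b y x" and pos: "0 \<le> ?b z z" for x y z
    using assms by (auto simp: positive_op_iff adjoint_pair_def inner_commute)
  have expand: "?b (x + r *\<^sub>R y) (x + r *\<^sub>R y) = ?b x x + 2 * r * ?b x y + r\<^sup>2 * ?b y y" for r
    using sym[of x y]
    by (simp add: bop_apply_add bop_apply_scaleR inner_add_left inner_add_right algebra_simps power2_eq_square)
  show ?thesis
  proof (cases "?b y y = 0")
    case True
    \<comment> \<open>With a zero quadratic coefficient the form is affine in \<open>r\<close>,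
      hence unbounded below unless its slope vanishes; the chosen \<open>r\<close> makes its value
      -1.\<close>
    have "?b x y = 0"
    proof (rule ccontr)
      assume "?b x y \<noteq> 0"
      then show False
        using pos[of "x + (- (?b x x + 1) / (2 * ?b x y)) *\<^sub>R y"] True unfolding expand by (simp add: field_simps)
    qed
    then show ?thesis using True by simp
  next
    case False
    then have yy: "?b y y > 0" using pos[of y] by simp
    have "0 \<le> ?b x x + 2 * (- ?b x y / ?b y y) * ?b x y + (- ?b x y / ?b y y)\<^sup>2 * ?b y y"
      using pos[of "x + (- ?b x y / ?b y y) *\<^sub>R y"] unfolding expand .
    then have "0 \<le> ?b x x - (?b x y)\<^sup>2 / ?b y y"
      using False by (simp add: power2_eq_square field_simps)
    then show ?thesis using yy by (simp add: field_simps)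
  qed
qed

text \<open>Lax-Milgram through Banach's fixed point theorem for \<open>x - (T x - b) / d\<close>.
  The value \<open>d = K^2 / c\<close> minimises the squared contraction factor
  \<open>1 - 2 c / d + K^2 / d^2\<close>, and adding \<open>c\<close> to the norm ensures
  \<open>K \<ge> c > 0\<close>. The generality matters for \<open>1 - Q * R\<close> in
  \<open>shear_into_nest\<close>.\<close>

lemma coercive_invertible:
  fixes T :: "'a::chilbert_space bop"
  assumes c: "c > 0" and co: "\<And>x. c * (norm x)\<^sup>2 \<le> x \<bullet> bop_apply T x"
  shows "invertible_op T"
proof -
  define K where "K = norm T + c"
  define d where "d = K\<^sup>2 / c"
  have K: "K \<ge> c" "K > 0" "norm T \<le> K" using c by (auto simp: K_def add_pos_nonneg add_nonneg_pos)
  have d: "d > 0" using K c by (simp add: d_def)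
  define q where "q = sqrt (1 - c\<^sup>2 / K\<^sup>2)"
  have q01: "0 \<le> 1 - c\<^sup>2 / K\<^sup>2" "1 - c\<^sup>2 / K\<^sup>2 < 1" using K c by (auto simp: field_simps power_mono)
  have q: "0 \<le> q" "q < 1" using q01 unfolding q_def by (auto simp: real_sqrt_lt_1_iff)
  have contr: "norm (x - (1/d) *\<^sub>R bop_apply T x) \<le> q * norm x" for x
  proof -
    have Tx: "(norm (bop_apply T x))\<^sup>2 \<le> K\<^sup>2 * (norm x)\<^sup>2"
      using norm_bop_apply[of T x] K mult_right_mono[OF K(3), of "norm x"]
      by (metis (no_types, lifting) norm_ge_zero order_trans power_mono power_mult_distrib)
    have "(norm (x - (1/d) *\<^sub>R bop_apply T x))\<^sup>2 = (norm x)\<^sup>2 - 2 / d * (x \<bullet> bop_apply T x) + (norm (bop_apply T x))\<^sup>2 / d\<^sup>2"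
      unfolding power2_norm_eq_inner
      by (simp add: inner_diff_left inner_diff_right inner_commute algebra_simps power2_eq_square)
    also have "\<dots> \<le> (norm x)\<^sup>2 - 2 / d * (c * (norm x)\<^sup>2) + (K\<^sup>2 * (norm x)\<^sup>2) / d\<^sup>2"
      using d co[of x] Tx by (intro add_mono diff_mono mult_left_mono divide_right_mono) auto
    also have "\<dots> = (1 - c\<^sup>2 / K\<^sup>2) * (norm x)\<^sup>2"
      using K c by (simp add: d_def field_simps power2_eq_square)
    also have "\<dots> = (q * norm x)\<^sup>2" using q01 by (simp add: q_def power_mult_distrib)
    finally show ?thesis by (rule power2_le_imp_le) (use q in simp)
  qed
  have surj: "\<exists>x. bop_apply T x = b" for b
  proof -
    have "\<exists>!x. x - (1/d) *\<^sub>R (bop_apply T x - b) = x"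
    proof (rule banach_fix_type[where c = q])
      show "0 \<le> q" "q < 1" by fact+
      show "\<forall>x y. dist (x - (1/d) *\<^sub>R (bop_apply T x - b)) (y - (1/d) *\<^sub>R (bop_apply T y - b)) \<le> q * dist x y"
      proof (intro allI)
        fix x y
        have "(x - (1/d) *\<^sub>R (bop_apply T x - b)) - (y - (1/d) *\<^sub>R (bop_apply T y - b)) = (x - y) - (1/d) *\<^sub>R bop_apply T (x - y)"
          by (simp add: bop_apply_diff algebra_simps)
        then show "dist (x - (1/d) *\<^sub>R (bop_apply T x - b)) (y - (1/d) *\<^sub>R (bop_apply T y - b)) \<le> q * dist x y"
          unfolding dist_norm using contr[of "x - y"] by metis
      qed
    qed
    then show ?thesis using d by auto
  qed
  have lower: "c * norm x \<le> norm (bop_apply T x)" for x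
  proof (cases "x = 0")
    case False
    have "c * (norm x)\<^sup>2 \<le> norm x * norm (bop_apply T x)"
      using co[of x] norm_cauchy_schwarz[of x "bop_apply T x"] by linarith
    then show ?thesis using False by (simp add: power2_eq_square)
  qed simp
  have inj: "x = y" if "bop_apply T x = bop_apply T y" for x y
    using lower[of "x - y"] that c by (simp add: bop_apply_diff mult_le_0_iff)
  define g where "g = (\<lambda>b. SOME x. bop_apply T x = b)"
  have Tg: "bop_apply T (g b) = b" for b
    unfolding g_def using someI_ex[OF surj] .
  have gT: "g (bop_apply T x) = x" for x
    using inj[OF Tg] .
  have "\<exists>S. \<forall>x. bop_apply S x = g x"
  proof (rule bop_exists)
    show "bounded_linear g"
    proof (rule bounded_linear_intro[where K = "1 / c"])
      show "g (x + y) = g x + g y" for x y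
        by (rule inj) (simp add: Tg bop_apply_add)
      show "g (r *\<^sub>R x) = r *\<^sub>R g x" for r x
        by (rule inj) (simp add: Tg bop_apply_scaleR)
      show "norm (g x) \<le> norm x * (1 / c)" for x
        using lower[of "g x"] c by (simp add: Tg field_simps)
    qed
    show "g (z *\<^sub>C x) = z *\<^sub>C g x" for z x
      by (rule inj) (simp add: Tg bop_apply_scaleC)
  qed
  then obtain S where S: "\<And>x. bop_apply S x = g x" by blast
  have "S * T = 1" "T * S = 1"
    by (rule bop_eqI, simp add: S Tg gT)+
  then show ?thesis unfolding invertible_op_def by blast
qed

subsection \<open>Orthogonal projections\<close>

definition projection :: "'a::chilbert_space bop \<Rightarrow> bool"
  where "projection P \<longleftrightarrow> self_adjoint P \<and> P * P = P"

lemma projectionD: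
  assumes "projection P"
  shows "bop_apply P x \<bullet> y = x \<bullet> bop_apply P y" "bop_apply P (bop_apply P x) = bop_apply P x"
    "bop_apply P x \<bullet> bop_apply P y = x \<bullet> bop_apply P y"
proof -
  show *: "bop_apply P (bop_apply P x) = bop_apply P x" for x
    using assms by (metis bop_apply_simps(6) projection_def)
  show **: "bop_apply P x \<bullet> y = x \<bullet> bop_apply P y" for x y
    using assms by (simp add: projection_def adjoint_pair_def)
  show "bop_apply P x \<bullet> bop_apply P y = x \<bullet> bop_apply P y"
    unfolding ** * ..
qed

lemma projection_pythagoras:
  assumes "projection P"
  shows "(norm x)\<^sup>2 = (norm (bop_apply P x))\<^sup>2 + (norm (x - bop_apply P x))\<^sup>2"
  unfolding power2_norm_eq_inner
  using projectionD(3)[OF assms, of x x] projectionD(1)[OF assms, of x x]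
  by (simp add: inner_diff_left inner_diff_right)

lemma projection_norm_le: "projection P \<Longrightarrow> norm (bop_apply P x) \<le> norm x"
  by (rule power2_le_imp_le) (use projection_pythagoras[of P x] zero_le_power2[of "norm (x - bop_apply P x)"] in linarith, simp)

lemma projection_zero: "projection 0"
  by (simp add: projection_def adjoint_pair_zero)

lemma projection_compl: "projection P \<Longrightarrow> projection (1 - P)"
  by (auto simp: projection_def adjoint_pair_diff adjoint_pair_one bop_apply_diff projectionD(2) intro!: bop_eqI)

lemma projection_mult_swap:
  assumes "projection P" "projection Q" "P * Q = Q"
  shows "Q * P = Q"
proof -
  have "adjoint_pair (P * Q) (Q * P)"
    using assms(1,2) by (auto simp only: projection_def intro!: adjoint_pair_mult)
  then have "adj_op (P * Q) = Q * P" by (rule adj_op_eqI)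
  moreover have "adj_op Q = Q" using assms by (simp add: projection_def adj_op_eqI)
  ultimately show ?thesis using assms by simp
qed

text \<open>A minimising sequence for the distance to \<open>M\<close> is Cauchy by the
  parallelogram identity, because midpoints stay in \<open>M\<close>. Linearity of the nearest point
  map follows from its characterisation by orthogonality.\<close>

lemma projection_exists:
  fixes M :: "'a::chilbert_space set"
  assumes "closed M" "0 \<in> M" and add: "\<And>x y. x \<in> M \<Longrightarrow> y \<in> M \<Longrightarrow> x + y \<in> M"
    and sc: "\<And>c x. x \<in> M \<Longrightarrow> c *\<^sub>C x \<in> M"
  shows "\<exists>P. projection P \<and> (\<forall>x. bop_apply P x \<in> M) \<and> (\<forall>x\<in>M. bop_apply P x = x)"
proof -
  have scR: "r *\<^sub>R x \<in> M" if "x \<in> M" for r x using sc[OF that] by (simp add: scaleR_scaleC)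
  have diff: "x - y \<in> M" if "x \<in> M" "y \<in> M" for x y
    using add[OF that(1) scR[OF that(2), of "-1"]] by simp
  have ex: "\<exists>m. m \<in> M \<and> (\<forall>v\<in>M. (x - m) \<bullet> v = 0)" for x
  proof -
    define D where "D = (\<lambda>m. (norm (x - m))\<^sup>2)"
    define d where "d = (INF m\<in>M. D m)"
    have bdd: "bdd_below (D ` M)" by (rule bdd_belowI[of _ 0]) (auto simp: D_def)
    have dle: "d \<le> D m" if "m \<in> M" for m unfolding d_def using that bdd by (intro cINF_lower)
    have "\<exists>m\<in>M. D m < d + 1 / real (Suc n)" for n
    proof -
      have "(INF m\<in>M. D m) < d + 1 / real (Suc n)" by (simp add: d_def)
      moreover have "M \<noteq> {}" using assms(2) by auto
      ultimately show ?thesis using cINF_less_iff[OF _ bdd, of "d + 1 / real (Suc n)"] by simp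
    qed
    then obtain s where s: "\<And>n. s n \<in> M" "\<And>n. D (s n) < d + 1 / real (Suc n)" by metis
    have par: "(norm (m - n))\<^sup>2 \<le> 2 * (D m - d) + 2 * (D n - d)" if "m \<in> M" "n \<in> M" for m n
    proof -
      have "(1/2) *\<^sub>R (m + n) \<in> M" using that add scR by blast
      then have "4 * d \<le> 4 * D ((1/2) *\<^sub>R (m + n))" using dle by simp
      moreover have "4 * D ((1/2) *\<^sub>R (m + n)) + (norm (m - n))\<^sup>2 = 2 * D m + 2 * D n"
        unfolding D_def power2_norm_eq_inner
        by (simp add: inner_diff_left inner_diff_right inner_add_left inner_add_right inner_commute algebra_simps)
      moreover have "w \<le> 2 * (a - d) + 2 * (b - d)" if "4 * d \<le> 4 * t" "4 * t + w = 2 * a + 2 * b" for t w a b d :: real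
        using that by simp
      ultimately show ?thesis by blast
    qed
    have "Cauchy s"
      unfolding Cauchy_altdef2
    proof (intro allI impI)
      fix e :: real assume e: "e > 0"
      obtain N where N: "4 / e\<^sup>2 < real N" using reals_Archimedean2 by blast
      have "dist (s n) (s N) < e" if "n \<ge> N" for n
      proof -
        have "D (s n) - d < 1 / real (Suc N)"
        proof -
          have "1 / real (Suc n) \<le> 1 / real (Suc N)" using that by (simp add: frac_le)
          then show ?thesis using s(2)[of n] by linarith
        qed
        moreover have "D (s N) - d < 1 / real (Suc N)" using s(2)[of N] by linarith
        moreover have "(norm (s n - s N))\<^sup>2 \<le> 2 * (D (s n) - d) + 2 * (D (s N) - d)"
          by (rule par[OF s(1) s(1)])
        moreover have "w < 4 / real (Suc N)" if "a < 1 / real (Suc N)" "b < 1 / real (Suc N)" "w \<le> 2 * a + 2 * b" for a b w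
          using that by simp
        ultimately have "(norm (s n - s N))\<^sup>2 < 4 / real (Suc N)"
          by blast
        also have "\<dots> \<le> e\<^sup>2"
        proof -
          have "4 < real N * e\<^sup>2" using N e by (simp add: pos_divide_less_eq)
          also have "\<dots> \<le> real (Suc N) * e\<^sup>2" by (intro mult_right_mono) auto
          finally show ?thesis by (simp add: pos_divide_le_eq mult.commute)
        qed
        finally have "norm (s n - s N) < e" by (rule power2_less_imp_less) (use e in simp)
        then show ?thesis by (simp add: dist_norm)
      qed
      then show "\<exists>N. \<forall>n\<ge>N. dist (s n) (s N) < e" by blast
    qed
    then obtain m where m: "s \<longlonglongrightarrow> m" by (auto dest!: Cauchy_convergent simp: convergent_def)
    have mM: "m \<in> M" using closed_sequentially[OF assms(1)] s(1) m by blast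
    have "(\<lambda>n. D (s n)) \<longlonglongrightarrow> D m" unfolding D_def by (intro tendsto_intros m)
    moreover have "(\<lambda>n. d + 1 / real (Suc n)) \<longlonglongrightarrow> d + 0"
      by (intro tendsto_intros LIMSEQ_Suc[OF lim_1_over_n])
    ultimately have Dm: "D m \<le> d + 0"
      by (rule LIMSEQ_le) (use s(2) less_imp_le in blast)
    have "(x - m) \<bullet> v = 0" if v: "v \<in> M" for v
    proof (cases "v = 0")
      case False
      define r where "r = ((x - m) \<bullet> v) / (v \<bullet> v)"
      have "D m \<le> D (m + r *\<^sub>R v)" using Dm dle[OF add[OF mM scR[OF v, of r]]] by linarith
      also have "\<dots> = D m - 2 * r * ((x - m) \<bullet> v) + r\<^sup>2 * (v \<bullet> v)"
        using norm_diff_scaleR_sq[of "x - m" r v] by (simp add: D_def diff_diff_add)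
      also have "\<dots> = D m - ((x - m) \<bullet> v)\<^sup>2 / (v \<bullet> v)"
        using False by (simp add: r_def power2_eq_square field_simps)
      finally have "((x - m) \<bullet> v)\<^sup>2 / (v \<bullet> v) \<le> 0" by simp
      moreover have "0 < v \<bullet> v" using False by simp
      ultimately show ?thesis by (simp add: divide_le_0_iff)
    qed simp
    then show ?thesis using mM by blast
  qed
  define f where "f = (\<lambda>x. SOME m. m \<in> M \<and> (\<forall>v\<in>M. (x - m) \<bullet> v = 0))"
  have "f x \<in> M \<and> (\<forall>v\<in>M. (x - f x) \<bullet> v = 0)" for x
    unfolding f_def by (rule someI_ex[OF ex])
  then have f: "f x \<in> M" "v \<in> M \<Longrightarrow> (x - f x) \<bullet> v = 0" for x v
    by blast+
  have uniq: "f x = m" if "m \<in> M" "\<And>v. v \<in> M \<Longrightarrow> (x - m) \<bullet> v = 0" for x m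
  proof -
    have "(f x - m) \<bullet> (f x - m) = (x - m) \<bullet> (f x - m) - (x - f x) \<bullet> (f x - m)"
      by (simp add: inner_diff_left inner_diff_right)
    also have "\<dots> = 0" using f(2) that diff[OF f(1)[of x] that(1)] by simp
    finally show ?thesis by simp
  qed
  have "\<exists>P. \<forall>x. bop_apply P x = f x"
  proof (rule bop_exists)
    show "bounded_linear f"
    proof (rule bounded_linear_intro[where K = 1])
      show "f (x + y) = f x + f y" for x y
      proof (rule uniq)
        fix v assume v: "v \<in> M"
        have "(x + y - (f x + f y)) \<bullet> v = (x - f x) \<bullet> v + (y - f y) \<bullet> v"
          by (simp add: inner_diff_left inner_add_left)
        then show "(x + y - (f x + f y)) \<bullet> v = 0" using f(2)[OF v] by simp
      qed (simp add: add f)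
      show "f (r *\<^sub>R x) = r *\<^sub>R f x" for r x
        using f(2) by (intro uniq) (auto simp: scR f(1) simp flip: scaleR_diff_right)
      show "norm (f x) \<le> norm x * 1" for x
      proof -
        have "(norm x)\<^sup>2 = (norm (f x))\<^sup>2 + (norm (x - f x))\<^sup>2"
          using f(2)[OF f(1), of x x] unfolding power2_norm_eq_inner
          by (simp add: inner_diff_left inner_diff_right inner_commute)
        then have "(norm (f x))\<^sup>2 \<le> (norm x * 1)\<^sup>2" by simp
          then show ?thesis by (rule power2_le_imp_le) simp
      qed
    qed
    show "f (c *\<^sub>C x) = c *\<^sub>C f x" for c x
      using f(2) sc
      by (intro uniq) (auto simp: f(1) inner_scaleC_left simp flip: scaleC_diff_right)
  qed
  then obtain P where P: "\<And>x. bop_apply P x = f x" by blast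
  show ?thesis
  proof (intro exI[of _ P] conjI allI ballI)
    show "bop_apply P x \<in> M" for x by (simp add: P f)
    show PM: "bop_apply P x = x" if "x \<in> M" for x using that by (simp add: P uniq)
    have "f x \<bullet> y = x \<bullet> f y" for x y
      using f(2)[OF f(1)[of y], of x] f(2)[OF f(1)[of x], of y]
      by (simp add: inner_diff_left inner_commute[of y] inner_commute[of "f y" "f x"])
    then have "self_adjoint P" by (simp add: adjoint_pair_def P)
    moreover have "P * P = P"
      by (rule bop_eqI) (use PM f(1) in \<open>simp add: P\<close>)
    ultimately show "projection P" by (simp add: projection_def)
  qed
qed

section \<open>Functional calculus of a self-adjoint operator\<close>

lemma scaleC_of_real_bop: "complex_of_real t *\<^sub>C (T :: 'a::chilbert_space bop) = t *\<^sub>R T"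
  by (rule bop_eqI) (simp add: scaleR_scaleC)

lemma invertible_op_mult: "invertible_op S \<Longrightarrow> invertible_op T \<Longrightarrow> invertible_op (S * T)"
proof -
  assume "invertible_op S" "invertible_op T"
  then obtain S' T' where "S' * S = 1" "S * S' = 1" "T' * T = 1" "T * T' = 1"
    unfolding invertible_op_def by blast
  then have "(T' * S') * (S * T) = 1" "(S * T) * (T' * S') = 1"
    by (metis mult.assoc mult.left_neutral)+
  then show ?thesis unfolding invertible_op_def by blast
qed

lemma invertible_op_scaleR: "r \<noteq> 0 \<Longrightarrow> invertible_op T \<Longrightarrow> invertible_op (r *\<^sub>R T)"
proof -
  assume "r \<noteq> 0" "invertible_op T"
  then obtain S where "S * T = 1" "T * S = 1" unfolding invertible_op_def by blast
  then have "((1/r) *\<^sub>R S) * (r *\<^sub>R T) = 1" "(r *\<^sub>R T) * ((1/r) *\<^sub>R S) = 1"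
    using \<open>r \<noteq> 0\<close> by simp_all
  then show ?thesis unfolding invertible_op_def by blast
qed

lemma invertible_op_one: "invertible_op 1"
  unfolding invertible_op_def by (rule exI[of _ 1]) simp

subsection \<open>Polynomials in an operator\<close>

lemma poly_op_eq_sum: "degree p \<le> n \<Longrightarrow> poly_op p T = (\<Sum>i\<le>n. coeff p i *\<^sub>R T ^ i)"
  unfolding poly_op_def by (rule sum.mono_neutral_left) (auto simp: coeff_eq_0)

lemma poly_op_0 [simp]: "poly_op 0 T = 0"
  by (simp add: poly_op_def)

lemma poly_op_pCons: "poly_op (pCons a p) T = a *\<^sub>R 1 + T * poly_op p T"
proof -
  have "poly_op (pCons a p) T = (\<Sum>i\<le>Suc (degree p). coeff (pCons a p) i *\<^sub>R T ^ i)"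
    by (rule poly_op_eq_sum) (rule degree_pCons_le)
  also have "\<dots> = a *\<^sub>R 1 + T * poly_op p T"
    unfolding poly_op_def
    by (simp add: sum.atMost_Suc_shift sum_distrib_left del: sum.atMost_Suc)
  finally show ?thesis .
qed

lemma poly_op_add: "poly_op (p + q) T = poly_op p T + poly_op q T"
proof -
  let ?n = "max (degree p) (degree q)"
  have "poly_op p T = (\<Sum>i\<le>?n. coeff p i *\<^sub>R T ^ i)" "poly_op q T = (\<Sum>i\<le>?n. coeff q i *\<^sub>R T ^ i)"
    "poly_op (p + q) T = (\<Sum>i\<le>?n. coeff (p + q) i *\<^sub>R T ^ i)"
    by (intro poly_op_eq_sum; simp add: degree_add_le_max)+
  then show ?thesis by (simp add: scaleR_add_left sum.distrib)
qed

lemma poly_op_smult: "poly_op (smult c p) T = c *\<^sub>R poly_op p T"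
  using poly_op_eq_sum[OF degree_smult_le, of c p T] by (simp add: poly_op_def scaleR_sum_right)

lemma poly_op_diff: "poly_op (p - q) T = poly_op p T - poly_op q T"
  using poly_op_add[of p "smult (-1) q" T] poly_op_smult[of "-1" q T] by simp

lemma poly_op_mult: "poly_op (p * q) T = poly_op p T * poly_op q T"
  by (induction p) (simp_all add: poly_op_pCons poly_op_add poly_op_smult algebra_simps)

lemma poly_op_commute: "S * T = T * S \<Longrightarrow> S * poly_op p T = poly_op p T * S"
proof (induction p)
  case (pCons a p)
  then have "S * (T * poly_op p T) = T * poly_op p T * S" by (metis mult.assoc)
  then show ?case by (simp add: poly_op_pCons algebra_simps)
qed simp

lemma self_adjoint_poly_op: "self_adjoint T \<Longrightarrow> self_adjoint (poly_op p T)"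
  unfolding poly_op_def by (intro adjoint_pair_intros)

subsection \<open>The norm of a polynomial is attained on the spectrum\<close>

lemma poly_map_of_real_add:
  "poly (map_poly complex_of_real (p + q)) z = poly (map_poly of_real p) z + poly (map_poly of_real q) z"
  by (induction p q rule: poly_induct2) (simp_all add: map_poly_pCons algebra_simps)

lemma poly_map_of_real_smult:
  "poly (map_poly complex_of_real (smult c p)) z = of_real c * poly (map_poly of_real p) z"
  by (induction p) (simp_all add: map_poly_pCons algebra_simps)

lemma poly_map_of_real_mult:
  "poly (map_poly complex_of_real (p * q)) z = poly (map_poly of_real p) z * poly (map_poly of_real q) z"
  by (induction p) (simp_all add: map_poly_pCons poly_map_of_real_add poly_map_of_real_smult algebra_simps)

lemma poly_map_of_real:
  "poly (map_poly complex_of_real p) (of_real t) = of_real (poly p t)"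
  by (induction p) (simp_all add: map_poly_pCons)

text \<open>The quadratic factor is \<open>(t - x)^2 + y^2\<close>, which becomes coercive when a
  self-adjoint operator replaces \<open>t\<close>; only real roots can then obstruct
  invertibility.\<close>

lemma real_poly_factor:
  fixes q :: "real poly"
  assumes "degree q > 0"
  obtains t s where "q = [:-t, 1:] * s" | x y s where "y \<noteq> 0" "q = [:x\<^sup>2 + y\<^sup>2, - 2 * x, 1:] * s"
proof -
  have "\<not> constant (poly (map_poly complex_of_real q))"
    using assms by (simp add: constant_degree degree_map_poly)
  then obtain z where z: "poly (map_poly complex_of_real q) z = 0"
    using fundamental_theorem_of_algebra by blast
  show thesis
  proof (cases "Im z = 0")
    case True
    then have "z = of_real (Re z)" by (simp add: complex_eq_iff)
    then have "complex_of_real (poly q (Re z)) = 0"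
      using z by (metis poly_map_of_real)
    then have "[:- Re z, 1:] dvd q" by (simp add: poly_eq_0_iff_dvd)
    then show thesis using that(1) by (auto elim!: dvdE)
  next
    case False
    define d where "d = [:(Re z)\<^sup>2 + (Im z)\<^sup>2, - 2 * Re z, 1:]"
    define r where "r = q mod d"
    have d0: "d \<noteq> 0" and deg: "degree d = 2" by (simp_all add: d_def)
    have q: "q = d * (q div d) + r" by (simp add: r_def)
    have dz: "poly (map_poly complex_of_real d) z = 0"
      by (simp add: d_def map_poly_pCons complex_eq_iff power2_eq_square algebra_simps)
    have "degree r < 2" using degree_mod_less[OF d0, of q] deg by (auto simp: r_def)
    then have r: "r = [:coeff r 0, coeff r 1:]"
      by (intro poly_eqI) (auto simp: coeff_pCons coeff_eq_0 split: nat.split)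
    have "poly (map_poly complex_of_real r) z = 0"
      using z by (subst (asm) q) (simp add: poly_map_of_real_add poly_map_of_real_mult dz)
    then have "complex_of_real (coeff r 0) + z * complex_of_real (coeff r 1) = 0"
      by (subst (asm) r) (simp add: map_poly_pCons)
    then have "coeff r 1 = 0" "coeff r 0 = 0"
      using False by (auto simp: complex_eq_iff)
    then have "r = 0" by (subst r) simp
    then have "q = d * (q div d)" by (metis q add.right_neutral)
    from that(2)[OF False this[unfolded d_def]] show thesis .
  qed
qed

text \<open>One half of the spectral mapping theorem, restricted to the real points of the spectrum:
  linear factors are invertible off the spectrum, quadratic ones by coercivity.\<close>

lemma poly_op_invertible:
  fixes T :: "'a::chilbert_space bop"
  assumes T: "self_adjoint T"
  shows "q \<noteq> 0 \<Longrightarrow> (\<And>t. complex_of_real t \<in> spectrum T \<Longrightarrow> poly q t \<noteq> 0) \<Longrightarrow> invertible_op (poly_op q T)"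
proof (induction "degree q" arbitrary: q rule: less_induct)
  case less
  show ?case
  proof (cases "degree q = 0")
    case True
    then obtain c where "q = [:c:]" by (rule degree_eq_zeroE)
    then show ?thesis using less.prems
      by (auto simp: poly_op_pCons intro: invertible_op_scaleR invertible_op_one)
  next
    case False
    have step: "invertible_op (poly_op q T)"
      if inv: "invertible_op (poly_op d T)" and q: "q = d * s" and d: "degree d > 0" for d s
    proof -
      have "s \<noteq> 0" "d \<noteq> 0" using q less.prems(1) by auto
      then have "degree s < degree q" using q d by (simp add: degree_mult_eq)
      moreover have "poly s t \<noteq> 0" if "complex_of_real t \<in> spectrum T" for t
        using less.prems(2)[OF that] q by auto
      ultimately have "invertible_op (poly_op s T)"
        using less.hyps \<open>s \<noteq> 0\<close> by blast
      then show ?thesis unfolding q poly_op_mult by (rule invertible_op_mult[OF inv])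
    qed
    from False have "degree q > 0" by simp
    then show ?thesis
    proof (cases rule: real_poly_factor)
      case (1 t s)
      have "complex_of_real t \<notin> spectrum T" using less.prems(2)[of t] 1 by auto
      then have "invertible_op (T - t *\<^sub>R 1)"
        by (simp add: spectrum_def scaleC_of_real_bop)
      then have "invertible_op (poly_op [:-t, 1:] T)"
        by (simp add: poly_op_pCons algebra_simps)
      then show ?thesis by (rule step[OF _ 1]) simp
    next
      case (2 x y s)
      let ?S = "T - x *\<^sub>R 1"
      have S: "self_adjoint ?S" by (intro adjoint_pair_intros T)
      have eq: "poly_op [:x\<^sup>2 + y\<^sup>2, - 2 * x, 1:] T = ?S * ?S + y\<^sup>2 *\<^sub>R 1"
        by (rule bop_eqI, simp add: poly_op_pCons bop_apply_diff bop_apply_add bop_apply_scaleR bop_apply_minus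
            algebra_simps power2_eq_square,
            simp flip: scaleR_add_left)
      have "invertible_op (poly_op [:x\<^sup>2 + y\<^sup>2, - 2 * x, 1:] T)"
        unfolding eq
      proof (rule coercive_invertible)
        show "0 < y\<^sup>2" using 2 by simp
        show "y\<^sup>2 * (norm v)\<^sup>2 \<le> v \<bullet> bop_apply (?S * ?S + y\<^sup>2 *\<^sub>R 1) v" for v
          using self_adjoint_norm_sq[OF S, of v] zero_le_power2[of "norm (bop_apply ?S v)"]
          unfolding bop_apply_simps(3) inner_add_right by (simp add: dot_square_norm)
      qed
      then show ?thesis by (rule step[OF _ 2(2)]) simp
    qed
  qed
qed

text \<open>With \<open>\<nu> = norm Y\<close> and \<open>w = Y (Y x) - \<nu>^2 x\<close>, expanding
  gives \<open>|w|^2 \<le> \<nu>^2 (\<nu>^2 |x|^2 - |Y x|^2)\<close>. A left inverse bounds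
  \<open>|x|\<close> by a multiple of \<open>|w|\<close>, so
  \<open>|Y x|^2 \<le> (\<nu>^2 - 1 / C) |x|^2\<close>, which contradicts the choice of
  \<open>\<nu>\<close>.\<close>

lemma not_invertible_at_norm:
  fixes Y :: "'a::chilbert_space bop"
  assumes Y: "self_adjoint Y" and "norm Y > 0"
  shows "\<not> invertible_op (Y * Y - (norm Y)\<^sup>2 *\<^sub>R 1)"
proof
  assume "invertible_op (Y * Y - (norm Y)\<^sup>2 *\<^sub>R 1)"
  then obtain S where S: "S * (Y * Y - (norm Y)\<^sup>2 *\<^sub>R 1) = 1" unfolding invertible_op_def by blast
  define \<nu> where "\<nu> = norm Y"
  have \<nu>: "\<nu> > 0" using assms \<nu>_def by simp
  define C where "C = (norm S)\<^sup>2 * \<nu>\<^sup>2 + 1"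
  have C: "C > 0" unfolding C_def by (intro add_nonneg_pos) auto
  have key: "(norm x)\<^sup>2 \<le> C * (\<nu>\<^sup>2 * (norm x)\<^sup>2 - (norm (bop_apply Y x))\<^sup>2)" for x
  proof -
    let ?w = "bop_apply Y (bop_apply Y x) - \<nu>\<^sup>2 *\<^sub>R x"
    have "bop_apply S ?w = bop_apply (S * (Y * Y - (norm Y)\<^sup>2 *\<^sub>R 1)) x"
      by (simp add: \<nu>_def)
    then have "x = bop_apply S ?w" using S by simp
    then have "norm x \<le> norm S * norm ?w" using norm_bop_apply by metis
    then have "(norm x)\<^sup>2 \<le> (norm S)\<^sup>2 * (norm ?w)\<^sup>2"
      by (metis norm_ge_zero power_mono power_mult_distrib)
    also have "(norm ?w)\<^sup>2 \<le> \<nu>\<^sup>2 * (\<nu>\<^sup>2 * (norm x)\<^sup>2 - (norm (bop_apply Y x))\<^sup>2)"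
    proof -
      have "bop_apply Y (bop_apply Y x) \<bullet> x = (norm (bop_apply Y x))\<^sup>2"
        using Y by (simp add: adjoint_pair_def dot_square_norm)
      then have "(norm ?w)\<^sup>2 = (norm (bop_apply Y (bop_apply Y x)))\<^sup>2 - 2 * \<nu>\<^sup>2 * (norm (bop_apply Y x))\<^sup>2 + \<nu>\<^sup>2 * (\<nu>\<^sup>2 * (norm x)\<^sup>2)"
        unfolding norm_diff_scaleR_sq dot_square_norm by simp
      moreover have "(norm (bop_apply Y (bop_apply Y x)))\<^sup>2 \<le> \<nu>\<^sup>2 * (norm (bop_apply Y x))\<^sup>2"
        using norm_bop_apply[of Y "bop_apply Y x"] unfolding \<nu>_def
        by (metis norm_ge_zero power_mono power_mult_distrib)
      ultimately show ?thesis by (simp add: algebra_simps)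
    qed
    finally have "(norm x)\<^sup>2 \<le> (norm S)\<^sup>2 * (\<nu>\<^sup>2 * (\<nu>\<^sup>2 * (norm x)\<^sup>2 - (norm (bop_apply Y x))\<^sup>2))"
      by (simp add: mult_left_mono)
    moreover have "(norm (bop_apply Y x))\<^sup>2 \<le> \<nu>\<^sup>2 * (norm x)\<^sup>2"
      using norm_bop_apply[of Y x] unfolding \<nu>_def
      by (metis norm_ge_zero power_mono power_mult_distrib)
    ultimately show ?thesis by (simp add: C_def algebra_simps)
  qed
  \<comment> \<open>The maximum keeps the square root meaningful if the difference is
    negative.\<close>
  define k where "k = max 0 (\<nu>\<^sup>2 - 1 / C)"
  have k: "0 \<le> k" "k < \<nu>\<^sup>2" using \<nu> C by (auto simp: k_def)
  have "norm Y \<le> sqrt k"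
  proof (rule norm_bop_le)
    show "norm (bop_apply Y x) \<le> sqrt k * norm x" for x
    proof (rule power2_le_imp_le)
      have "(norm (bop_apply Y x))\<^sup>2 \<le> (\<nu>\<^sup>2 - 1 / C) * (norm x)\<^sup>2"
        using key[of x] C by (simp add: field_simps)
      also have "\<dots> \<le> k * (norm x)\<^sup>2" by (intro mult_right_mono) (auto simp: k_def)
      finally show "(norm (bop_apply Y x))\<^sup>2 \<le> (sqrt k * norm x)\<^sup>2"
        using k by (simp add: power_mult_distrib)
    qed (use k in simp)
  qed (use k in simp)
  moreover have "sqrt k < \<nu>" using k \<nu> real_less_lsqrt by simp
  ultimately show False by (simp add: \<nu>_def)
qed

lemma real_spectrum_nonempty:
  fixes T :: "'a::chilbert_space bop"
  assumes T: "self_adjoint T" and nz: "(1 :: 'a bop) \<noteq> 0"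
  shows "\<exists>t. complex_of_real t \<in> spectrum T"
proof (cases "T = 0")
  case True
  have "\<not> invertible_op (0 :: 'a bop)" using nz by (simp add: invertible_op_def)
  then have "complex_of_real 0 \<in> spectrum T" using True by (simp add: spectrum_def scaleC_of_real_bop del: of_real_0)
  then show ?thesis by blast
next
  case False
  define q where "q = [:- (norm T)\<^sup>2, 0, 1:]"
  have "poly_op q T = T * T - (norm T)\<^sup>2 *\<^sub>R 1"
    by (simp add: q_def poly_op_pCons)
  then have "\<not> invertible_op (poly_op q T)"
    using not_invertible_at_norm[OF T] False by simp
  moreover have "q \<noteq> 0" by (simp add: q_def)
  ultimately show ?thesis using poly_op_invertible[OF T] by blast
qed

text \<open>If the norm \<open>\<nu>\<close> exceeded \<open>e\<close>, the polynomial
  \<open>p^2 - \<nu>^2\<close> would have no zero on the real spectrum and would be invertible at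
  \<open>T\<close>, against \<open>not_invertible_at_norm\<close>.\<close>

lemma norm_poly_op_le:
  fixes T :: "'a::chilbert_space bop"
  assumes T: "self_adjoint T" and "0 \<le> e"
    and e: "\<And>t. complex_of_real t \<in> spectrum T \<Longrightarrow> \<bar>poly p t\<bar> \<le> e"
  shows "norm (poly_op p T) \<le> e"
proof (rule ccontr)
  assume *: "\<not> norm (poly_op p T) \<le> e"
  define \<nu> where "\<nu> = norm (poly_op p T)"
  have \<nu>: "\<nu> > e" "\<nu> > 0" using * \<open>0 \<le> e\<close> by (auto simp: \<nu>_def)
  define q where "q = p * p - [:\<nu>\<^sup>2:]"
  have q: "poly q t \<noteq> 0" if "complex_of_real t \<in> spectrum T" for t
  proof -
    have "(poly p t)\<^sup>2 \<le> e\<^sup>2" using e[OF that] \<open>0 \<le> e\<close> by (simp add: abs_le_square_iff[symmetric])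
    also have "\<dots> < \<nu>\<^sup>2" using \<nu> \<open>0 \<le> e\<close> by (simp add: power_strict_mono)
    finally show ?thesis by (simp add: q_def power2_eq_square)
  qed
  \<comment> \<open>On the zero space every operator is invertible and the spectrum is empty;
    excluding that case supplies a spectral point at which \<open>q\<close> is nonzero.\<close>
  have "(1 :: 'a bop) \<noteq> 0"
  proof
    assume "(1 :: 'a bop) = 0"
    then have "poly_op p T = 0" by (metis mult.right_neutral mult_zero_right)
    then show False using \<nu> by (simp add: \<nu>_def)
  qed
  then have "q \<noteq> 0" using real_spectrum_nonempty[OF T] q by auto
  then have "invertible_op (poly_op q T)" using poly_op_invertible[OF T] q by blast
  moreover have "poly_op q T = poly_op p T * poly_op p T - \<nu>\<^sup>2 *\<^sub>R 1"
    by (simp add: q_def poly_op_diff poly_op_mult poly_op_pCons)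
  ultimately show False
    using not_invertible_at_norm[OF self_adjoint_poly_op[OF T, of p]] \<nu>(2) by (simp add: \<nu>_def)
qed

subsection \<open>Continuous functions of an operator\<close>

text \<open>Bounds on the quadratic form locate the spectrum in an interval, where polynomial
  approximation is available; such bounds also survive a unital positive map.\<close>

definition numerical_bounds :: "real \<Rightarrow> real \<Rightarrow> 'a::chilbert_space bop \<Rightarrow> bool"
  where "numerical_bounds l u T \<longleftrightarrow> self_adjoint T \<and>
    (\<forall>x. l * (norm x)\<^sup>2 \<le> x \<bullet> bop_apply T x \<and> x \<bullet> bop_apply T x \<le> u * (norm x)\<^sup>2)"

lemma spectrum_numerical_bounds:
  assumes T: "numerical_bounds l u T" and t: "complex_of_real t \<in> spectrum T"
  shows "t \<in> {l..u}"
proof (rule ccontr)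
  assume "t \<notin> {l..u}"
  then consider "t < l" | "t > u" by force
  then have "invertible_op (T - t *\<^sub>R 1)"
  proof cases
    case 1
    have "(l - t) * (norm x)\<^sup>2 \<le> x \<bullet> bop_apply (T - t *\<^sub>R 1) x" for x
      using T by (simp add: numerical_bounds_def inner_diff_right dot_square_norm algebra_simps)
    then show ?thesis by (rule coercive_invertible[rotated]) (use 1 in simp)
  next
    case 2
    have "(t - u) * (norm x)\<^sup>2 \<le> x \<bullet> bop_apply (- 1 *\<^sub>R (T - t *\<^sub>R 1)) x" for x
      using T by (simp add: numerical_bounds_def inner_diff_right dot_square_norm algebra_simps)
    then have "invertible_op (- 1 *\<^sub>R (T - t *\<^sub>R 1))" by (rule coercive_invertible[rotated]) (use 2 in simp)
    from invertible_op_scaleR[OF _ this, of "-1"] show ?thesis by simp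
  qed
  then show False using t by (simp add: spectrum_def scaleC_of_real_bop)
qed

lemma polynomials_dense:
  fixes f :: "real \<Rightarrow> real"
  assumes "continuous_on {l..u} f"
  obtains p where "uniform_limit {l..u} (\<lambda>n. poly (p n)) f sequentially"
proof -
  obtain g where g: "uniform_limit {l..u} g f sequentially" "\<And>n::nat. polynomial_function (g n)"
    using Stone_Weierstrass_uniform_limit[OF compact_Icc assms] by blast
  have "\<exists>p. g n = poly p" for n
  proof -
    have "real_polynomial_function (g n)" using g(2) by (simp add: real_polynomial_function_eq)
    then obtain a N where "g n = (\<lambda>x. \<Sum>i\<le>N. a i * x ^ i)"
      by (auto simp: real_polynomial_function_iff_sum)
    then have "g n = poly (\<Sum>i\<le>N. monom (a i) i)" by (auto simp: poly_sum poly_monom)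
    then show ?thesis by blast
  qed
  then obtain p where "g = (\<lambda>n. poly (p n))" by metis
  then show thesis using g(1) that by blast
qed

text \<open>This discharges the definite description in \<open>cfc\<close>. By
  \<open>norm_poly_op_le\<close>, any two sequences approximating \<open>f\<close> on the spectrum
  have operator values with difference tending to 0, so the limit exists and is common; the given
  sequence shows that it is unique.\<close>

lemma cfc_tendsto:
  fixes T :: "'a::chilbert_space bop"
  assumes T: "numerical_bounds l u T"
    and p: "uniform_limit {l..u} (\<lambda>n. poly (p n)) f sequentially"
  shows "(\<lambda>n. poly_op (p n) T) \<longlonglongrightarrow> cfc f T"
proof -
  have sa: "self_adjoint T" using T by (simp add: numerical_bounds_def)
  let ?\<sigma> = "{t. complex_of_real t \<in> spectrum T}"
  have sub: "?\<sigma> \<subseteq> {l..u}" using spectrum_numerical_bounds[OF T] by blast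
  have p\<sigma>: "uniform_limit ?\<sigma> (\<lambda>n. poly (p n)) f sequentially" by (rule uniform_limit_on_subset[OF p sub])
  have close: "\<exists>N. \<forall>m\<ge>N. \<forall>n\<ge>N. norm (poly_op (q m) T - poly_op (p n) T) < e"
    if q: "uniform_limit ?\<sigma> (\<lambda>n. poly (q n)) f sequentially" and e: "e > 0" for q e
  proof -
    have "\<forall>\<^sub>F n in sequentially. \<forall>t\<in>?\<sigma>. dist (poly (q n) t) (f t) < e / 4"
      "\<forall>\<^sub>F n in sequentially. \<forall>t\<in>?\<sigma>. dist (poly (p n) t) (f t) < e / 4"
      using uniform_limitD[OF q, of "e / 4"] uniform_limitD[OF p\<sigma>, of "e / 4"] e by simp_all
    then obtain N1 N2 where N: "\<And>n t. n \<ge> N1 \<Longrightarrow> t \<in> ?\<sigma> \<Longrightarrow> dist (poly (q n) t) (f t) < e / 4"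
      "\<And>n t. n \<ge> N2 \<Longrightarrow> t \<in> ?\<sigma> \<Longrightarrow> dist (poly (p n) t) (f t) < e / 4"
      unfolding eventually_sequentially by blast
    have "norm (poly_op (q m) T - poly_op (p n) T) < e" if "m \<ge> max N1 N2" "n \<ge> max N1 N2" for m n
    proof -
      have "norm (poly_op (q m - p n) T) \<le> e / 2"
      proof (rule norm_poly_op_le[OF sa])
        fix t assume t: "complex_of_real t \<in> spectrum T"
        have "\<bar>a - b\<bar> \<le> e / 2" if "\<bar>a - c\<bar> < e / 4" "\<bar>b - c\<bar> < e / 4" for a b c
          using that by linarith
        then show "\<bar>poly (q m - p n) t\<bar> \<le> e / 2"
          using N[of m t] N[of n t] t that by (simp add: dist_real_def)
      qed (use e in simp)
      then show ?thesis using e by (simp add: poly_op_diff)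
    qed
    then show ?thesis by blast
  qed
  have "Cauchy (\<lambda>n. poly_op (p n) T)"
    unfolding Cauchy_def dist_norm using close[OF p\<sigma>] by blast
  then obtain S where S: "(\<lambda>n. poly_op (p n) T) \<longlonglongrightarrow> S"
    by (auto dest!: Cauchy_convergent simp: convergent_def)
  have all: "(\<lambda>n. poly_op (q n) T) \<longlonglongrightarrow> S"
    if q: "uniform_limit ?\<sigma> (\<lambda>n. poly (q n)) f sequentially" for q
  proof -
    have "(\<lambda>n. poly_op (q n) T - poly_op (p n) T) \<longlonglongrightarrow> 0"
      unfolding lim_sequentially dist_norm using close[OF q] by (metis diff_zero)
    from tendsto_add[OF this S] show ?thesis by simp
  qed
  have "cfc f T = S"
    unfolding cfc_def
  proof (rule the_equality)
    show "\<forall>q. uniform_limit ?\<sigma> (\<lambda>n. poly (q n)) f sequentially \<longrightarrow> (\<lambda>n. poly_op (q n) T) \<longlonglongrightarrow> S"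
      using all by blast
    show "R = S" if "\<forall>q. uniform_limit ?\<sigma> (\<lambda>n. poly (q n)) f sequentially \<longrightarrow> (\<lambda>n. poly_op (q n) T) \<longlonglongrightarrow> R" for R
      using that p\<sigma> S LIMSEQ_unique by blast
  qed
  then show ?thesis using S by simp
qed

context
  fixes T :: "'a::chilbert_space bop" and l u :: real
  assumes T: "numerical_bounds l u T"
begin

private lemma bounded_image: "continuous_on {l..u} f \<Longrightarrow> bounded (f ` {l..u})" for f :: "real \<Rightarrow> real"
  by (intro compact_imp_bounded compact_continuous_image compact_Icc)

private lemma poly_add_fun: "poly (p + q) = (\<lambda>x. poly p x + poly q x)" for p q :: "real poly"
  by (simp add: fun_eq_iff)

private lemma poly_mult_fun: "poly (p * q) = (\<lambda>x. poly p x * poly q x)" for p q :: "real poly"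
  by (simp add: fun_eq_iff)

lemma cfc_poly: "cfc (poly p) T = poly_op p T"
  using cfc_tendsto[OF T, of "\<lambda>_. p" "poly p"] by (simp add: LIMSEQ_const_iff uniform_limit_const)

lemma cfc_cong: 
  assumes "continuous_on {l..u} f" "\<And>t. t \<in> {l..u} \<Longrightarrow> f t = g t"
  shows "cfc f T = cfc g T"
proof -
  obtain p where p: "uniform_limit {l..u} (\<lambda>n. poly (p n)) f sequentially"
    using polynomials_dense[OF assms(1)] .
  then have "uniform_limit {l..u} (\<lambda>n. poly (p n)) g sequentially"
    using assms(2) by (subst uniform_limit_cong'[of _ _ _ _ f]) auto
  then show ?thesis using cfc_tendsto[OF T] p LIMSEQ_unique by blast
qed

lemma cfc_add:
  assumes f: "continuous_on {l..u} f" and g: "continuous_on {l..u} g"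
  shows "cfc (\<lambda>t. f t + g t) T = cfc f T + cfc g T"
proof -
  obtain p where p: "uniform_limit {l..u} (\<lambda>n. poly (p n)) f sequentially"
    using polynomials_dense[OF f] .
  obtain q where q: "uniform_limit {l..u} (\<lambda>n. poly (q n)) g sequentially"
    using polynomials_dense[OF g] .
  have "uniform_limit {l..u} (\<lambda>n. poly (p n + q n)) (\<lambda>t. f t + g t) sequentially"
    using uniform_limit_add[OF p q] by (simp add: poly_add_fun)
  from cfc_tendsto[OF T this]
  have "(\<lambda>n. poly_op (p n) T + poly_op (q n) T) \<longlonglongrightarrow> cfc (\<lambda>t. f t + g t) T"
    by (simp add: poly_op_add)
  moreover have "(\<lambda>n. poly_op (p n) T + poly_op (q n) T) \<longlonglongrightarrow> cfc f T + cfc g T"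
    by (intro tendsto_add cfc_tendsto[OF T] p q)
  ultimately show ?thesis by (rule LIMSEQ_unique)
qed

lemma cfc_mult:
  assumes f: "continuous_on {l..u} f" and g: "continuous_on {l..u} g"
  shows "cfc (\<lambda>t. f t * g t) T = cfc f T * cfc g T"
proof -
  obtain p where p: "uniform_limit {l..u} (\<lambda>n. poly (p n)) f sequentially"
    using polynomials_dense[OF f] .
  obtain q where q: "uniform_limit {l..u} (\<lambda>n. poly (q n)) g sequentially"
    using polynomials_dense[OF g] .
  have "uniform_limit {l..u} (\<lambda>n. poly (p n * q n)) (\<lambda>t. f t * g t) sequentially"
    using uniform_lim_mult[OF p q bounded_image[OF f] bounded_image[OF g]] by (simp add: poly_mult_fun)
  from cfc_tendsto[OF T this]
  have "(\<lambda>n. poly_op (p n) T * poly_op (q n) T) \<longlonglongrightarrow> cfc (\<lambda>t. f t * g t) T"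
    by (simp add: poly_op_mult)
  moreover have "(\<lambda>n. poly_op (p n) T * poly_op (q n) T) \<longlonglongrightarrow> cfc f T * cfc g T"
    by (intro tendsto_mult cfc_tendsto[OF T] p q)
  ultimately show ?thesis by (rule LIMSEQ_unique)
qed

lemma cfc_const: "cfc (\<lambda>t. c) T = c *\<^sub>R 1"
proof -
  have "(\<lambda>t::real. c) = poly [:c:]" by (simp add: fun_eq_iff)
  then show ?thesis by (simp only: cfc_poly) (simp add: poly_op_pCons)
qed

lemma cfc_id: "cfc (\<lambda>t. t) T = T"
proof -
  have "(\<lambda>t::real. t) = poly [:0, 1:]" by (simp add: fun_eq_iff)
  then show ?thesis by (simp only: cfc_poly) (simp add: poly_op_pCons)
qed

lemma cfc_cmult: "continuous_on {l..u} f \<Longrightarrow> cfc (\<lambda>t. c * f t) T = c *\<^sub>R cfc f T"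
  using cfc_mult[of "\<lambda>_. c" f] by (simp add: cfc_const)

lemma cfc_diff:
  assumes "continuous_on {l..u} f" "continuous_on {l..u} g"
  shows "cfc (\<lambda>t. f t - g t) T = cfc f T - cfc g T"
  using cfc_add[of f "\<lambda>t. (-1) * g t"] cfc_cmult[of g "-1"] assms
  by (simp add: continuous_on_minus)

lemma cfc_commute:
  assumes f: "continuous_on {l..u} f" and S: "S * T = T * S"
  shows "S * cfc f T = cfc f T * S"
proof -
  obtain p where p: "uniform_limit {l..u} (\<lambda>n. poly (p n)) f sequentially"
    using polynomials_dense[OF f] .
  have "(\<lambda>n. S * poly_op (p n) T) \<longlonglongrightarrow> S * cfc f T"
    by (intro tendsto_mult_left cfc_tendsto[OF T] p)
  moreover have "(\<lambda>n. S * poly_op (p n) T) \<longlonglongrightarrow> cfc f T * S"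
    unfolding poly_op_commute[OF S] by (intro tendsto_mult_right cfc_tendsto[OF T] p)
  ultimately show ?thesis by (rule LIMSEQ_unique)
qed

lemma self_adjoint_cfc:
  assumes f: "continuous_on {l..u} f"
  shows "self_adjoint (cfc f T)"
proof -
  obtain p where p: "uniform_limit {l..u} (\<lambda>n. poly (p n)) f sequentially"
    using polynomials_dense[OF f] .
  show ?thesis
    by (rule adjoint_pair_tendsto[OF cfc_tendsto[OF T p] cfc_tendsto[OF T p]])
      (use T in \<open>simp add: numerical_bounds_def self_adjoint_poly_op\<close>)
qed

lemma positive_op_cfc:
  assumes f: "continuous_on {l..u} f" and nonneg: "\<And>t. t \<in> {l..u} \<Longrightarrow> 0 \<le> f t"
  shows "positive_op (cfc f T)"
proof -
  have s: "continuous_on {l..u} (\<lambda>t. sqrt (f t))" by (intro continuous_intros f)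
  have "cfc f T = cfc (\<lambda>t. sqrt (f t) * sqrt (f t)) T"
    by (rule cfc_cong[OF f]) (use nonneg in simp)
  also have "\<dots> = cfc (\<lambda>t. sqrt (f t)) T * cfc (\<lambda>t. sqrt (f t)) T"
    by (rule cfc_mult[OF s s])
  finally have eq: "cfc f T = cfc (\<lambda>t. sqrt (f t)) T * cfc (\<lambda>t. sqrt (f t)) T" .
  show ?thesis
    unfolding positive_op_iff
    using self_adjoint_cfc[OF f] self_adjoint_norm_sq[OF self_adjoint_cfc[OF s]] eq
    by (metis zero_le_power2)
qed

lemma cfc_mono:
  assumes f: "continuous_on {l..u} f" and g: "continuous_on {l..u} g"
    and le: "\<And>t. t \<in> {l..u} \<Longrightarrow> f t \<le> g t"
  shows "cfc f T \<le> cfc g T"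
  unfolding less_eq_bop_def cfc_diff[OF g f, symmetric]
  by (rule positive_op_cfc) (use le in \<open>auto intro!: continuous_intros f g\<close>)

end

subsection \<open>The absolute value\<close>

text \<open>The adjoint comes in as \<open>T'\<close>. The commutation clause is what makes the
  positive factor in \<open>nest_qr\<close> respect the blocks.\<close>

lemma abs_op_properties:
  fixes T :: "'a::chilbert_space bop"
  assumes T: "adjoint_pair T T'"
  shows "positive_op (abs_op T)" "abs_op T * abs_op T = T' * T"
    "norm (bop_apply (abs_op T) x) = norm (bop_apply T x)"
    "S * (T' * T) = T' * T * S \<Longrightarrow> S * abs_op T = abs_op T * S"
proof -
  let ?Y = "T' * T"
  have TT: "x \<bullet> bop_apply ?Y x = (norm (bop_apply T x))\<^sup>2" for x
    using T by (simp add: adjoint_pair_def dot_square_norm[symmetric])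
  have saY: "self_adjoint ?Y" by (intro adjoint_pair_mult T adjoint_pair_sym[OF T])
  have Y: "numerical_bounds 0 ((norm T)\<^sup>2) ?Y"
    unfolding numerical_bounds_def
  proof (intro conjI allI saY)
    fix x
    show "0 * (norm x)\<^sup>2 \<le> x \<bullet> bop_apply ?Y x" unfolding TT by simp
    show "x \<bullet> bop_apply ?Y x \<le> (norm T)\<^sup>2 * (norm x)\<^sup>2" unfolding TT power_mult_distrib[symmetric]
      by (rule power_mono[OF norm_bop_apply norm_ge_zero])
  qed
  define f :: "real \<Rightarrow> real" where "f = (\<lambda>t. t powr (1/2))"
  have cont: "continuous_on {0..(norm T)\<^sup>2} f"
    unfolding f_def by (intro continuous_on_powr' continuous_intros) auto
  have G: "abs_op T = cfc f ?Y"
    by (simp add: abs_op_def powr_op_def f_def adj_op_eqI[OF T])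
  show "S * abs_op T = abs_op T * S" if "S * ?Y = ?Y * S"
    unfolding G by (rule cfc_commute[OF Y cont that])
  show pos: "positive_op (abs_op T)"
    unfolding G by (rule positive_op_cfc[OF Y cont]) (simp add: f_def)
  have "abs_op T * abs_op T = cfc (\<lambda>t. f t * f t) ?Y"
    unfolding G by (rule cfc_mult[OF Y cont cont, symmetric])
  also have "\<dots> = cfc (\<lambda>t. t) ?Y"
    by (rule cfc_cong[OF Y continuous_on_mult[OF cont cont]]) (simp add: f_def powr_half_sqrt)
  finally show sq: "abs_op T * abs_op T = ?Y" by (simp add: cfc_id[OF Y])
  have "(norm (bop_apply (abs_op T) x))\<^sup>2 = (norm (bop_apply T x))\<^sup>2"
    using self_adjoint_norm_sq[of "abs_op T" x] pos unfolding sq TT by (simp add: positive_op_iff)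
  then show "norm (bop_apply (abs_op T) x) = norm (bop_apply T x)" by simp
qed

subsection \<open>Spectral projections\<close>

text \<open>The projection onto the spectral subspace for \<open>[c, \<infinity>)\<close> is the one onto the kernel of
  the negative part of \<open>T - c\<close>.\<close>

lemma spectral_projections:
  fixes T :: "'a::chilbert_space bop"
  assumes T: "numerical_bounds l u T"
  obtains F where "\<And>c. projection (F c)" "\<And>c. F c * T = T * F c"
    "\<And>c x. bop_apply (F c) x = x \<Longrightarrow> c * (norm x)\<^sup>2 \<le> x \<bullet> bop_apply T x"
    "\<And>c x. bop_apply (F c) x = 0 \<Longrightarrow> x \<bullet> bop_apply T x \<le> c * (norm x)\<^sup>2"
    "\<And>c d. c \<le> d \<Longrightarrow> F c * F d = F d" "\<And>c. c \<le> l \<Longrightarrow> F c = 1"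
proof -
  define N where "N = (\<lambda>c. cfc (\<lambda>t. max (c - t) 0) T)"
  define R where "R = (\<lambda>c. cfc (\<lambda>t. max (t - c) 0) T)"
  have cont: "continuous_on {l..u} (\<lambda>t. max (c - t) 0)" "continuous_on {l..u} (\<lambda>t. max (t - c) 0)" for c :: real
    by (intro continuous_intros)+
  have Npos: "positive_op (N c)" and Rpos: "positive_op (R c)" for c
    unfolding N_def R_def by (rule positive_op_cfc[OF T]; simp add: cont)+
  have sub: "T - c *\<^sub>R 1 = R c - N c" for c
  proof -
    have "R c - N c = cfc (\<lambda>t. max (t - c) 0 - max (c - t) 0) T"
      unfolding N_def R_def by (rule cfc_diff[OF T cont(2) cont(1), symmetric])
    also have "\<dots> = cfc (\<lambda>t. t - c) T"
      by (rule cfc_cong[OF T]) (auto intro!: continuous_intros)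
    also have "\<dots> = cfc (\<lambda>t. t) T - cfc (\<lambda>t. c) T"
      by (rule cfc_diff[OF T]) (auto intro!: continuous_intros)
    finally show ?thesis by (simp add: cfc_id[OF T] cfc_const[OF T])
  qed
  have NR: "N c * R c = 0" for c
  proof -
    have "N c * R c = cfc (\<lambda>t. max (c - t) 0 * max (t - c) 0) T"
      unfolding N_def R_def by (rule cfc_mult[OF T cont(1) cont(2), symmetric])
    also have "\<dots> = cfc (\<lambda>t. 0) T"
      by (rule cfc_cong[OF T continuous_on_mult[OF cont]]) (simp add: max_def)
    finally show ?thesis by (simp add: cfc_const[OF T])
  qed
  have NT: "T * N c = N c * T" for c
    unfolding N_def by (rule cfc_commute[OF T cont(1)]) simp
  \<comment> \<open>A positive operator annihilates every vector at which its form vanishes, by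
    Cauchy-Schwarz.\<close>
  have zero: "bop_apply S x = 0" if "positive_op S" "x \<bullet> bop_apply S x \<le> 0" for S :: "'a bop" and x
  proof -
    have "(bop_apply S x \<bullet> bop_apply S x)\<^sup>2 \<le> (bop_apply S x \<bullet> bop_apply S (bop_apply S x)) * (x \<bullet> bop_apply S x)"
      by (rule positive_op_cauchy_schwarz[OF that(1)])
    also have "\<dots> \<le> 0" using that by (intro mult_nonneg_nonpos) (auto simp: positive_op_iff)
    finally show ?thesis by simp
  qed
  have "\<exists>F. projection F \<and> (\<forall>x. bop_apply F x = x \<longleftrightarrow> bop_apply (N c) x = 0)" for c
  proof -
    let ?M = "{x. bop_apply (N c) x = 0}"
    have "closed ?M"
      by (intro closed_Collect_eq continuous_intros linear_continuous_on bounded_linear_bop_apply)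
    then have "\<exists>P. projection P \<and> (\<forall>x. bop_apply P x \<in> ?M) \<and> (\<forall>x\<in>?M. bop_apply P x = x)"
    proof (rule projection_exists)
      show "0 \<in> ?M" by simp
      show "x + y \<in> ?M" if "x \<in> ?M" "y \<in> ?M" for x y using that by (simp add: bop_apply_add)
      show "r *\<^sub>C x \<in> ?M" if "x \<in> ?M" for r x
        using that linear_0[OF bounded_linear.linear[OF bounded_linear_scaleC]] by (simp add: bop_apply_scaleC)
    qed
    then obtain P where "projection P" "\<And>x. bop_apply (N c) (bop_apply P x) = 0"
      "\<And>x. bop_apply (N c) x = 0 \<Longrightarrow> bop_apply P x = x"
      by auto
    then show ?thesis by (intro exI[of _ P]) metis
  qed
  then obtain F where F: "\<And>c. projection (F c)" "\<And>c x. bop_apply (F c) x = x \<longleftrightarrow> bop_apply (N c) x = 0"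
    by metis
  have NF: "bop_apply (N c) (bop_apply (F c) x) = 0" for c x
    using F(2) projectionD(2)[OF F(1)] by blast
  show thesis
  proof (rule that[of F])
    show "projection (F c)" for c by (rule F)
    show "c * (norm x)\<^sup>2 \<le> x \<bullet> bop_apply T x" if "bop_apply (F c) x = x" for c x
    proof -
      have "bop_apply (N c) x = 0" using that F(2) by blast
      then have "x \<bullet> bop_apply (T - c *\<^sub>R 1) x = x \<bullet> bop_apply (R c) x" unfolding sub by simp
      moreover have "0 \<le> x \<bullet> bop_apply (R c) x" using Rpos[of c] by (simp add: positive_op_iff)
      ultimately show ?thesis by (simp add: inner_diff_right dot_square_norm)
    qed
    show "x \<bullet> bop_apply T x \<le> c * (norm x)\<^sup>2" if "bop_apply (F c) x = 0" for c x
    proof -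
      \<comment> \<open>The range of \<open>R c\<close> lies in the kernel of \<open>N c\<close>,
        which is the range of \<open>F c\<close>; a vector killed by \<open>F c\<close> is therefore
        orthogonal to it.\<close>
      have "bop_apply (N c) (bop_apply (R c) x) = 0" using NR by (metis bop_apply_simps(1,6))
      then have "bop_apply (F c) (bop_apply (R c) x) = bop_apply (R c) x" using F(2) by blast
      then have "x \<bullet> bop_apply (R c) x = 0"
        using projectionD(1)[OF F(1), of c x "bop_apply (R c) x"] that by simp
      then have "x \<bullet> bop_apply (T - c *\<^sub>R 1) x = - (x \<bullet> bop_apply (N c) x)"
        unfolding sub by (simp add: inner_diff_right)
      moreover have "0 \<le> x \<bullet> bop_apply (N c) x" using Npos[of c] by (simp add: positive_op_iff)
      ultimately show ?thesis by (simp add: inner_diff_right dot_square_norm)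
    qed
    show "F c * T = T * F c" for c
    proof -
      have sa: "self_adjoint T" "self_adjoint (F c)"
        using T F(1) by (auto simp: numerical_bounds_def projection_def)
      \<comment> \<open>The range of \<open>F c\<close> is invariant under \<open>T\<close>; taking
        adjoints turns invariance into commutation.\<close>
      have "bop_apply (N c) (bop_apply T (bop_apply (F c) x)) = 0" for x
        using NT[of c] NF[of c x] by (metis bop_apply_simps(6) bop_apply_zero)
      then have FTF: "F c * T * F c = T * F c"
        using F(2) by (intro bop_eqI) simp
      have "adjoint_pair (F c * T * F c) (F c * (T * F c))" "adjoint_pair (T * F c) (F c * T)"
        by (intro adjoint_pair_mult sa)+
      then have "F c * (T * F c) = F c * T" using FTF adj_op_eqI by metis
      then show ?thesis using FTF by (simp add: mult.assoc)
    qed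
    show "F c * F d = F d" if "c \<le> d" for c d
    proof (rule bop_eqI)
      fix x
      let ?y = "bop_apply (F d) x"
      \<comment> \<open>Negative parts grow with the level, so their kernels shrink.\<close>
      have "N c \<le> N d" unfolding N_def by (rule cfc_mono[OF T cont(1) cont(1)]) (use that in auto)
      then have "?y \<bullet> bop_apply (N c) ?y \<le> 0" using bop_leD[of "N c" "N d" ?y] NF by simp
      then have "bop_apply (N c) ?y = 0" using zero[OF Npos] by blast
      then show "bop_apply (F c * F d) x = ?y" using F(2) by simp
    qed
    show "F c = 1" if "c \<le> l" for c
    proof -
      have "N c = cfc (\<lambda>t. 0) T"
        unfolding N_def by (rule cfc_cong[OF T cont(1)]) (use that in auto)
      then have "N c = 0" by (simp add: cfc_const[OF T])
      then show ?thesis using F(2) by (intro bop_eqI) simp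
    qed
  qed
qed

section \<open>Dominating a staircase by a positive operator\<close>

lemma positive_op_norm_sq_le:
  assumes "positive_op T"
  shows "(norm (bop_apply T x))\<^sup>2 \<le> norm T * (x \<bullet> bop_apply T x)"
proof (cases "bop_apply T x = 0")
  case True
  then show ?thesis by simp
next
  case False
  let ?y = "bop_apply T x"
  have pos: "0 \<le> x \<bullet> bop_apply T x" using assms by (simp add: positive_op_iff)
  have "((norm ?y)\<^sup>2)\<^sup>2 \<le> (?y \<bullet> bop_apply T ?y) * (x \<bullet> bop_apply T x)"
    using positive_op_cauchy_schwarz[OF assms, of ?y x] by (simp add: dot_square_norm)
  also have "?y \<bullet> bop_apply T ?y \<le> norm T * (norm ?y)\<^sup>2"
    using norm_cauchy_schwarz[of ?y "bop_apply T ?y"] mult_left_mono[OF norm_bop_apply[of T ?y], of "norm ?y"]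
    by (simp add: power2_eq_square mult.left_commute)
  finally have "(norm ?y)\<^sup>2 * (norm ?y)\<^sup>2 \<le> (norm ?y)\<^sup>2 * (norm T * (x \<bullet> bop_apply T x))"
    using pos by (simp add: mult_right_mono power2_eq_square mult_ac)
  then show ?thesis by (rule mult_left_le_imp_le) (use False in simp)
qed

text \<open>\<open>R\<close> projects onto the image under \<open>Z\<close> of the range of
  \<open>P\<close>. Describing this image by two equations in the left inverse \<open>L\<close>
  makes it visibly closed.\<close>

lemma image_projection_exists:
  fixes Z :: "'a::chilbert_space bop"
  assumes LZ: "L * Z = 1" and P: "projection P"
  shows "\<exists>R. projection R \<and> R * Z * P = Z * P \<and> Z * P * L * R = R"
proof -
  let ?M = "{w. bop_apply P (bop_apply L w) = bop_apply L w \<and> bop_apply Z (bop_apply L w) = w}"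
  have LZ': "bop_apply L (bop_apply Z x) = x" for x using LZ by (metis bop_apply_simps(2,6))
  have "closed ?M"
    by (intro closed_Collect_conj closed_Collect_eq continuous_on_compose2[OF linear_continuous_on[OF bounded_linear_bop_apply]]
        continuous_on_id linear_continuous_on bounded_linear_bop_apply) auto
  then have "\<exists>R. projection R \<and> (\<forall>x. bop_apply R x \<in> ?M) \<and> (\<forall>x\<in>?M. bop_apply R x = x)"
  proof (rule projection_exists)
    show "0 \<in> ?M" by simp
    show "x + y \<in> ?M" if "x \<in> ?M" "y \<in> ?M" for x y using that by (simp add: bop_apply_add)
    show "r *\<^sub>C x \<in> ?M" if "x \<in> ?M" for r x using that by (simp add: bop_apply_scaleC)
  qed
  then obtain R where R: "projection R" "\<And>x. bop_apply R x \<in> ?M" "\<And>x. x \<in> ?M \<Longrightarrow> bop_apply R x = x"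
    by blast
  have "R * Z * P = Z * P"
  proof (rule bop_eqI)
    fix x
    have "bop_apply Z (bop_apply P x) \<in> ?M" by (simp add: LZ' projectionD(2)[OF P])
    from R(3)[OF this] show "bop_apply (R * Z * P) x = bop_apply (Z * P) x" by simp
  qed
  moreover have "Z * P * L * R = R"
    by (rule bop_eqI) (use R(2) in simp)
  ultimately show ?thesis using R(1) by blast
qed

section \<open>Finite nests of projections and their diagonal blocks\<close>

lemma projection_diff:
  assumes "projection P" "projection Q" "P * Q = Q"
  shows "projection (P - Q)"
    "(norm (bop_apply (P - Q) x))\<^sup>2 = (norm (bop_apply P x))\<^sup>2 - (norm (bop_apply Q x))\<^sup>2"
proof -
  have QP: "Q * P = Q" by (rule projection_mult_swap[OF assms])
  show *: "projection (P - Q)"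
    using assms QP by (simp add: projection_def adjoint_pair_diff algebra_simps)
  show "(norm (bop_apply (P - Q) x))\<^sup>2 = (norm (bop_apply P x))\<^sup>2 - (norm (bop_apply Q x))\<^sup>2"
    using projectionD(3)[OF *, of x x] projectionD(3)[OF assms(1), of x x] projectionD(3)[OF assms(2), of x x]
    by (simp add: power2_norm_eq_inner inner_diff_right)
qed

text \<open>For positive \<open>H\<close>, \<open>|H x|^2\<close> is at most \<open>norm H\<close>
  times the form at \<open>x\<close>, so a lower bound on norms gives one on the form. The added 1
  keeps the denominator positive.\<close>

lemma coercive_of_bounded_below:
  assumes H: "positive_op H" and e: "e > 0" and below: "\<And>x. e * norm x \<le> norm (bop_apply H x)"
  shows "invertible_op H"
proof (rule coercive_invertible)
  show "e\<^sup>2 / (norm H + 1) > 0" using e by (simp add: add_nonneg_pos)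
  fix x
  have pos: "0 \<le> x \<bullet> bop_apply H x" using H by (simp add: positive_op_iff)
  have "e\<^sup>2 * (norm x)\<^sup>2 \<le> (norm (bop_apply H x))\<^sup>2"
    using power_mono[OF below[of x], of 2] e by (simp add: power_mult_distrib)
  also have "\<dots> \<le> norm H * (x \<bullet> bop_apply H x)" by (rule positive_op_norm_sq_le[OF H])
  also have "\<dots> \<le> (norm H + 1) * (x \<bullet> bop_apply H x)" using pos by (simp add: mult_right_mono)
  finally show "e\<^sup>2 / (norm H + 1) * (norm x)\<^sup>2 \<le> x \<bullet> bop_apply H x"
    by (simp add: pos_divide_le_eq add_nonneg_pos mult.commute)
qed

text \<open>Summation by parts: the sum equals \<open>c 0 * d 0\<close> plus the increments of
  \<open>c\<close> weighted by \<open>d\<close>. It will compare two nests of which one dominates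
  the other.\<close>

lemma abel_sum_nonneg:
  fixes c d :: "nat \<Rightarrow> real"
  assumes "mono c" "0 \<le> c 0" "\<And>i. 0 \<le> d i" "d (Suc n) = 0"
  shows "0 \<le> (\<Sum>i\<le>n. c i * (d i - d (Suc i)))"
proof -
  \<comment> \<open>The boundary term makes the statement inductive; it vanishes at
    \<open>m = n\<close>.\<close>
  have "- c m * d (Suc m) \<le> (\<Sum>i\<le>m. c i * (d i - d (Suc i)))" for m
  proof (induction m)
    case 0
    then show ?case using assms by (simp add: algebra_simps)
  next
    case (Suc m)
    have "c m * d (Suc m) \<le> c (Suc m) * d (Suc m)"
      using assms by (intro mult_right_mono) (auto simp: mono_def)
    then show ?case using Suc by (simp add: algebra_simps)
  qed
  from this[of n] show ?thesis using assms by simp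
qed

lemma block_sum:
  fixes E :: "nat \<Rightarrow> 'a::chilbert_space bop"
  shows "(\<Sum>i\<le>n. E i - E (Suc i)) = E 0 - E (Suc n)"
  by (induction n) (simp_all add: algebra_simps)

text \<open>The subspaces decrease with \<open>i\<close>. Since nesting is required for every index,
  all of them vanish from \<open>Suc n\<close> on, so that the blocks up to \<open>n\<close> sum to
  \<open>P 0\<close>.\<close>

locale nest =
  fixes P :: "nat \<Rightarrow> 'a::chilbert_space bop" and n :: nat
  assumes proj: "\<And>i. projection (P i)"
    and nested: "\<And>i. P i * P (Suc i) = P (Suc i)"
    and last: "P (Suc n) = 0"
begin

lemma nested_le: "i \<le> j \<Longrightarrow> P i * P j = P j"
proof (induction j rule: dec_induct)
  case base
  then show ?case using proj by (simp add: projection_def)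
next
  case (step j)
  then show ?case by (metis nested mult.assoc)
qed

lemma nested_ge: "i \<le> j \<Longrightarrow> P j * P i = P j"
  using projection_mult_swap[OF proj proj nested_le] .

definition E :: "nat \<Rightarrow> 'a bop" where "E i = P i - P (Suc i)"

lemma proj_E: "projection (E i)"
  unfolding E_def by (rule projection_diff(1)[OF proj proj nested])

lemma P_E: "P i * E i = E i" "i < j \<Longrightarrow> E i * P j = 0"
  unfolding E_def using nested_le[of i i] nested[of i] nested_le[of i j] nested_le[of "Suc i" j]
  by (simp_all add: algebra_simps)

lemma E_orthogonal: "i \<noteq> j \<Longrightarrow> E i * E j = 0"
proof -
  have *: "E i * E j = 0" if "i < j" for i j
    using P_E(2)[OF that] P_E(2)[of i "Suc j"] that by (simp add: E_def[of j] algebra_simps)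
  assume "i \<noteq> j"
  then consider "i < j" | "j < i" by linarith
  then show ?thesis
  proof cases
    case 2
    have "E i = E i * P i"
      using nested_ge[of i i] nested_ge[of i "Suc i"] by (simp add: E_def algebra_simps)
    moreover have "P i * E j = 0"
    proof -
      have "P i * P j = P i" "P i * P (Suc j) = P i" using 2 by (simp_all add: nested_ge)
      then show ?thesis by (simp add: E_def algebra_simps)
    qed
    ultimately show ?thesis by (metis mult.assoc mult_zero_right)
  qed (rule *)
qed

lemma sum_E: "(\<Sum>i\<le>n. E i) = P 0"
  unfolding E_def block_sum by (simp add: last)

lemma E_block_sum: 
  assumes "j \<le> n"
  shows "(\<Sum>i\<le>n. A i * E i) * E j = A j * E j" "E j * (\<Sum>i\<le>n. E i * A i) = E j * A j"
proof -
  have EE: "E j * E j = E j" using proj_E by (simp add: projection_def)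
  have "A i * E i * E j = (if i = j then A j * E j else 0)" for i
    using E_orthogonal[of i j] EE by (simp add: mult.assoc)
  then show "(\<Sum>i\<le>n. A i * E i) * E j = A j * E j"
    using assms by (simp add: sum_distrib_right)
  have "E j * (E i * A i) = (if i = j then E j * A j else 0)" for i
    using E_orthogonal[of j i] EE by (simp flip: mult.assoc)
  then show "E j * (\<Sum>i\<le>n. E i * A i) = E j * A j"
    using assms by (simp add: sum_distrib_left)
qed

lemma E_apply_zero: "bop_apply (E i) (bop_apply (P (Suc i)) x) = 0"
  using P_E(2)[of i "Suc i"] by (metis bop_apply_simps(1,6) lessI)

lemma P_apply_E: "bop_apply (P i) (bop_apply (E i) x) = bop_apply (E i) x"
  using P_E(1)[of i] by (metis bop_apply_simps(6))

end

text \<open>A QR factorisation of \<open>Z\<close> with respect to a finite nest: \<open>W\<close> is the isometric part of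
  the block diagonal of \<open>Z\<close>.\<close>

lemma nest_qr:
  assumes P: "nest P n" "P 0 = 1" and R: "nest R n"
    and Z: "adjoint_pair Z Z'" and LZ: "L * Z = 1"
    and RZ: "\<And>i. R i * Z * P i = Z * P i" and ZR: "\<And>i. Z * P i * L * R i = R i"
  shows "\<exists>W W'. adjoint_pair W W' \<and> W' * W = 1 \<and> (\<forall>i\<le>n. W * nest.E P i = nest.E R i * W)"
proof -
  interpret P: nest P n by (rule P(1))
  interpret R: nest R n by (rule R)
  have sa: "self_adjoint (P.E i)" "self_adjoint (R.E i)" for i
    using P.proj_E R.proj_E by (auto simp: projection_def)
  define Y where "Y = (\<Sum>i\<le>n. R.E i * Z * P.E i)"
  define Y' where "Y' = (\<Sum>i\<le>n. P.E i * Z' * R.E i)"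
  define X where "X = (\<Sum>i\<le>n. P.E i * L * R.E i)"
  have YY': "adjoint_pair Y Y'"
    unfolding Y_def Y'_def
    using adjoint_pair_mult[OF adjoint_pair_mult[OF sa(2) Z] sa(1)]
    by (intro adjoint_pair_sum) (simp add: mult.assoc)
  have PEidem: "P.E i * P.E i = P.E i" and REidem: "R.E i * R.E i = R.E i" for i
    using P.proj_E R.proj_E by (auto simp: projection_def)
  have YE: "Y * P.E i = R.E i * Z * P.E i" if "i \<le> n" for i
    using P.E_block_sum(1)[OF that, of "\<lambda>i. R.E i * Z"] by (simp add: Y_def)
  have EY: "R.E i * Y = R.E i * Z * P.E i" if "i \<le> n" for i
    using R.E_block_sum(2)[OF that, of "\<lambda>i. Z * P.E i"] by (simp add: Y_def mult.assoc)
  have "Y' * R.E i = P.E i * Z' * R.E i" "P.E i * Y' = P.E i * Z' * R.E i" if "i \<le> n" for i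
    using R.E_block_sum(1)[OF that, of "\<lambda>i. P.E i * Z'"] P.E_block_sum(2)[OF that, of "\<lambda>i. Z' * R.E i"]
    by (simp_all add: Y'_def mult.assoc)
  \<comment> \<open>\<open>Y' * Y\<close> is block diagonal for the nest \<open>P\<close>; its
    square root and the inverse of that root inherit this.\<close>
  then have YYE: "P.E i * (Y' * Y) = Y' * Y * P.E i" if "i \<le> n" for i
    using YE[OF that] EY[OF that] that by (metis mult.assoc)
  have XY: "X * Y = 1"
  proof -
    \<comment> \<open>\<open>Z\<close> and \<open>L\<close> are triangular: they map the nests into
      each other. Subtracting \<open>R (Suc i)\<close> changes \<open>L\<close> only by vectors in
      \<open>P (Suc i)\<close>, which the block \<open>E i\<close> kills; hence the diagonal of
      \<open>L\<close> inverts the diagonal of \<open>Z\<close> from the left.\<close>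
    have *: "P.E i * L * R.E i * Y = P.E i" if i: "i \<le> n" for i
    proof (rule bop_eqI)
      fix v
      let ?w = "bop_apply (P.E i) v"
      have L: "bop_apply L (bop_apply Z x) = x" for x using LZ by (metis bop_apply_simps(2,6))
      have w: "bop_apply (P i) ?w = ?w" by (rule P.P_apply_E)
      have RZw: "bop_apply (R i) (bop_apply Z ?w) = bop_apply Z ?w"
        using RZ[of i] w by (metis bop_apply_simps(6))
      have "bop_apply (R (Suc i)) x = bop_apply Z (bop_apply (P (Suc i)) (bop_apply L (bop_apply (R (Suc i)) x)))" for x
        using ZR[of "Suc i"] by (metis bop_apply_simps(6))
      then have LR: "bop_apply L (bop_apply (R (Suc i)) x) = bop_apply (P (Suc i)) (bop_apply L (bop_apply (R (Suc i)) x))" for x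
        using L by metis
      have "bop_apply (P.E i) (bop_apply L (bop_apply (R (Suc i)) x)) = 0" for x
        by (subst LR) (rule P.E_apply_zero)
      then have "bop_apply (P.E i) (bop_apply L (bop_apply (R.E i) (bop_apply Z ?w))) = bop_apply (P.E i) ?w"
        by (simp add: R.E_def RZw bop_apply_diff L)
      then have "bop_apply (P.E i * L * (R.E i * Z * P.E i)) v = bop_apply (P.E i) v"
        using PEidem by (metis bop_apply_simps(6))
      then show "bop_apply (P.E i * L * R.E i * Y) v = bop_apply (P.E i) v"
        using EY[OF i] by (simp add: mult.assoc)
    qed
    have "X * Y = (\<Sum>i\<le>n. P.E i * L * R.E i * Y)" by (simp add: X_def sum_distrib_right)
    also have "\<dots> = (\<Sum>i\<le>n. P.E i)" by (intro sum.cong refl *) simp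
    finally show ?thesis by (simp add: P.sum_E P(2))
  qed
  \<comment> \<open>The polar decomposition of \<open>Y\<close>, with \<open>W = Y * J\<close> where
    \<open>J\<close> inverts \<open>H\<close>. The left inverse \<open>X\<close> makes
    \<open>H\<close> bounded below.\<close>
  define H where "H = abs_op Y"
  note H = abs_op_properties[OF YY', folded H_def]
  have "invertible_op H"
  proof (rule coercive_of_bounded_below[OF H(1)])
    show "0 < 1 / (norm X + 1)" by (simp add: add_nonneg_pos)
    fix x
    have "norm x = norm (bop_apply X (bop_apply Y x))" using XY by (metis bop_apply_simps(2,6))
    also have "\<dots> \<le> norm X * norm (bop_apply Y x)" by (rule norm_bop_apply)
    also have "\<dots> \<le> (norm X + 1) * norm (bop_apply H x)" unfolding H(3) by (intro mult_right_mono) auto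
    finally show "1 / (norm X + 1) * norm x \<le> norm (bop_apply H x)"
      by (simp add: pos_divide_le_eq add_nonneg_pos mult.commute)
  qed
  then obtain J where J: "J * H = 1" "H * J = 1" unfolding invertible_op_def by blast
  have saH: "self_adjoint H" using H(1) by (simp add: positive_op_iff)
  have saJ: "self_adjoint J"
    unfolding adjoint_pair_def
  proof (intro allI)
    fix x y
    have HJ: "bop_apply H (bop_apply J z) = z" for z using J(2) by (metis bop_apply_simps(2,6))
    have "bop_apply J x \<bullet> y = bop_apply J x \<bullet> bop_apply H (bop_apply J y)" by (simp add: HJ)
    also have "\<dots> = bop_apply H (bop_apply J x) \<bullet> bop_apply J y" using saH by (simp add: adjoint_pair_def)
    finally show "bop_apply J x \<bullet> y = x \<bullet> bop_apply J y" by (simp add: HJ)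
  qed
  have JE: "J * P.E i = P.E i * J" if "i \<le> n" for i
  proof -
    have "P.E i * H = H * P.E i" by (rule H(4)[OF YYE[OF that]])
    then have "J * (P.E i * H) * J = J * (H * P.E i) * J" by simp
    moreover have "J * (P.E i * H) * J = J * P.E i * (H * J)" "J * (H * P.E i) * J = J * H * (P.E i * J)"
      by (simp_all only: mult.assoc)
    ultimately show ?thesis using J by simp
  qed
  have "adjoint_pair (Y * J) (J * Y')" by (rule adjoint_pair_mult[OF YY' saJ])
  moreover have "(J * Y') * (Y * J) = 1"
  proof -
    have "(J * Y') * (Y * J) = J * (H * H) * J" using H(2) by (simp add: mult.assoc)
    also have "\<dots> = (J * H) * (H * J)" by (simp only: mult.assoc)
    finally show ?thesis using J by simp
  qed
  moreover have "(Y * J) * P.E i = R.E i * (Y * J)" if "i \<le> n" for i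
  proof -
    have "(Y * J) * P.E i = Y * P.E i * J" using JE[OF that] by (simp add: mult.assoc)
    also have "\<dots> = R.E i * Y * J" using YE[OF that] EY[OF that] by simp
    finally show ?thesis by (simp add: mult.assoc)
  qed
  ultimately show ?thesis by blast
qed

text \<open>A subspace on which \<open>G\<close> is large embeds boundedly into the spectral subspace of \<open>G\<close>;
  the shear below moves it there without decreasing the values of \<open>G\<close> on its subspaces.\<close>

lemma spectral_projection_estimates:
  fixes G F :: "'a::chilbert_space bop"
  assumes G: "positive_op G" and F: "projection F" "F * G = G * F" and c: "c > 0" and d: "d > 0" and e: "c \<le> e"
    and low: "\<And>v. bop_apply F v = 0 \<Longrightarrow> v \<bullet> bop_apply G v \<le> c * (norm v)\<^sup>2"
    and v: "(1 + d) * e * norm v \<le> norm (bop_apply G v)"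
  shows "(1 + d) * e * norm (bop_apply F v) \<le> norm (bop_apply G (bop_apply F v))"
    and "d * c\<^sup>2 * (norm v)\<^sup>2 \<le> (norm G)\<^sup>2 * (norm (bop_apply F v))\<^sup>2"
proof -
  let ?w = "v - bop_apply F v"
  have FG: "bop_apply F (bop_apply G x) = bop_apply G (bop_apply F x)" for x
    using F(2) by (metis bop_apply_simps(6))
  have Fw: "bop_apply F ?w = 0" by (simp add: bop_apply_diff projectionD(2)[OF F(1)])
  have GFw: "bop_apply F (bop_apply G ?w) = 0" unfolding FG Fw by simp
  \<comment> \<open>The bound on the form becomes a bound on the norm by Cauchy-Schwarz, because
    \<open>G ?w\<close> is again killed by \<open>F\<close>.\<close>
  have Gw: "norm (bop_apply G ?w) \<le> c * norm ?w"
  proof (cases "bop_apply G ?w = 0")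
    case False
    let ?y = "bop_apply G ?w"
    have "((norm ?y)\<^sup>2)\<^sup>2 \<le> (?y \<bullet> bop_apply G ?y) * (?w \<bullet> bop_apply G ?w)"
      using positive_op_cauchy_schwarz[OF G, of ?y ?w] by (simp add: dot_square_norm)
    also have "\<dots> \<le> (c * (norm ?y)\<^sup>2) * (c * (norm ?w)\<^sup>2)"
      using G c by (intro mult_mono low Fw GFw) (auto simp: positive_op_iff)
    finally have "(norm ?y)\<^sup>2 * (norm ?y)\<^sup>2 \<le> (norm ?y)\<^sup>2 * (c * norm ?w)\<^sup>2"
      by (simp add: power2_eq_square mult_ac)
    then have "(norm ?y)\<^sup>2 \<le> (c * norm ?w)\<^sup>2"
      by (rule mult_left_le_imp_le) (use False in simp)
    then show ?thesis by (rule power2_le_imp_le) (use c in simp)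
  qed (use c in simp)
  have split: "(norm (bop_apply G v))\<^sup>2 = (norm (bop_apply G (bop_apply F v)))\<^sup>2 + (norm (bop_apply G ?w))\<^sup>2"
    using projection_pythagoras[OF F(1), of "bop_apply G v"] by (simp add: FG bop_apply_diff)
  have split': "(norm v)\<^sup>2 = (norm (bop_apply F v))\<^sup>2 + (norm ?w)\<^sup>2"
    by (rule projection_pythagoras[OF F(1)])
  have v2: "((1 + d) * e)\<^sup>2 * (norm v)\<^sup>2 \<le> (norm (bop_apply G v))\<^sup>2"
    using power_mono[OF v, of 2] c d e by (simp add: power_mult_distrib)
  have Gw2: "(norm (bop_apply G ?w))\<^sup>2 \<le> c\<^sup>2 * (norm ?w)\<^sup>2"
    using power_mono[OF Gw, of 2] by (simp add: power_mult_distrib)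
  have ce: "c \<le> (1 + d) * e" using c d e by (simp add: algebra_simps add_nonneg_nonneg order_trans)
  then have c2: "c\<^sup>2 * (norm ?w)\<^sup>2 \<le> ((1 + d) * e)\<^sup>2 * (norm ?w)\<^sup>2"
    using c by (intro mult_right_mono power_mono) auto
  \<comment> \<open>The part outside \<open>F\<close> contributes a ratio of at most
    \<open>c\<close>, below the average ratio \<open>(1 + d) * e\<close>; the part inside must
    therefore reach that average.\<close>
  have "((1 + d) * e * norm (bop_apply F v))\<^sup>2 \<le> (norm (bop_apply G (bop_apply F v)))\<^sup>2"
    using v2 Gw2 c2 unfolding split split' power_mult_distrib by (simp add: algebra_simps)
  then show "(1 + d) * e * norm (bop_apply F v) \<le> norm (bop_apply G (bop_apply F v))"
    by (rule power2_le_imp_le) simp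
  have "(norm (bop_apply G (bop_apply F v)))\<^sup>2 \<le> (norm G)\<^sup>2 * (norm (bop_apply F v))\<^sup>2"
    using power_mono[OF norm_bop_apply[of G "bop_apply F v"], of 2] by (simp add: power_mult_distrib)
  \<comment> \<open>Here the slack \<open>d\<close> becomes a gap:
    \<open>((1 + d) c)^2 - c^2\<close> is at least \<open>d c^2\<close>.\<close>
  moreover have "(c\<^sup>2 + d * c\<^sup>2) * (norm v)\<^sup>2 \<le> ((1 + d) * e)\<^sup>2 * (norm v)\<^sup>2"
  proof (rule mult_right_mono)
    have "c\<^sup>2 + d * c\<^sup>2 \<le> ((1 + d) * c)\<^sup>2"
      using d c by (simp add: power2_eq_square algebra_simps)
    also have "\<dots> \<le> ((1 + d) * e)\<^sup>2" using c d e by (intro power_mono mult_left_mono) auto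
    finally show "c\<^sup>2 + d * c\<^sup>2 \<le> ((1 + d) * e)\<^sup>2" .
  qed simp
  moreover have "c\<^sup>2 * (norm ?w)\<^sup>2 \<le> c\<^sup>2 * (norm v)\<^sup>2"
    unfolding split' by (intro mult_left_mono) auto
  ultimately show "d * c\<^sup>2 * (norm v)\<^sup>2 \<le> (norm G)\<^sup>2 * (norm (bop_apply F v))\<^sup>2"
    using v2 Gw2 unfolding split by (simp add: algebra_simps)
qed

text \<open>Induction treats one level at a time: after stage \<open>k\<close> the first
  \<open>k\<close> subspaces lie in their spectral subspaces. The shear \<open>1 - Q * R\<close>
  acts as \<open>F k\<close> on the image of \<open>P k\<close> and as the identity on its
  orthogonal complement. Invertibility comes from a norm of \<open>Q * R\<close> below 1, and the
  growth of \<open>G\<close> on smaller subspaces survives because their levels are at least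
  \<open>c k\<close>.\<close>

lemma shear_into_nest:
  fixes G :: "'a::chilbert_space bop" and c :: "nat \<Rightarrow> real"
  assumes G: "positive_op G" and P: "nest P n" and c: "mono c" "0 < c 0" and d: "d > 0"
    and large: "\<And>i v. i \<le> n \<Longrightarrow> bop_apply (P i) v = v \<Longrightarrow> (1 + d) * c i * norm v \<le> norm (bop_apply G v)"
    and F: "\<And>i. projection (F i)" "\<And>i. F i * G = G * F i" "\<And>i j. i \<le> j \<Longrightarrow> F i * F j = F j"
      "\<And>i v. bop_apply (F i) v = 0 \<Longrightarrow> v \<bullet> bop_apply G v \<le> c i * (norm v)\<^sup>2"
  shows "\<exists>Z Z' L. adjoint_pair Z Z' \<and> L * Z = 1 \<and> (\<forall>i\<le>n. F i * Z * P i = Z * P i)"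
proof -
  interpret nest P n by (rule P)
  have cpos: "0 < c i" for i using c monoD[OF c(1), of 0 i] by simp
  have Psub: "bop_apply (P i) v = v" if "i \<le> j" "bop_apply (P j) v = v" for i j v
    using nested_le[OF that(1)] that(2) by (metis bop_apply_simps(6))
  have "k \<le> Suc n \<Longrightarrow> \<exists>Z Z' L. adjoint_pair Z Z' \<and> L * Z = 1 \<and> (\<forall>i<k. F i * Z * P i = Z * P i) \<and>
      (\<forall>i v. k \<le> i \<longrightarrow> i \<le> n \<longrightarrow> bop_apply (P i) v = v \<longrightarrow>
        (1 + d) * c i * norm (bop_apply Z v) \<le> norm (bop_apply G (bop_apply Z v)))" for k
  proof (induction k)
    case 0
    show ?case
      by (rule exI[of _ 1], rule exI[of _ 1], rule exI[of _ 1]) (auto simp: adjoint_pair_one large)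
  next
    case (Suc k)
    then obtain Z Z' L where Z: "adjoint_pair Z Z'" and LZ: "L * Z = 1"
      and FZ: "\<And>i. i < k \<Longrightarrow> F i * Z * P i = Z * P i"
      and GZ: "\<And>i v. k \<le> i \<Longrightarrow> i \<le> n \<Longrightarrow> bop_apply (P i) v = v \<Longrightarrow>
        (1 + d) * c i * norm (bop_apply Z v) \<le> norm (bop_apply G (bop_apply Z v))"
      by (auto simp: Suc_le_eq)
    have kn: "k \<le> n" using Suc.prems by simp
    obtain R where R: "projection R" "R * Z * P k = Z * P k" "Z * P k * L * R = R"
      using image_projection_exists[OF LZ proj[of k]] by blast
    have LZ': "bop_apply L (bop_apply Z x) = x" for x using LZ by (metis bop_apply_simps(2,6))
    define Q where "Q = 1 - F k"
    have Q: "projection Q" unfolding Q_def by (rule projection_compl[OF F(1)])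
    have saR: "self_adjoint R" and saQ: "self_adjoint Q" using R(1) Q by (auto simp: projection_def)
    have Rv: "\<exists>v. bop_apply (P k) v = v \<and> bop_apply R x = bop_apply Z v" for x
    proof (intro exI conjI)
      let ?v = "bop_apply (P k) (bop_apply L (bop_apply R x))"
      show "bop_apply (P k) ?v = ?v" by (rule projectionD(2)[OF proj])
      show "bop_apply R x = bop_apply Z ?v" using R(3) by (metis bop_apply_simps(6))
    qed
    \<comment> \<open>The share of the squared norm that \<open>F k\<close> retains on the image of
      \<open>P k\<close>, capped at 1 so that \<open>sqrt (1 - q)\<close>, a bound for the norm of
      \<open>Q * R\<close>, is defined.\<close>
    define q where "q = min 1 (d * (c k)\<^sup>2 / ((norm G)\<^sup>2 + 1))"
    have q: "0 < q" "q \<le> 1" using d cpos[of k] by (auto simp: q_def add_nonneg_pos)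
    have qF: "q * (norm w)\<^sup>2 \<le> (norm (bop_apply (F k) w))\<^sup>2" if "w = bop_apply R x" for w x
    proof -
      obtain v where v: "bop_apply (P k) v = v" "w = bop_apply Z v" using Rv[of x] \<open>w = bop_apply R x\<close> by metis
      have "d * (c k)\<^sup>2 * (norm w)\<^sup>2 \<le> (norm G)\<^sup>2 * (norm (bop_apply (F k) w))\<^sup>2"
        unfolding v(2)
        by (rule spectral_projection_estimates(2)[OF G F(1) F(2) cpos d order_refl F(4) GZ[OF order_refl kn v(1)]])
      also have "\<dots> \<le> ((norm G)\<^sup>2 + 1) * (norm (bop_apply (F k) w))\<^sup>2" by (intro mult_right_mono) auto
      finally have "d * (c k)\<^sup>2 / ((norm G)\<^sup>2 + 1) * (norm w)\<^sup>2 \<le> (norm (bop_apply (F k) w))\<^sup>2"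
        by (simp add: pos_divide_le_eq add_nonneg_pos mult.commute)
      moreover have "q * (norm w)\<^sup>2 \<le> d * (c k)\<^sup>2 / ((norm G)\<^sup>2 + 1) * (norm w)\<^sup>2"
        by (intro mult_right_mono) (auto simp: q_def)
      ultimately show ?thesis by linarith
    qed
    have "invertible_op (1 - Q * R)"
    proof (rule coercive_invertible)
      show "0 < 1 - sqrt (1 - q)" using q by simp
      fix x
      let ?w = "bop_apply R x"
      have "(norm (bop_apply Q ?w))\<^sup>2 = (norm ?w)\<^sup>2 - (norm (bop_apply (F k) ?w))\<^sup>2"
        using projection_pythagoras[OF F(1)[of k], of ?w] by (simp add: Q_def)
      also have "\<dots> \<le> (1 - q) * (norm ?w)\<^sup>2" using qF[OF refl, of x] by (simp add: algebra_simps)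
      also have "\<dots> \<le> (1 - q) * (norm x)\<^sup>2"
        using q projection_norm_le[OF R(1), of x] by (intro mult_left_mono power_mono) auto
      also have "\<dots> = (sqrt (1 - q) * norm x)\<^sup>2" using q by (simp add: power_mult_distrib)
      finally have "norm (bop_apply Q ?w) \<le> sqrt (1 - q) * norm x"
        by (rule power2_le_imp_le) (use q in simp)
      then have "x \<bullet> bop_apply Q ?w \<le> norm x * (sqrt (1 - q) * norm x)"
        using norm_cauchy_schwarz[of x "bop_apply Q ?w"] mult_left_mono[of _ _ "norm x"] by fastforce
      then show "(1 - sqrt (1 - q)) * (norm x)\<^sup>2 \<le> x \<bullet> bop_apply (1 - Q * R) x"
        by (simp add: inner_diff_right dot_square_norm algebra_simps power2_eq_square)
    qed
    then obtain S where S: "S * (1 - Q * R) = 1" unfolding invertible_op_def by blast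
    let ?Z = "(1 - Q * R) * Z"
    have "adjoint_pair ?Z (Z' * (1 - R * Q))"
      by (intro adjoint_pair_mult adjoint_pair_diff adjoint_pair_one saR saQ Z)
    moreover have "(L * S) * ?Z = 1"
    proof -
      have "(L * S) * ?Z = L * (S * (1 - Q * R)) * Z" by (simp only: mult.assoc)
      then show ?thesis using S LZ by simp
    qed
    moreover have step: "bop_apply ?Z v = bop_apply (F k) (bop_apply Z v)" if "bop_apply (P k) v = v" for v
    proof -
      have "bop_apply R (bop_apply Z v) = bop_apply Z v" using R(2) that by (metis bop_apply_simps(6))
      then show ?thesis by (simp add: Q_def)
    qed
    moreover have "F i * ?Z * P i = ?Z * P i" if "i < Suc k" for i
    proof (cases "i = k")
      case True
      show ?thesis
        by (rule bop_eqI)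
          (use step[of "bop_apply (P k) x" for x] projectionD(2)[OF proj] projectionD(2)[OF F(1)] in \<open>simp add: True\<close>)
    next
      case False
      then have ik: "i < k" using that by simp
      have FR: "bop_apply (F i) (bop_apply R x) = bop_apply R x" for x
      proof -
        obtain v where v: "bop_apply (P k) v = v" "bop_apply R x = bop_apply Z v" using Rv[of x] by metis
        have "bop_apply (P i) v = v" using Psub[of i k v] ik v(1) by simp
        then have "bop_apply (F i) (bop_apply Z v) = bop_apply Z v" using FZ[OF ik] by (metis bop_apply_simps(6))
        then show ?thesis by (simp add: v(2))
      qed
      have FF: "F i * F k = F k" using F(3)[of i k] ik by simp
      have "F i * Q = Q * F i"
        using FF projection_mult_swap[OF F(1) F(1) FF] by (simp add: Q_def algebra_simps)
      \<comment> \<open>Earlier levels are not disturbed: the image of \<open>P k\<close> already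
        lies in the range of \<open>F i\<close>, and \<open>F i\<close> commutes with
        \<open>Q\<close>.\<close>
      then have FQR: "F i * (Q * R) = Q * R"
        using FR by (intro bop_eqI) (metis bop_apply_simps(6))
      have "F i * ?Z * P i = F i * Z * P i - F i * (Q * R) * (Z * P i)" by (simp add: algebra_simps)
      then show ?thesis using FZ[OF ik] FQR by (simp add: algebra_simps)
    qed
    moreover have "(1 + d) * c i * norm (bop_apply ?Z v) \<le> norm (bop_apply G (bop_apply ?Z v))"
      if "Suc k \<le> i" "i \<le> n" "bop_apply (P i) v = v" for i v
    proof -
      have "bop_apply (P k) v = v" using Psub[of k i v] that by simp
      moreover have "(1 + d) * c i * norm (bop_apply Z v) \<le> norm (bop_apply G (bop_apply Z v))"
        using GZ[of i v] that by simp
      moreover have "c k \<le> c i" using monoD[OF c(1), of k i] that by simp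
      ultimately show ?thesis
        using spectral_projection_estimates(1)[OF G F(1) F(2) cpos d _ F(4)] step by metis
    qed
    ultimately show ?case by blast
  qed
  from this[of "Suc n"] show ?thesis by (auto simp: less_Suc_eq_le)
qed

text \<open>A min-max comparison for finitely many levels. The shear places the nest
  \<open>P\<close> inside the spectral nest of \<open>G\<close>, and the QR factorisation replaces
  the shear by an isometry \<open>W\<close> carrying blocks of \<open>P\<close> to blocks of the
  image nest \<open>R\<close>. The factor \<open>1 + d\<close> is what keeps the shear
  invertible.\<close>

theorem nest_domination:
  fixes G :: "'a::chilbert_space bop" and c :: "nat \<Rightarrow> real"
  assumes G: "positive_op G" and P: "nest P n" "P 0 = 1" and c: "mono c" "0 < c 0" and d: "d > 0"
    and large: "\<And>i v. i \<le> n \<Longrightarrow> bop_apply (P i) v = v \<Longrightarrow> (1 + d) * c i * norm v \<le> norm (bop_apply G v)"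
  shows "\<exists>W W'. adjoint_pair W W' \<and> W' * W = 1 \<and>
    (\<forall>x. (\<Sum>i\<le>n. c i * (norm (bop_apply (nest.E P i) x))\<^sup>2) \<le> bop_apply W x \<bullet> bop_apply G (bop_apply W x))"
proof -
  interpret P: nest P n by (rule P(1))
  have cpos: "0 < c i" for i using c monoD[OF c(1), of 0 i] by simp
  have "numerical_bounds (- norm G) (norm G) G"
    unfolding numerical_bounds_def
  proof (intro conjI allI)
    show "self_adjoint G" using G by (simp add: positive_op_iff)
    fix x
    have "\<bar>x \<bullet> bop_apply G x\<bar> \<le> norm x * (norm G * norm x)"
      using Cauchy_Schwarz_ineq2[of x "bop_apply G x"] mult_left_mono[OF norm_bop_apply[of G x], of "norm x"] by simp
    then show "- norm G * (norm x)\<^sup>2 \<le> x \<bullet> bop_apply G x" "x \<bullet> bop_apply G x \<le> norm G * (norm x)\<^sup>2"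
      by (simp_all add: power2_eq_square mult_ac)
  qed
  then obtain F0 where F0: "\<And>c. projection (F0 c)" "\<And>c. F0 c * G = G * F0 c"
    "\<And>c x. bop_apply (F0 c) x = x \<Longrightarrow> c * (norm x)\<^sup>2 \<le> x \<bullet> bop_apply G x"
    "\<And>c x. bop_apply (F0 c) x = 0 \<Longrightarrow> x \<bullet> bop_apply G x \<le> c * (norm x)\<^sup>2"
    "\<And>c d. c \<le> d \<Longrightarrow> F0 c * F0 d = F0 d"
    by (rule spectral_projections) blast
  have "\<exists>Z Z' L. adjoint_pair Z Z' \<and> L * Z = 1 \<and> (\<forall>i\<le>n. F0 (c i) * Z * P i = Z * P i)"
    by (rule shear_into_nest[OF G P(1) c d large]) (use F0 monoD[OF c(1)] in auto)
  then obtain Z Z' L where Z: "adjoint_pair Z Z'" "L * Z = 1" "\<And>i. i \<le> n \<Longrightarrow> F0 (c i) * Z * P i = Z * P i"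
    by blast
  have LZ': "bop_apply L (bop_apply Z x) = x" for x using Z(2) by (metis bop_apply_simps(2,6))
  have "\<forall>i. \<exists>R. projection R \<and> R * Z * P i = Z * P i \<and> Z * P i * L * R = R"
    using image_projection_exists[OF Z(2) P.proj] by blast
  then obtain R where R: "\<And>i. projection (R i)" "\<And>i. R i * Z * P i = Z * P i" "\<And>i. Z * P i * L * R i = R i"
    by metis
  have "nest R n"
  proof
    show "projection (R i)" for i by (rule R)
    show "R i * R (Suc i) = R (Suc i)" for i
    proof -
      have "R (Suc i) = Z * (P i * P (Suc i)) * L * R (Suc i)" using P.nested R(3) by simp
      also have "\<dots> = (Z * P i) * (P (Suc i) * L * R (Suc i))" by (simp only: mult.assoc)
      finally have *: "R (Suc i) = (Z * P i) * (P (Suc i) * L * R (Suc i))" .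
      have "R i * ((Z * P i) * (P (Suc i) * L * R (Suc i))) = (Z * P i) * (P (Suc i) * L * R (Suc i))"
        using R(2)[of i] by (simp flip: mult.assoc)
      then show ?thesis using * by simp
    qed
    show "R (Suc n) = 0" using R(3)[of "Suc n"] P.last by simp
  qed
  then interpret R: nest R n .
  obtain W W' where W: "adjoint_pair W W'" "W' * W = 1" "\<And>i. i \<le> n \<Longrightarrow> W * P.E i = R.E i * W"
    using nest_qr[OF P \<open>nest R n\<close> Z(1,2) R(2,3)] by blast
  define F where "F = (\<lambda>i. if i \<le> n then F0 (c i) else 0)"
  have "nest F n"
  proof
    show "projection (F i)" for i by (simp add: F_def F0 projection_zero)
    show "F i * F (Suc i) = F (Suc i)" for i using F0(5) monoD[OF c(1), of i "Suc i"] by (simp add: F_def)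
    show "F (Suc n) = 0" by (simp add: F_def)
  qed
  then interpret F: nest F n .
  have FR: "F i * R i = R i" if "i \<le> n" for i
  proof -
    have "F i * (Z * P i * L * R i) = Z * P i * L * R i"
      using Z(3)[OF that] that by (simp add: F_def flip: mult.assoc)
    then show ?thesis using R(3) by simp
  qed
  have "(\<Sum>i\<le>n. c i * (norm (bop_apply (P.E i) x))\<^sup>2) \<le> bop_apply W x \<bullet> bop_apply G (bop_apply W x)" for x
  proof -
    let ?y = "bop_apply W x"
    define s where "s = (\<lambda>i. (norm (bop_apply (F i) ?y))\<^sup>2)"
    define r where "r = (\<lambda>i. (norm (bop_apply (R i) ?y))\<^sup>2)"
    define g where "g = (\<lambda>i. ?y \<bullet> bop_apply G (bop_apply (F i) ?y))"
    have isoW: "norm (bop_apply W z) = norm z" for z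
    proof -
      have "bop_apply W z \<bullet> bop_apply W z = z \<bullet> bop_apply W' (bop_apply W z)" using W(1) by (rule adjoint_pairD)
      also have "bop_apply W' (bop_apply W z) = z" using W(2) by (metis bop_apply_simps(2,6))
      finally show ?thesis by (simp add: norm_eq_sqrt_inner)
    qed
    have GF: "bop_apply G (bop_apply (F i) z) = bop_apply (F i) (bop_apply G z)" for i z
      using F0(2)[of "c i"] by (cases "i \<le> n") (auto simp: F_def, metis bop_apply_simps(6))
    have "(norm (bop_apply (P.E i) x))\<^sup>2 = r i - r (Suc i)" if "i \<le> n" for i
    proof -
      have "norm (bop_apply (P.E i) x) = norm (bop_apply (R.E i) ?y)"
        using isoW[of "bop_apply (P.E i) x"] W(3)[OF that] by (metis bop_apply_simps(6))
      then show ?thesis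
        using projection_diff(2)[OF R(1) R(1) R.nested, of i ?y] by (simp add: r_def R.E_def)
    qed
    then have "(\<Sum>i\<le>n. c i * (norm (bop_apply (P.E i) x))\<^sup>2) = (\<Sum>i\<le>n. c i * (r i - r (Suc i)))" by simp
    \<comment> \<open>\<open>R i\<close> lies below \<open>F i\<close>, so passing to the spectral
      nest moves weight to higher levels; summation by parts applies to the differences of squared
      norms.\<close>
    also have "\<dots> \<le> (\<Sum>i\<le>n. c i * (s i - s (Suc i)))"
    proof -
      have rs: "r i \<le> s i" for i
      proof (cases "i \<le> n")
        case True
        have "R i * F i = R i" by (rule projection_mult_swap[OF F.proj R(1) FR[OF True]])
        then have "bop_apply (R i) ?y = bop_apply (R i) (bop_apply (F i) ?y)" by (metis bop_apply_simps(6))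
        then show ?thesis
          unfolding r_def s_def using projection_norm_le[OF R(1), of i "bop_apply (F i) ?y"]
          by (simp add: power_mono)
      next
        case False
        have "R i = 0" using R.nested_le[of "Suc n" i] R.last False by simp
        then show ?thesis by (simp add: r_def s_def)
      qed
      have "0 \<le> (\<Sum>i\<le>n. c i * ((s i - r i) - (s (Suc i) - r (Suc i))))"
        using abel_sum_nonneg[OF c(1), of "\<lambda>i. s i - r i" n] rs cpos[of 0] F.last R.last
        by (simp add: s_def r_def)
      then show ?thesis by (simp add: algebra_simps sum_subtractf sum.distrib)
    qed
    also have "\<dots> \<le> (\<Sum>i\<le>n. g i - g (Suc i))"
    proof (rule sum_mono)
      fix i assume "i \<in> {..n}"
      then have i: "i \<le> n" by simp
      let ?z = "bop_apply (F.E i) ?y"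
      have "c i * (norm ?z)\<^sup>2 \<le> ?z \<bullet> bop_apply G ?z"
        using F0(3)[of "c i" ?z] F.P_apply_E[of i ?y] i by (simp add: F_def)
      also have "bop_apply G ?z = bop_apply (F.E i) (bop_apply G ?y)"
        by (simp add: F.E_def bop_apply_diff GF)
      also have "?z \<bullet> \<dots> = ?y \<bullet> bop_apply (F.E i) (bop_apply G ?y)"
        by (rule projectionD(3)[OF F.proj_E])
      also have "\<dots> = g i - g (Suc i)" by (simp add: F.E_def g_def GF inner_diff_right)
      finally show "c i * (s i - s (Suc i)) \<le> g i - g (Suc i)"
        using projection_diff(2)[OF F.proj F.proj F.nested, of i ?y] by (simp add: s_def F.E_def)
    qed
    also have "\<dots> = g 0 - g (Suc n)" by (rule sum_telescope)
    \<comment> \<open>The spectral nest may start below the identity; the part of \<open>G\<close>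
      outside \<open>F 0\<close> is positive and can only help.\<close>
    also have "\<dots> \<le> ?y \<bullet> bop_apply G ?y"
    proof -
      let ?z = "?y - bop_apply (F 0) ?y"
      have "0 \<le> ?z \<bullet> bop_apply G ?z" using G by (simp add: positive_op_iff)
      also have "\<dots> = ?z \<bullet> bop_apply G ?y - ?z \<bullet> bop_apply (F 0) (bop_apply G ?y)"
        by (simp add: bop_apply_diff GF inner_diff_right)
      also have "?z \<bullet> bop_apply (F 0) (bop_apply G ?y) = bop_apply (F 0) ?z \<bullet> bop_apply G ?y"
        by (rule projectionD(1)[OF F.proj, symmetric])
      also have "bop_apply (F 0) ?z = 0" by (simp add: bop_apply_diff projectionD(2)[OF F.proj])
      also have "?z \<bullet> bop_apply G ?y = ?y \<bullet> bop_apply G ?y - g 0"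
        using projectionD(1)[OF F.proj, of 0 ?y "bop_apply G ?y"] by (simp add: inner_diff_left g_def GF)
      finally show ?thesis using F.last by (simp add: g_def)
    qed
    finally show ?thesis .
  qed
  then show ?thesis using W(1,2) by blast
qed

section \<open>The scalar inequality\<close>

lemma sinh_less_mult_cosh:
  fixes t :: real
  assumes "t > 0"
  shows "sinh t < t * cosh t"
proof -
  have "(\<lambda>t. t * cosh t - sinh t) 0 < (\<lambda>t. t * cosh t - sinh t) t"
  proof (rule DERIV_pos_imp_increasing_open[OF assms])
    fix x :: real assume "0 < x" "x < t"
    then show "\<exists>y. ((\<lambda>t. t * cosh t - sinh t) has_real_derivative y) (at x) \<and> 0 < y"
      by (intro exI[of _ "x * sinh x"] conjI) (auto intro!: derivative_eq_intros)
  qed (auto intro!: continuous_intros)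
  then show ?thesis by simp
qed

lemma sinh_div_strict_mono:
  fixes x y :: real
  assumes "0 < x" "x < y"
  shows "sinh x / x < sinh y / y"
proof (rule DERIV_pos_imp_increasing_open[OF assms(2), of "\<lambda>t. sinh t / t"])
  fix t assume t: "x < t" "t < y"
  then have "t > 0" using assms by simp
  then show "\<exists>d. ((\<lambda>t. sinh t / t) has_real_derivative d) (at t) \<and> 0 < d"
    using sinh_less_mult_cosh[of t]
    by (intro exI[of _ "(cosh t * t - sinh t) / (t * t)"] conjI)
      (auto intro!: derivative_eq_intros divide_pos_pos simp: mult.commute)
qed (use assms in \<open>auto intro!: continuous_intros\<close>)

text \<open>Bernoulli's inequality by the mean value theorem. The strict version for
  \<open>q > 1\<close> makes the comparison of a chord with its scaled power strict away from the
  point of contact.\<close>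

lemma powr_tangent:
  fixes r q :: real
  assumes "r > 0"
  shows "q > 1 \<Longrightarrow> r \<noteq> 1 \<Longrightarrow> 1 + q * (r - 1) < r powr q"
    and "0 < q \<Longrightarrow> q < 1 \<Longrightarrow> r powr q \<le> 1 + q * (r - 1)"
proof -
  have mvt: "\<exists>\<xi>. (r < \<xi> \<and> \<xi> < 1 \<or> 1 < \<xi> \<and> \<xi> < r) \<and> r powr q - 1 = (r - 1) * (q * \<xi> powr (q - 1))" if "r \<noteq> 1"
  proof -
    have D: "((\<lambda>t. t powr q) has_real_derivative q * t powr (q - 1)) (at t)" if "t > 0" for t
      using that by (auto intro!: derivative_eq_intros)
    show ?thesis
    proof (cases "r < 1")
      case True
      obtain \<xi> where "r < \<xi>" "\<xi> < 1" "1 powr q - r powr q = (1 - r) * (q * \<xi> powr (q - 1))"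
        using MVT2[OF True, of "\<lambda>t. t powr q" "\<lambda>t. q * t powr (q - 1)"] D assms by auto
      then show ?thesis by (intro exI[of _ \<xi>]) (auto simp: algebra_simps)
    next
      case False
      then have "1 < r" using that by simp
      obtain \<xi> where "1 < \<xi>" "\<xi> < r" "r powr q - 1 powr q = (r - 1) * (q * \<xi> powr (q - 1))"
        using MVT2[OF \<open>1 < r\<close>, of "\<lambda>t. t powr q" "\<lambda>t. q * t powr (q - 1)"] D by auto
      then show ?thesis by (intro exI[of _ \<xi>]) auto
    qed
  qed
  show "1 + q * (r - 1) < r powr q" if q: "q > 1" and r: "r \<noteq> 1"
  proof -
    obtain \<xi> where \<xi>: "r < \<xi> \<and> \<xi> < 1 \<or> 1 < \<xi> \<and> \<xi> < r" "r powr q - 1 = (r - 1) * (q * \<xi> powr (q - 1))"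
      using mvt[OF r] by blast
    have "0 < q * ((r - 1) * (\<xi> powr (q - 1) - 1))"
    proof (rule mult_pos_pos)
      from \<xi>(1) show "0 < (r - 1) * (\<xi> powr (q - 1) - 1)"
      proof
        assume "r < \<xi> \<and> \<xi> < 1"
        then have "\<xi> powr (q - 1) < 1 powr (q - 1)" using q assms by (intro powr_less_mono2) auto
        then show ?thesis using \<open>r < \<xi> \<and> \<xi> < 1\<close> by (intro mult_neg_neg) auto
      next
        assume "1 < \<xi> \<and> \<xi> < r"
        then have "1 powr (q - 1) < \<xi> powr (q - 1)" using q by (intro powr_less_mono2) auto
        then show ?thesis using \<open>1 < \<xi> \<and> \<xi> < r\<close> by (intro mult_pos_pos) auto
      qed
    qed (use q in simp)
    then show ?thesis using \<xi>(2) by (simp add: algebra_simps)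
  qed
  show "r powr q \<le> 1 + q * (r - 1)" if q: "0 < q" "q < 1"
  proof (cases "r = 1")
    case False
    obtain \<xi> where \<xi>: "r < \<xi> \<and> \<xi> < 1 \<or> 1 < \<xi> \<and> \<xi> < r" "r powr q - 1 = (r - 1) * (q * \<xi> powr (q - 1))"
      using mvt[OF False] by blast
    have "0 \<le> q * ((r - 1) * (1 - \<xi> powr (q - 1)))"
    proof (rule mult_nonneg_nonneg)
      from \<xi>(1) show "0 \<le> (r - 1) * (1 - \<xi> powr (q - 1))"
      proof
        assume *: "r < \<xi> \<and> \<xi> < 1"
        then have "1 powr (q - 1) \<le> \<xi> powr (q - 1)" using q assms by (intro powr_mono2') auto
        then show ?thesis using * by (intro mult_nonpos_nonpos) auto
      next
        assume *: "1 < \<xi> \<and> \<xi> < r"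
        then have "\<xi> powr (q - 1) \<le> 1 powr (q - 1)" using q by (intro powr_mono2') auto
        then show ?thesis using * by (intro mult_nonneg_nonneg) auto
      qed
    qed (use q in simp)
    then show ?thesis using \<xi>(2) by (simp add: algebra_simps)
  qed simp
qed

text \<open>The classical constant \<open>(h + 1)^2 / (4 h)\<close> in the logarithmic coordinate
  \<open>h = e^(2v)\<close>.\<close>

lemma kantorovich_exp_two: "kantorovich (exp (2 * v)) 2 = (cosh v)\<^sup>2"
proof (cases "v = 0")
  case False
  define h where "h = exp (2 * v)"
  have h: "h > 0" "h \<noteq> 1" using False by (auto simp: h_def)
  have "kantorovich h 2 = (h\<^sup>2 - h) / (h - 1) * ((1/2) * ((h\<^sup>2 - 1) / (h\<^sup>2 - h))) powr 2"
    using h by (simp add: kantorovich_def)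
  also have "(h\<^sup>2 - h) / (h - 1) = h" using h by (simp add: field_simps power2_eq_square)
  also have "(h\<^sup>2 - 1) / (h\<^sup>2 - h) = (h + 1) / h"
  proof -
    have "h\<^sup>2 - 1 = (h + 1) * (h - 1)" "h\<^sup>2 - h = h * (h - 1)" by (simp_all add: power2_eq_square algebra_simps)
    then show ?thesis using h by simp
  qed
  also have "h * ((1/2) * ((h + 1) / h)) powr 2 = (h + 1)\<^sup>2 / (4 * h)"
    using h by (simp add: power2_eq_square field_simps)
  also have "\<dots> = (cosh v)\<^sup>2"
  proof -
    have "h = exp v * exp v" by (simp add: h_def flip: exp_add)
    then show ?thesis by (simp add: cosh_def exp_minus power2_eq_square field_simps)
  qed
  finally show ?thesis by (simp add: h_def)
qed (simp add: kantorovich_def)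

section \<open>Kantorovich constants as tangency constants of chords\<close>

context
  fixes u :: real
  assumes u: "u > 0"
begin

text \<open>As a function of \<open>y \<in> [e\<^sup>-\<^sup>u, e\<^sup>u]\<close>, \<open>chord q y\<close> is the chord of \<open>t\<^sup>q\<close>;
  \<open>tangency q\<close> is where it touches \<open>kappa q * y\<^sup>q\<close>.\<close>

definition shc :: "real \<Rightarrow> real" where "shc q = sinh (q * u) / q"
definition chord :: "real \<Rightarrow> real \<Rightarrow> real"
  where "chord q y = (y * sinh (q * u) - sinh ((q - 1) * u)) / sinh u"
definition tangency :: "real \<Rightarrow> real" where "tangency q = shc (q - 1) / shc q"
definition kappa :: "real \<Rightarrow> real" where "kappa q = kantorovich (exp (2 * u)) q"

lemma sinh_u_pos: "sinh u > 0" using u by simp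

lemma shc_pos: "q \<noteq> 0 \<Longrightarrow> shc q > 0"
  unfolding shc_def using u by (cases "q > 0") (auto simp: divide_neg_neg mult_neg_pos)

lemma shc_minus: "shc (- q) = shc q"
  by (simp add: shc_def)

lemma shc_strict_mono: "0 < x \<Longrightarrow> x < y \<Longrightarrow> shc x < shc y"
  using sinh_div_strict_mono[of "x * u" "y * u"] u by (simp add: shc_def field_simps)

lemma tangency_pos: "q \<noteq> 0 \<Longrightarrow> q \<noteq> 1 \<Longrightarrow> tangency q > 0"
  by (simp add: tangency_def shc_pos)

lemma tangency_less_1: "q > 1 \<Longrightarrow> tangency q < 1"
  using shc_strict_mono[of "q - 1" q] shc_pos[of q] by (simp add: tangency_def)

lemma kappa_0 [simp]: "kappa 0 = 1" and kappa_1 [simp]: "kappa 1 = 1"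
  by (simp_all add: kappa_def kantorovich_def)

text \<open>With \<open>h = e^(2u)\<close> every difference of powers of \<open>h\<close> is an
  exponential times a hyperbolic sine, and the exponentials cancel.\<close>

lemma kappa_eq:
  assumes "q \<noteq> 0" "q \<noteq> 1"
  shows "kappa q = shc q / shc 1 * tangency q powr (1 - q)"
proof -
  have s: "sinh x = (exp x - exp (- x)) / 2" for x :: real by (simp add: sinh_def)
  have e1: "exp (2 * u) powr q = exp (q * u) * exp (q * u)" by (simp add: powr_def flip: exp_add)
  have d1: "exp (2 * u) powr q - exp (2 * u) = 2 * exp ((q + 1) * u) * sinh ((q - 1) * u)"
    unfolding e1 s by (simp add: right_diff_distrib algebra_simps flip: exp_add)
  have d2: "exp (2 * u) - 1 = 2 * exp u * sinh u"
  proof -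
    have "exp (2 * u) = exp u * exp u" by (simp flip: exp_add)
    then show ?thesis unfolding s by (simp add: field_simps exp_minus)
  qed
  have d3: "exp (2 * u) powr q - 1 = 2 * exp (q * u) * sinh (q * u)"
    unfolding e1 s by (simp add: field_simps exp_minus)
  have nz: "sinh ((q - 1) * u) \<noteq> 0" "sinh (q * u) \<noteq> 0" using assms u by simp_all
  have f1: "(exp (2 * u) powr q - exp (2 * u)) / ((q - 1) * (exp (2 * u) - 1)) = exp (q * u) * (shc (q - 1) / shc 1)"
  proof -
    have "exp ((q + 1) * u) = exp (q * u) * exp u" by (simp add: algebra_simps flip: exp_add)
    then show ?thesis unfolding d1 d2 shc_def using assms sinh_u_pos by (simp add: field_simps)
  qed
  have f2: "(q - 1) / q * ((exp (2 * u) powr q - 1) / (exp (2 * u) powr q - exp (2 * u))) = exp (- u) / tangency q"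
  proof -
    have "exp ((q + 1) * u) = exp (q * u) * exp u" by (simp add: algebra_simps flip: exp_add)
    then show ?thesis unfolding d1 d3 tangency_def shc_def using assms nz by (simp add: field_simps exp_minus)
  qed
  have T: "tangency q > 0" using assms by (rule tangency_pos)
  have "kappa q = exp (q * u) * (shc (q - 1) / shc 1) * (exp (- u) / tangency q) powr q"
    using assms u unfolding kappa_def kantorovich_def f1 f2 by simp
  also have "(exp (- u) / tangency q) powr q = exp (- (q * u)) * tangency q powr (- q)"
  proof -
    have "(exp (- u) / tangency q) powr q = exp (- u) powr q / tangency q powr q"
      by (rule powr_divide)
    then show ?thesis by (simp add: exp_powr_real powr_minus_divide mult.commute)
  qed
  also have "shc (q - 1) / shc 1 = shc q / shc 1 * tangency q"
    using shc_pos[OF assms(1)] by (simp add: tangency_def)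
  finally show ?thesis using T by (simp add: powr_diff powr_minus exp_minus field_simps)
qed

lemma kappa_pos: "kappa q > 0"
  using kappa_eq[of q] shc_pos tangency_pos[of q] by (cases "q = 0 \<or> q = 1") auto

lemma chord_0 [simp]: "chord 0 y = 1" and chord_1 [simp]: "chord 1 y = y"
  using u by (simp_all add: chord_def)

text \<open>The right-hand side is the tangent line of \<open>kappa q * y^q\<close> at
  \<open>tangency q\<close>: \<open>kappa q\<close> is the factor by which a power must be scaled to
  touch its chord. Bernoulli's inequality then decides on which side the chord lies.\<close>

lemma chord_tangent:
  assumes "q \<noteq> 0" "q \<noteq> 1"
  shows "chord q y = kappa q * tangency q powr q * (1 + q * (y / tangency q - 1))"
proof -
  have T: "tangency q > 0" using assms by (rule tangency_pos)
  have "kappa q * tangency q powr q = shc q / shc 1 * tangency q"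
    unfolding kappa_eq[OF assms] using T by (simp flip: powr_add)
  then have "kappa q * tangency q powr q * (1 + q * (y / tangency q - 1))
      = shc q / shc 1 * tangency q * (1 + q * (y / tangency q - 1))" by simp
  also have "\<dots> = shc q / shc 1 * (q * y - (q - 1) * tangency q)"
    using T shc_pos[of 1] by (simp add: field_simps)
  also have "\<dots> = chord q y"
    using assms shc_pos[of q] sinh_u_pos
    by (simp add: tangency_def chord_def shc_def field_simps)
  finally show ?thesis by simp
qed

lemma chord_le_kappa:
  assumes "q > 1" "y > 0"
  shows "chord q y \<le> kappa q * y powr q" and "y \<noteq> tangency q \<Longrightarrow> chord q y < kappa q * y powr q"
    and "chord q (tangency q) = kappa q * tangency q powr q"
proof -
  have T: "tangency q > 0" using assms tangency_pos by simp
  have eq: "chord q y = kappa q * tangency q powr q * (1 + q * (y / tangency q - 1))" for y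
    using chord_tangent assms by simp
  have y: "kappa q * y powr q = kappa q * tangency q powr q * (y / tangency q) powr q"
    using T assms by (simp add: powr_divide)
  show "chord q (tangency q) = kappa q * tangency q powr q" using T by (simp add: eq)
  show lt: "chord q y < kappa q * y powr q" if "y \<noteq> tangency q"
    unfolding eq y using powr_tangent(1)[of "y / tangency q" q] that assms T kappa_pos[of q] by simp
  show "chord q y \<le> kappa q * y powr q"
    using lt eq[of y] T by (cases "y = tangency q") auto
qed

lemma kappa_le_chord:
  assumes "0 \<le> q" "q \<le> 1" "y > 0"
  shows "kappa q * y powr q \<le> chord q y"
proof (cases "q = 0 \<or> q = 1")
  case True
  then show ?thesis using assms by auto
next
  case False
  then have q: "0 < q" "q < 1" "q \<noteq> 0" "q \<noteq> 1" using assms by auto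
  have T: "tangency q > 0" using q(3,4) by (rule tangency_pos)
  have "kappa q * y powr q = kappa q * tangency q powr q * (y / tangency q) powr q"
    using T assms by (simp add: powr_divide)
  also have "\<dots> \<le> chord q y"
    unfolding chord_tangent[OF q(3,4)]
    using powr_tangent(2)[of "y / tangency q" q] q assms T kappa_pos[of q] by (intro mult_left_mono) auto
  finally show ?thesis .
qed

lemma chord_mono: "0 \<le> q \<Longrightarrow> y \<le> y' \<Longrightarrow> chord q y \<le> chord q y'"
  unfolding chord_def using u by (intro divide_right_mono diff_right_mono mult_right_mono) auto

lemma chord_exp: "chord q (exp (- u)) = exp (- (q * u))" "chord q (exp u) = exp (q * u)"
proof -
  have s: "sinh ((q - 1) * u) = sinh (q * u) * cosh u - cosh (q * u) * sinh u"
    using sinh_diff[of "q * u" u] by (simp add: left_diff_distrib)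
  have e: "exp (- u) = cosh u - sinh u" "exp u = cosh u + sinh u" "exp (- (q * u)) = cosh (q * u) - sinh (q * u)"
    "exp (q * u) = cosh (q * u) + sinh (q * u)"
    by (simp_all add: cosh_minus_sinh cosh_plus_sinh)
  show "chord q (exp (- u)) = exp (- (q * u))" "chord q (exp u) = exp (q * u)"
    unfolding chord_def s e using sinh_u_pos by (simp_all add: field_simps)
qed

lemma chord_pos: "0 \<le> q \<Longrightarrow> exp (- u) \<le> y \<Longrightarrow> exp (- (q * u)) \<le> chord q y"
  using chord_mono[of q "exp (- u)" y] by (simp add: chord_exp)

text \<open>For \<open>m = 1 / cosh (x * u)\<close> and \<open>c = chord x y\<close>, the right-hand
  side is \<open>cosh (x * u)^2\<close> times \<open>2 m c - m^2\<close>. This singles out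
  \<open>m\<close> as the cut-off level.\<close>

lemma chord_double: "chord (2 * x) y = 2 * cosh (x * u) * chord x y - 1"
proof -
  have "sinh ((2 * x - 1) * u) = sinh (x * u) * cosh ((x - 1) * u) + cosh (x * u) * sinh ((x - 1) * u)"
    using sinh_add[of "x * u" "(x - 1) * u"] by (simp add: algebra_simps)
  moreover have "sinh (2 * x * u) = 2 * sinh (x * u) * cosh (x * u)"
    using sinh_double[of "x * u"] by (simp add: mult.assoc)
  moreover have "sinh u = sinh (x * u) * cosh ((x - 1) * u) - cosh (x * u) * sinh ((x - 1) * u)"
    using sinh_diff[of "x * u" "(x - 1) * u"] by (simp add: algebra_simps)
  ultimately have "y * sinh (2 * x * u) - sinh ((2 * x - 1) * u) =
      2 * cosh (x * u) * (y * sinh (x * u) - sinh ((x - 1) * u)) - sinh u"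
    by (simp add: algebra_simps)
  then show ?thesis unfolding chord_def using sinh_u_pos by (simp add: field_simps)
qed

text \<open>The sign decides which branch of the cut-off is active; for \<open>x > 0\<close> it
  changes at \<open>y = cosh ((1 - x) * u) / cosh (x * u)\<close>.\<close>

lemma one_minus_cosh_chord:
  "1 - cosh (x * u) * chord x y = sinh (x * u) * (cosh ((1 - x) * u) - y * cosh (x * u)) / sinh u"
proof -
  have "sinh u = sinh (x * u) * cosh ((1 - x) * u) + cosh (x * u) * sinh ((1 - x) * u)"
    using sinh_add[of "x * u" "(1 - x) * u"] by (simp add: algebra_simps)
  moreover have "sinh ((x - 1) * u) = - sinh ((1 - x) * u)"
    using sinh_minus[of "(1 - x) * u"] by (simp add: algebra_simps)
  ultimately have "sinh u - cosh (x * u) * (y * sinh (x * u) - sinh ((x - 1) * u))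
      = sinh (x * u) * (cosh ((1 - x) * u) - y * cosh (x * u))"
    by (simp add: algebra_simps)
  then show ?thesis unfolding chord_def using sinh_u_pos by (simp add: field_simps)
qed

text \<open>A lower bound for the square of an operator \<open>\<ge> chord x X\<close>, obtained from
  \<open>A\<^sup>2 \<ge> 2 m A - m\<^sup>2\<close>; the cut-off keeps \<open>m\<close> below twice the smallest value of the chord.\<close>

definition cutoff :: "real \<Rightarrow> real \<Rightarrow> real" where "cutoff x y = min (chord x y) (1 / cosh (x * u))"
definition square_bound :: "real \<Rightarrow> real \<Rightarrow> real"
  where "square_bound x y = cutoff x y * (2 * chord x y - cutoff x y)"

lemma square_bound_le: "square_bound x y \<le> (chord x y)\<^sup>2"
  using zero_le_power2[of "chord x y - cutoff x y"] unfolding square_bound_def by (simp add: power2_eq_square algebra_simps)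

lemma square_bound_eq: "cosh (x * u) * chord x y \<le> 1 \<Longrightarrow> square_bound x y = (chord x y)\<^sup>2"
  unfolding square_bound_def cutoff_def by (simp add: min_absorb1 field_simps power2_eq_square)

text \<open>Below the cut-off the difference of the two sides is the square of
  \<open>cosh (x * u) * chord x y - 1\<close>; above it there is equality.\<close>

lemma chord_double_le: "chord (2 * x) y \<le> (cosh (x * u))\<^sup>2 * square_bound x y"
proof (cases "cosh (x * u) * chord x y \<le> 1")
  case True
  then show ?thesis
    using zero_le_power2[of "cosh (x * u) * chord x y - 1"]
    unfolding chord_double by (simp add: square_bound_eq power2_eq_square algebra_simps)
next
  case False
  then have "cutoff x y = 1 / cosh (x * u)" by (simp add: cutoff_def min_absorb2 field_simps)
  then show ?thesis unfolding chord_double by (simp add: square_bound_def power2_eq_square field_simps)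
qed

lemma chord_double_less:
  "cosh (x * u) * chord x y < 1 \<Longrightarrow> chord (2 * x) y < (cosh (x * u))\<^sup>2 * square_bound x y"
  using zero_less_power2[of "cosh (x * u) * chord x y - 1"]
  unfolding chord_double by (simp add: square_bound_eq power2_eq_square algebra_simps)

text \<open>The power \<open>t^(2x)\<close> is concave here, so its scaled version lies below its
  chord, which \<open>square_bound\<close> dominates. Strictness for \<open>y < 1\<close> holds
  because the cut-off becomes active only at some \<open>y \<ge> 1\<close> when
  \<open>0 < x \<le> 1/2\<close>.\<close>

lemma square_bound_small:
  assumes "0 \<le> x" "x \<le> 1/2" "y > 0"
  shows "kappa (2 * x) * y powr (2 * x) \<le> (cosh (x * u))\<^sup>2 * square_bound x y"
    and "0 < x \<Longrightarrow> y < 1 \<Longrightarrow> kappa (2 * x) * y powr (2 * x) < (cosh (x * u))\<^sup>2 * square_bound x y"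
proof -
  have k: "kappa (2 * x) * y powr (2 * x) \<le> chord (2 * x) y"
    by (rule kappa_le_chord) (use assms in auto)
  then show "kappa (2 * x) * y powr (2 * x) \<le> (cosh (x * u))\<^sup>2 * square_bound x y"
    using chord_double_le[of x y] by linarith
  assume x: "0 < x" and y: "y < 1"
  have "cosh (x * u) \<le> cosh ((1 - x) * u)"
    using assms x u by (subst cosh_real_nonneg_le_iff) auto
  moreover have "y * cosh (x * u) < cosh (x * u)" using y by simp
  ultimately have "y * cosh (x * u) < cosh ((1 - x) * u)" by linarith
  then have "0 < 1 - cosh (x * u) * chord x y"
    unfolding one_minus_cosh_chord using x u by (intro divide_pos_pos mult_pos_pos) auto
  then show "kappa (2 * x) * y powr (2 * x) < (cosh (x * u))\<^sup>2 * square_bound x y"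
    using chord_double_less[of x y] k by linarith
qed

lemma kappa_2: "kappa 2 = (cosh u)\<^sup>2"
  unfolding kappa_def by (rule kantorovich_exp_two)

lemma tangency_2: "tangency 2 = 1 / cosh u"
  using u by (simp add: tangency_def shc_def sinh_double)

text \<open>Both claims reduce to \<open>sinh (t u) < t * sinh u\<close> for
  \<open>t = 2x - 1\<close>. The second places the tangency point of \<open>t^(2x)\<close> strictly
  below the cut-off threshold.\<close>

lemma tangency_double:
  assumes x: "1/2 < x" "x < 1"
  shows "tangency (2 * x) \<le> tangency x"
    and "tangency (2 * x) * cosh (x * u) < cosh ((1 - x) * u)"
proof -
  let ?t = "2 * x - 1"
  have S: "shc ?t < shc 1" using shc_strict_mono[of ?t 1] x by simp
  have S2: "shc (2 * x) = shc x * cosh (x * u)"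
    using sinh_double[of "x * u"] by (simp add: shc_def mult.assoc field_simps)
  have T: "tangency (2 * x) = shc ?t / (shc x * cosh (x * u))" by (simp add: tangency_def S2)
  have sp: "shc x > 0" "shc (1 - x) > 0" using x by (auto intro!: shc_pos)
  have sum: "2 * cosh (x * u) * sinh ((1 - x) * u) = sinh u - sinh (?t * u)"
    using sinh_add[of "x * u" "(1 - x) * u"] sinh_diff[of "x * u" "(1 - x) * u"] by (simp add: algebra_simps)
  have sum': "2 * sinh (x * u) * cosh ((1 - x) * u) = sinh u + sinh (?t * u)"
    using sinh_add[of "x * u" "(1 - x) * u"] sinh_diff[of "x * u" "(1 - x) * u"] by (simp add: algebra_simps)
  have cancel: "c * (s / a) = 2 * c * s / (2 * a)" for c s a :: real by simp
  have St: "sinh (?t * u) < ?t * sinh u" using S x by (simp add: shc_def field_simps)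
  have "shc ?t \<le> cosh (x * u) * shc (1 - x)"
  proof -
    have "cosh (x * u) * shc (1 - x) = (sinh u - sinh (?t * u)) / (2 * (1 - x))"
      unfolding sum[symmetric] shc_def by (rule cancel)
    moreover have "shc ?t \<le> (sinh u - sinh (?t * u)) / (2 * (1 - x))"
      using St x by (simp add: shc_def field_simps)
    ultimately show ?thesis by simp
  qed
  then show "tangency (2 * x) \<le> tangency x"
    unfolding T using sp shc_minus[of "1 - x"] by (simp add: tangency_def field_simps)
  have "tangency (2 * x) * cosh (x * u) = shc ?t / shc x" unfolding T by simp
  also have "\<dots> < cosh ((1 - x) * u)"
  proof -
    have "shc x * cosh ((1 - x) * u) = (sinh u + sinh (?t * u)) / (2 * x)"
      unfolding sum'[symmetric] shc_def by simp
    moreover have "shc ?t < (sinh u + sinh (?t * u)) / (2 * x)"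
      using St x by (simp add: shc_def field_simps)
    ultimately show ?thesis using sp by (simp add: pos_divide_less_eq mult.commute)
  qed
  finally show "tangency (2 * x) * cosh (x * u) < cosh ((1 - x) * u)" .
qed

text \<open>Now \<open>t^(2x)\<close> is convex and its chord lies on the wrong side, except at the
  point of contact, where chord and scaled power agree and \<open>chord_double_less\<close> applies.
  Scaling by \<open>r = y / tangency (2x)\<close> carries the strict inequality to smaller
  \<open>y\<close>.\<close>

lemma square_bound_large:
  assumes x: "1/2 < x" "x \<le> 1" and y: "0 < y" "y \<le> tangency (2 * x)"
  shows "kappa (2 * x) * y powr (2 * x) \<le> (cosh (x * u))\<^sup>2 * square_bound x y"
    and "x < 1 \<Longrightarrow> kappa (2 * x) * y powr (2 * x) < (cosh (x * u))\<^sup>2 * square_bound x y"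
proof -
  show less: "kappa (2 * x) * y powr (2 * x) < (cosh (x * u))\<^sup>2 * square_bound x y" if x1: "x < 1"
  proof -
    let ?y1 = "tangency (2 * x)" and ?\<mu> = "tangency x"
    note td = tangency_double[OF x(1) x1]
    have y1: "?y1 > 0" and mu: "?\<mu> > 0" using x x1 by (auto intro!: tangency_pos)
    have small: "cosh (x * u) * chord x z < 1" if "z \<le> ?y1" for z
    proof -
      have "z * cosh (x * u) \<le> ?y1 * cosh (x * u)" using that by simp
      then have "z * cosh (x * u) < cosh ((1 - x) * u)" using td(2) by linarith
      then have "0 < 1 - cosh (x * u) * chord x z"
        unfolding one_minus_cosh_chord using td(2) x u by (intro divide_pos_pos mult_pos_pos) auto
      then show ?thesis by simp
    qed
    define r where "r = y / ?y1"
    have r: "0 < r" "r \<le> 1" using y y1 by (auto simp: r_def)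
    have eq: "chord x z = kappa x * ?\<mu> powr x / ?\<mu> * (x * z + (1 - x) * ?\<mu>)" for z
      using chord_tangent[of x z] x x1 mu by (simp add: field_simps)
    \<comment> \<open>Equivalently, \<open>chord x y / y^x\<close> is at least its value at
      \<open>?y1\<close>; this uses that \<open>?y1\<close> does not exceed the tangency point
      \<open>?\<mu>\<close>.\<close>
    have ch: "r powr x * chord x ?y1 \<le> chord x y"
    proof -
      have "r powr x * (x * ?y1 + (1 - x) * ?\<mu>) \<le> (1 + x * (r - 1)) * (x * ?y1 + (1 - x) * ?\<mu>)"
        using powr_tangent(2)[OF r(1), of x] x x1 y1 mu by (intro mult_right_mono) auto
      also have "\<dots> = x * y + (1 - x) * ?\<mu> + x * (1 - r) * (1 - x) * (?y1 - ?\<mu>)"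
        using y1 by (simp add: r_def field_simps)
      also have "\<dots> \<le> x * y + (1 - x) * ?\<mu>"
        using td(1) x x1 r by (simp add: mult_nonneg_nonpos)
      finally have "r powr x * (x * ?y1 + (1 - x) * ?\<mu>) \<le> x * y + (1 - x) * ?\<mu>" .
      then have "kappa x * ?\<mu> powr x / ?\<mu> * (r powr x * (x * ?y1 + (1 - x) * ?\<mu>)) \<le>
          kappa x * ?\<mu> powr x / ?\<mu> * (x * y + (1 - x) * ?\<mu>)"
        using kappa_pos[of x] mu by (intro mult_left_mono) auto
      then show ?thesis unfolding eq by (simp add: mult_ac)
    qed
    have r2: "(r powr x)\<^sup>2 = r powr (2 * x)" using r by (simp add: powr_power mult.commute)
    have "kappa (2 * x) * ?y1 powr (2 * x) = chord (2 * x) ?y1"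
      using chord_le_kappa(3)[of "2 * x" 1] x by simp
    also have "\<dots> < (cosh (x * u))\<^sup>2 * (chord x ?y1)\<^sup>2"
      using chord_double_less[OF small[OF order_refl]] square_bound_eq[of x ?y1] small[of ?y1] by simp
    finally have "r powr (2 * x) * (kappa (2 * x) * ?y1 powr (2 * x)) < r powr (2 * x) * ((cosh (x * u))\<^sup>2 * (chord x ?y1)\<^sup>2)"
      using r by (intro mult_strict_left_mono) auto
    also have "\<dots> = (cosh (x * u))\<^sup>2 * (r powr x * chord x ?y1)\<^sup>2"
      by (simp add: power_mult_distrib r2 mult_ac)
    also have "\<dots> \<le> (cosh (x * u))\<^sup>2 * (chord x y)\<^sup>2"
    proof (intro mult_left_mono power_mono ch)
      have "0 \<le> chord x ?y1"
        unfolding eq using x x1 mu y1 kappa_pos[of x] by simp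
      then show "0 \<le> r powr x * chord x ?y1" by simp
    qed simp
    also have "(chord x y)\<^sup>2 = square_bound x y"
      using square_bound_eq[of x y] small[OF y(2)] by simp
    finally show ?thesis using r y y1 by (simp add: r_def powr_divide mult.commute)
  qed
  show "kappa (2 * x) * y powr (2 * x) \<le> (cosh (x * u))\<^sup>2 * square_bound x y"
  proof (cases "x < 1")
    case False
    then have x1: "x = 1" using x by simp
    \<comment> \<open>For \<open>x = 1\<close> the chord is \<open>y\<close> itself and both sides
      coincide, so no strict version is possible.\<close>
    have "cosh (x * u) * chord x y \<le> 1" using y by (simp add: x1 tangency_2 field_simps)
    then show ?thesis using y by (simp add: square_bound_eq x1 kappa_2)
  qed (use less in simp)
qed

text \<open>The function \<open>f\<close> below is convex for \<open>t \<ge> 1\<close>, with \<open>f 1 = 0 \<le> f q\<close>, whence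
  \<open>f q \<le> f p\<close>.\<close>

lemma chord_defect_mono:
  assumes q: "1 < q" "q \<le> 2" and qp: "q \<le> p" and y: "tangency q \<le> y"
  shows "kappa q * y powr q / chord q y \<le> kappa p * y powr p / chord p y"
proof -
  let ?y0 = "tangency q"
  have sq: "shc 1 > 0" "shc q > 0" "shc (q - 1) > 0" using q by (auto intro!: shc_pos)
  have y0: "?y0 > 0" using q by (auto intro!: tangency_pos)
  \<comment> \<open>The number \<open>1 / cosh u\<close> is \<open>tangency 2\<close>. From it
    onwards, chords with exponent at least 1 are positive and nondecreasing in the exponent.\<close>
  have y0c: "1 / cosh u \<le> ?y0"
  proof (cases "q = 2")
    case False
    let ?a = "(q - 1) * u"
    have "shc (2 - q) < shc q" using shc_strict_mono[of "2 - q" q] q False by simp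
    then have lt: "sinh ((2 - q) * u) * q \<le> sinh (q * u) * (2 - q)" using q False by (simp add: shc_def field_simps)
    have s1: "sinh (q * u) = sinh ?a * cosh u + cosh ?a * sinh u"
      using sinh_add[of ?a u] by (simp add: algebra_simps)
    have s2: "sinh ((2 - q) * u) = cosh ?a * sinh u - sinh ?a * cosh u"
      using sinh_diff[of u ?a] by (simp add: algebra_simps)
    have "(q - 1) * (cosh ?a * sinh u) \<le> sinh ?a * cosh u"
      using lt unfolding s1 s2 by (simp add: algebra_simps)
    then have "(q - 1) * sinh (q * u) \<le> q * (sinh ?a * cosh u)" unfolding s1 by (simp add: algebra_simps)
    then have "shc q \<le> shc (q - 1) * cosh u" using q by (simp add: shc_def field_simps)
    then show ?thesis using sq by (simp add: tangency_def field_simps)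
  qed (simp add: tangency_2)
  \<comment> \<open>As a function of the exponent, a chord is a combination of
    \<open>cosh (t u)\<close> and \<open>sinh (t u)\<close>, that is, a solution of
    \<open>g'' = u^2 g\<close>.\<close>
  define z where "z = (\<lambda>y. (y - cosh u) / sinh u)"
  have ch: "chord t y = cosh (t * u) + z y * sinh (t * u)" for t y
  proof -
    have "sinh ((t - 1) * u) = sinh (t * u) * cosh u - cosh (t * u) * sinh u"
      using sinh_diff[of "t * u" u] by (simp add: left_diff_distrib)
    then show ?thesis using sinh_u_pos by (simp add: chord_def z_def field_simps)
  qed
  have lower: "cosh ((t - 1) * u) / cosh u \<le> chord t v" "0 \<le> sinh (t * u) + z v * cosh (t * u)"
    if v: "1 / cosh u \<le> v" and t: "1 \<le> t" for v t
  proof -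
    have "1 - cosh u * cosh u = - (sinh u * sinh u)" using cosh_square_eq[of u] by (simp add: power2_eq_square)
    then have z: "- (sinh u / cosh u) \<le> z v"
      using v sinh_u_pos by (simp add: z_def field_simps)
    have "cosh ((t - 1) * u) / cosh u = cosh (t * u) + (- (sinh u / cosh u)) * sinh (t * u)"
      using cosh_diff[of "t * u" u] by (simp add: left_diff_distrib field_simps)
    also have "\<dots> \<le> chord t v" unfolding ch using z t u by (intro add_left_mono mult_right_mono) auto
    finally show "cosh ((t - 1) * u) / cosh u \<le> chord t v" .
    have "0 \<le> sinh ((t - 1) * u) / cosh u" using t u by simp
    also have "\<dots> = sinh (t * u) + (- (sinh u / cosh u)) * cosh (t * u)"
      using sinh_diff[of "t * u" u] by (simp add: left_diff_distrib field_simps)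
    also have "\<dots> \<le> sinh (t * u) + z v * cosh (t * u)" using z by (intro add_left_mono mult_right_mono) auto
    finally show "0 \<le> sinh (t * u) + z v * cosh (t * u)" .
  qed
  have pos: "chord t v > 0" if "1 / cosh u \<le> v" "1 \<le> t" for v t
    using lower(1)[OF that] by (rule less_le_trans[rotated]) simp
  have der: "((\<lambda>t. chord t v) has_real_derivative u * (sinh (t * u) + z v * cosh (t * u))) (at t)" for t v
    unfolding ch by (auto intro!: derivative_eq_intros simp: algebra_simps)
  have mono: "chord s v \<le> chord t v" if "1 \<le> s" "s \<le> t" "1 / cosh u \<le> v" for s t v
    by (rule DERIV_nonneg_imp_nondecreasing[OF that(2)]) (use der lower(2) that u in force)
  have yc: "1 / cosh u \<le> y" and ypos: "y > 0" using y y0c y0 by linarith+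
  define f where "f = (\<lambda>t. ln (chord t ?y0) - ln (chord t y) + t * ln (y / ?y0))"
  define f' where "f' = (\<lambda>t. u * (z ?y0 - z y) / (chord t ?y0 * chord t y) + ln (y / ?y0))"
  have df: "(f has_real_derivative f' t) (at t)" if "1 \<le> t" for t
  proof -
    let ?C = "cosh (t * u)" and ?S = "sinh (t * u)"
    have p: "chord t ?y0 > 0" "chord t y > 0" using pos[OF y0c that] pos[OF yc that] by auto
    have "(f has_real_derivative u * (?S + z ?y0 * ?C) / chord t ?y0 - u * (?S + z y * ?C) / chord t y + ln (y / ?y0)) (at t)"
      unfolding f_def by (rule derivative_eq_intros der p refl | simp)+
    moreover have "u * (?S + z ?y0 * ?C) / chord t ?y0 - u * (?S + z y * ?C) / chord t y
        = u * ((?S + z ?y0 * ?C) * chord t y - (?S + z y * ?C) * chord t ?y0) / (chord t ?y0 * chord t y)"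
      using p by (simp add: field_simps)
    \<comment> \<open>The numerator is the Wronskian of two such solutions up to the factor
      \<open>u\<close>, hence free of \<open>t\<close>; so \<open>f'\<close> depends on
      \<open>t\<close> only through the product of the two chords.\<close>
    moreover have "(?S + z ?y0 * ?C) * chord t y - (?S + z y * ?C) * chord t ?y0 = (z ?y0 - z y) * (?C\<^sup>2 - ?S\<^sup>2)"
      unfolding ch by (simp add: algebra_simps power2_eq_square)
    moreover have "?C\<^sup>2 - ?S\<^sup>2 = 1" by (simp add: cosh_square_eq)
    ultimately show ?thesis by (simp add: f'_def)
  qed
  have zz: "z ?y0 \<le> z y" using y sinh_u_pos by (simp add: z_def divide_right_mono)
  have f'_mono: "f' s \<le> f' t" if "1 \<le> s" "s \<le> t" for s t
  proof -
    have "chord s ?y0 * chord s y \<le> chord t ?y0 * chord t y"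
      using pos[OF y0c that(1)] pos[OF yc that(1)]  mono[OF that y0c] mono[OF that yc]
      by (intro mult_mono) auto
    moreover have "0 < chord s ?y0 * chord s y" using pos[OF y0c that(1)] pos[OF yc that(1)] by simp
    moreover have "0 \<le> u * (z y - z ?y0)" using u zz by simp
    ultimately have "u * (z y - z ?y0) / (chord t ?y0 * chord t y) \<le> u * (z y - z ?y0) / (chord s ?y0 * chord s y)"
      by (intro divide_left_mono mult_pos_pos) (use pos[OF y0c] pos[OF yc] that in auto)
    then show ?thesis by (simp add: f'_def algebra_simps diff_divide_distrib)
  qed
  have f1: "f 1 = 0" using y0 ypos by (simp add: f_def ln_div)
  have chq: "chord q y > 0" using pos[OF yc] q by simp
  \<comment> \<open>An equality, because \<open>?y0\<close> is the point where the chord of exponent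
    \<open>q\<close> touches its scaled power; for \<open>p\<close> only an inequality remains, in
    the direction required.\<close>
  have fq: "f q = ln (kappa q * y powr q / chord q y)"
    unfolding f_def chord_le_kappa(3)[OF q(1) y0]
    using y0 ypos kappa_pos[of q] chq by (simp add: ln_div ln_mult ln_powr algebra_simps)
  have "1 \<le> kappa q * y powr q / chord q y" using chord_le_kappa(1)[OF q(1) ypos] chq by simp
  then have fq0: "f q \<ge> 0" unfolding fq by simp
  have "f q \<le> f p"
  proof (cases "q = p")
    case False
    then have qp': "q < p" using qp by simp
    obtain s where s: "1 < s" "s < q" "f q - f 1 = (q - 1) * f' s"
      using MVT2[OF q(1), of f f'] df by auto
    obtain t where t: "q < t" "t < p" "f p - f q = (p - q) * f' t"
      using MVT2[OF qp', of f f'] df q by auto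
    have "0 \<le> f' s" using s fq0 f1 q by (simp add: zero_le_mult_iff)
    also have "\<dots> \<le> f' t" using f'_mono[of s t] s t by simp
    finally have "0 \<le> f p - f q" unfolding t(3) using qp' by simp
    then show ?thesis by simp
  qed simp
  also have "f p \<le> ln (kappa p * y powr p / chord p y)"
  proof -
    have p: "p > 1" "1 \<le> p" using q qp by auto
    have chp: "chord p y > 0" "chord p ?y0 > 0" using pos[OF yc p(2)] pos[OF y0c p(2)] by auto
    have "ln (chord p ?y0) \<le> ln (kappa p * ?y0 powr p)"
      using chord_le_kappa(1)[OF p(1) y0] chp by simp
    then show ?thesis
      unfolding f_def using y0 ypos kappa_pos[of p] chp by (simp add: ln_div ln_mult ln_powr algebra_simps)
  qed
  finally have "ln (kappa q * y powr q / chord q y) \<le> ln (kappa p * y powr p / chord p y)" unfolding fq .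
  moreover have "chord p y > 0" using pos[OF yc] q qp by simp
  ultimately show ?thesis using chq ypos kappa_pos[of q] kappa_pos[of p] by (subst (asm) ln_le_cancel_iff) auto
qed

text \<open>Dividing leaves \<open>g^2 * \<alpha> * \<beta> > 1\<close>, with \<open>g\<close> and
  \<open>\<beta>\<close> at least 1. Also \<open>\<alpha> \<ge> 1\<close>, unless
  \<open>x > 1/2\<close> and \<open>y\<close> exceeds \<open>tangency (2x)\<close>; there
  \<open>\<alpha>\<close> may be small, but one factor \<open>g\<close> compensates for it, since
  the defect \<open>g2\<close> of the chord of \<open>t^(2x)\<close> satisfies
  \<open>1 / \<alpha> \<le> g2 \<le> g\<close>.\<close>

lemma scalar_inequality_aux:
  assumes x: "0 \<le> x" "x \<le> 1" and w: "0 \<le> w" "w \<le> 1/2" and p: "p = 1 + x + w" and y: "y > 0"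
    and chp: "chord p y > 0" and ch2: "chord (2 * x) y > 0"
    and nontrivial: "\<not> (x = 0 \<and> w = 0)" "\<not> (x = 1 \<and> w = 0)"
  shows "(chord p y)\<^sup>2 * kappa (2 * x) * kappa (2 * w) <
    (kappa p)\<^sup>2 * y\<^sup>2 * ((cosh (x * u))\<^sup>2 * square_bound x y) * ((cosh (w * u))\<^sup>2 * square_bound w y)"
proof -
  define \<alpha> where "\<alpha> = (cosh (x * u))\<^sup>2 * square_bound x y / (kappa (2 * x) * y powr (2 * x))"
  define \<beta> where "\<beta> = (cosh (w * u))\<^sup>2 * square_bound w y / (kappa (2 * w) * y powr (2 * w))"
  define g where "g = kappa p * y powr p / chord p y"
  have kp: "kappa (2 * x) * y powr (2 * x) > 0" "kappa (2 * w) * y powr (2 * w) > 0"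
    using kappa_pos y by simp_all
  have p1: "p > 1" using x w nontrivial(1) p by auto
  have g1: "g \<ge> 1" using chord_le_kappa(1)[OF p1 y] chp by (simp add: g_def)
  have b1: "\<beta> \<ge> 1" using square_bound_small(1)[OF w y] kp by (simp add: \<beta>_def)
  have b1': "\<beta> > 1" if "w > 0" "y < 1" using square_bound_small(2)[OF w y that] kp by (simp add: \<beta>_def)
  \<comment> \<open>The contact point \<open>tangency p\<close> lies below 1, so strictness comes
    from \<open>g\<close> for \<open>y \<ge> 1\<close> and, in the cases below, from a square bound
    for \<open>y < 1\<close>.\<close>
  have gt: "g > 1" if "y \<ge> 1"
    using chord_le_kappa(2)[OF p1 y] tangency_less_1[OF p1] that chp by (simp add: g_def)
  have prod: "1 < g * g * \<alpha> * \<beta>" if "\<alpha> \<ge> 1" "g > 1 \<or> \<alpha> > 1 \<or> \<beta> > 1"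
  proof -
    have gg: "1 \<le> g * g" using mult_mono[of 1 g 1 g] g1 by simp
    have ab: "1 \<le> \<alpha> * \<beta>" using mult_mono[of 1 \<alpha> 1 \<beta>] that b1 by simp
    have "1 < g * g \<or> 1 < \<alpha> * \<beta>"
      using that(2)
    proof (elim disjE)
      assume "g > 1" then show ?thesis using mult_strict_mono[of 1 g 1 g] by simp
    next
      assume "\<alpha> > 1" then show ?thesis using mult_less_le_imp_less[of 1 \<alpha> 1 \<beta>] b1 by simp
    next
      assume "\<beta> > 1" then show ?thesis using mult_le_less_imp_less[of 1 \<alpha> 1 \<beta>] that b1 by simp
    qed
    then have "1 * 1 < (g * g) * (\<alpha> * \<beta>)"
    proof
      assume "1 < g * g" then show ?thesis by (rule mult_less_le_imp_less) (use ab gg in auto)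
    next
      assume "1 < \<alpha> * \<beta>" then show ?thesis by (intro mult_le_less_imp_less) (use ab gg in auto)
    qed
    then show ?thesis by (simp add: mult.assoc)
  qed
  have key: "1 < g * g * \<alpha> * \<beta>"
  proof (cases "x \<le> 1/2")
    case True
    have "\<alpha> \<ge> 1" using square_bound_small(1)[OF x(1) True y] kp by (simp add: \<alpha>_def)
    moreover have "g > 1 \<or> \<alpha> > 1 \<or> \<beta> > 1"
    proof (cases "y < 1")
      case y1: True
      show ?thesis
      proof (cases "x > 0")
        case xp: True
        then have "\<alpha> > 1" using square_bound_small(2)[OF x(1) True y xp y1] kp by (simp add: \<alpha>_def)
        then show ?thesis by simp
      next
        case False
        then have "w > 0" using nontrivial(1) x w by auto
        then show ?thesis using b1' y1 by simp
      qed
    qed (use gt in auto)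
    ultimately show ?thesis by (rule prod)
  next
    case False
    then have x2: "1/2 < x" by simp
    show ?thesis
    proof (cases "y \<le> tangency (2 * x)")
      case True
      have "\<alpha> \<ge> 1" using square_bound_large(1)[OF x2 x(2) y True] kp by (simp add: \<alpha>_def)
      moreover have "g > 1 \<or> \<alpha> > 1 \<or> \<beta> > 1"
      proof (cases "x < 1")
        case x1: True
        then have "\<alpha> > 1" using square_bound_large(2)[OF x2 x(2) y True x1] kp by (simp add: \<alpha>_def)
        then show ?thesis by simp
      next
        case False
        then have "w > 0" using nontrivial(2) x w by auto
        then show ?thesis using b1' gt by (cases "y < 1") auto
      qed
      ultimately show ?thesis by (rule prod)
    next
      case False
      define g2 where "g2 = kappa (2 * x) * y powr (2 * x) / chord (2 * x) y"
      have g2: "g2 > 1" using chord_le_kappa(2)[of "2 * x" y] False x2 y ch2 by (simp add: g2_def)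
      have gg2: "g2 \<le> g" unfolding g_def g2_def
        by (rule chord_defect_mono) (use False x2 x w p in auto)
      have a: "1 / g2 \<le> \<alpha>"
        using chord_double_le[of x y] kp by (simp add: g2_def \<alpha>_def divide_right_mono)
      have "1 < g2 * g2 * (1 / g2) * 1" using g2 by simp
      also have "\<dots> \<le> g * g * \<alpha> * \<beta>"
        using g2 gg2 a b1 by (intro mult_mono mult_nonneg_nonneg) (auto intro: order_trans[rotated])
      finally show ?thesis .
    qed
  qed
  have e: "y powr p * y powr p = y\<^sup>2 * (y powr (2 * x) * y powr (2 * w))"
  proof -
    have "y powr p * y powr p = y powr (2 + (2 * x + 2 * w))" by (simp add: p algebra_simps flip: powr_add)
    also have "\<dots> = y powr 2 * (y powr (2 * x) * y powr (2 * w))" by (simp only: powr_add)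
    finally show ?thesis using y by simp
  qed
  have "g * g * \<alpha> * \<beta> = ((kappa p)\<^sup>2 * y\<^sup>2 * ((cosh (x * u))\<^sup>2 * square_bound x y) * ((cosh (w * u))\<^sup>2 * square_bound w y))
      / ((chord p y)\<^sup>2 * kappa (2 * x) * kappa (2 * w))"
  proof -
    have cancel: "k * Y / c * (k * Y / c) * (A / (k1 * Y1)) * (B / (k2 * Y2)) = k\<^sup>2 * y\<^sup>2 * A * B / (c\<^sup>2 * k1 * k2)"
      if "Y * Y = y\<^sup>2 * (Y1 * Y2)" "c > 0" "k1 > 0" "k2 > 0" "Y1 > 0" "Y2 > 0" for k Y c A k1 Y1 B k2 Y2 :: real
    proof -
      have "k * Y / c * (k * Y / c) * (A / (k1 * Y1)) * (B / (k2 * Y2)) = k\<^sup>2 * (Y * Y) * A * B / (c\<^sup>2 * k1 * k2 * (Y1 * Y2))"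
        by (simp add: power2_eq_square mult_ac)
      then show ?thesis unfolding that(1) using that(2-) by (simp add: field_simps)
    qed
    show ?thesis unfolding g_def \<alpha>_def \<beta>_def
      by (rule cancel[OF e chp kappa_pos kappa_pos]) (use y in auto)
  qed
  moreover have "(chord p y)\<^sup>2 * kappa (2 * x) * kappa (2 * w) > 0" using chp kappa_pos by simp
  ultimately show ?thesis using key by simp
qed

text \<open>The auxiliary inequality treats both exponents alike, so either may be the one bounded
  by 1/2. Afterwards the square bound for \<open>b\<close> is enlarged to the full square, because
  the inner operator loses nothing in \<open>product_lower_bound\<close>. In the excluded cases
  equality can occur.\<close>

theorem scalar_inequality:
  assumes a: "0 \<le> a" "a \<le> 1" and b: "0 \<le> b" "b \<le> 1" and ab: "min a b \<le> 1/2"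
    and nontrivial: "\<not> (a = 0 \<and> b = 0)" "\<not> (a = 1 \<and> b = 0)" "\<not> (a = 0 \<and> b = 1)"
    and y: "exp (- u) \<le> y"
    and K: "K = cosh (a * u) * cosh (b * u) * kappa (2 * b) powr (- 1/2) * kappa (2 * a) powr (- 1/2) * kappa (1 + (a + b))"
  shows "(chord (1 + (a + b)) y)\<^sup>2 < K\<^sup>2 * y\<^sup>2 * (chord b y)\<^sup>2 * square_bound a y" "K > 0"
proof -
  let ?p = "1 + (a + b)"
  have ypos: "y > 0" using y exp_gt_zero[of "- u"] by linarith
  have ch: "chord q y > 0" if "q \<ge> 0" for q using chord_pos[OF that y] exp_gt_zero[of "- (q * u)"] by linarith
  show K0: "K > 0" unfolding K by (simp add: kappa_pos less_imp_neq[OF kappa_pos, symmetric])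
  have main: "(chord ?p y)\<^sup>2 * (kappa (2 * a) * kappa (2 * b)) <
    (kappa ?p)\<^sup>2 * y\<^sup>2 * (((cosh (a * u))\<^sup>2 * square_bound a y) * ((cosh (b * u))\<^sup>2 * square_bound b y))"
  proof (cases "b \<le> 1/2")
    case True
    show ?thesis
      using scalar_inequality_aux[OF a b(1) True _ ypos, of ?p] ch a b nontrivial by (simp add: mult_ac)
  next
    case False
    then have "a \<le> 1/2" using ab by simp
    moreover have "\<not> (b = 0 \<and> a = 0)" "\<not> (b = 1 \<and> a = 0)" using nontrivial by auto
    ultimately show ?thesis
      using scalar_inequality_aux[OF b a(1) _ _ ypos, of ?p] ch a b by (simp add: mult_ac)
  qed
  have sq: "(kappa q powr (- 1/2))\<^sup>2 = 1 / kappa q" for q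
  proof -
    have "(kappa q powr (- 1/2))\<^sup>2 = kappa q powr (- 1/2 + - 1/2)"
      unfolding power2_eq_square powr_add ..
    also have "\<dots> = 1 / kappa q" using kappa_pos[of q] by (simp add: powr_minus_divide)
    finally show ?thesis .
  qed
  have KK: "K\<^sup>2 * (kappa (2 * a) * kappa (2 * b)) = (kappa ?p)\<^sup>2 * ((cosh (a * u))\<^sup>2 * (cosh (b * u))\<^sup>2)"
    unfolding K power_mult_distrib sq using kappa_pos[of "2 * a"] kappa_pos[of "2 * b"] by (simp add: field_simps)
  have "(chord ?p y)\<^sup>2 * (kappa (2 * a) * kappa (2 * b)) < (K\<^sup>2 * y\<^sup>2 * square_bound b y * square_bound a y) * (kappa (2 * a) * kappa (2 * b))"
  proof -
    have "(K\<^sup>2 * y\<^sup>2 * square_bound b y * square_bound a y) * (kappa (2 * a) * kappa (2 * b))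
        = (K\<^sup>2 * (kappa (2 * a) * kappa (2 * b))) * (y\<^sup>2 * square_bound b y * square_bound a y)" by (simp only: mult_ac)
    also have "\<dots> = (kappa ?p)\<^sup>2 * y\<^sup>2 * (((cosh (a * u))\<^sup>2 * square_bound a y) * ((cosh (b * u))\<^sup>2 * square_bound b y))"
      unfolding KK by (simp only: mult_ac)
    finally show ?thesis by (rule ssubst) (rule main)
  qed
  then have "(chord ?p y)\<^sup>2 < K\<^sup>2 * y\<^sup>2 * square_bound b y * square_bound a y"
    using kappa_pos[of "2 * a"] kappa_pos[of "2 * b"] by simp
  also have "\<dots> \<le> K\<^sup>2 * y\<^sup>2 * (chord b y)\<^sup>2 * square_bound a y"
  proof -
    have "0 < chord (2 * a) y" using ch a by simp
    then have "0 < (cosh (a * u))\<^sup>2 * square_bound a y" using chord_double_le[of a y] by linarith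
    then have "0 \<le> square_bound a y" by (simp add: zero_less_mult_iff)
    then show ?thesis by (intro mult_right_mono mult_left_mono square_bound_le) auto
  qed
  finally show "(chord ?p y)\<^sup>2 < K\<^sup>2 * y\<^sup>2 * (chord b y)\<^sup>2 * square_bound a y" .
qed

end

section \<open>Powers and positive linear maps\<close>

text \<open>Write \<open>y\<close> as a convex combination of the endpoints, with weights
  \<open>l\<close> and \<open>1 - l\<close>. Relative to \<open>y\<close> the endpoints
  \<open>r\<close> and \<open>s\<close> have mean 1, so the linear terms of Bernoulli's inequality
  cancel.\<close>

lemma chord_powr:
  assumes u: "u > 0" and y: "exp (- u) \<le> y" "y \<le> exp u"
  shows "1 \<le> q \<Longrightarrow> y powr q \<le> chord u q y" and "0 \<le> q \<Longrightarrow> q \<le> 1 \<Longrightarrow> chord u q y \<le> y powr q"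
proof -
  have y0: "y > 0" using y(1) exp_gt_zero[of "- u"] by linarith
  define d where "d = exp u - exp (- u)"
  have d: "d > 0" using u by (simp add: d_def)
  define l where "l = (y - exp (- u)) / d"
  have l: "0 \<le> l" "l \<le> 1" using y d by (auto simp: l_def field_simps d_def)
  have yl: "y = l * exp u + (1 - l) * exp (- u)"
  proof -
    have "l * d = y - exp (- u)" using d by (simp add: l_def)
    then show ?thesis by (simp add: d_def algebra_simps)
  qed
  define r where "r = exp u / y"
  define s where "s = exp (- u) / y"
  have rs: "r > 0" "s > 0" using y0 by (simp_all add: r_def s_def)
  have lrs: "l * r + (1 - l) * s = 1" using yl y0 by (simp add: r_def s_def field_simps)
  have ch: "chord u q y = y powr q * (l * r powr q + (1 - l) * s powr q)" for q
  proof -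
    have "chord u q y = l * chord u q (exp u) + (1 - l) * chord u q (exp (- u))"
      unfolding chord_def[OF u] by (subst yl) (simp add: add_divide_distrib diff_divide_distrib algebra_simps)
    moreover have "chord u q (exp u) = y powr q * r powr q" "chord u q (exp (- u)) = y powr q * s powr q"
      using y0 u by (simp_all add: chord_exp r_def s_def powr_divide exp_powr_real mult.commute)
    ultimately show ?thesis by (simp add: algebra_simps)
  qed
  have lin: "l * (1 + q * (r - 1)) + (1 - l) * (1 + q * (s - 1)) = 1" for q
  proof -
    have "l * (1 + q * (r - 1)) + (1 - l) * (1 + q * (s - 1)) = 1 + q * ((l * r + (1 - l) * s) - 1)"
      by (simp add: algebra_simps)
    then show ?thesis unfolding lrs by simp
  qed
  show "y powr q \<le> chord u q y" if q: "1 \<le> q"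
  proof -
    have t: "1 + q * (v - 1) \<le> v powr q" if "v > 0" for v
      using powr_tangent(1)[OF that, of q] q by (cases "q = 1 \<or> v = 1") (use that in auto)
    have "l * (1 + q * (r - 1)) + (1 - l) * (1 + q * (s - 1)) \<le> l * r powr q + (1 - l) * s powr q"
      using l rs t by (intro add_mono mult_left_mono) auto
    then have "1 \<le> l * r powr q + (1 - l) * s powr q" unfolding lin .
    then show ?thesis unfolding ch using mult_left_mono[of 1 _ "y powr q"] by simp
  qed
  show "chord u q y \<le> y powr q" if q: "0 \<le> q" "q \<le> 1"
  proof -
    have t: "v powr q \<le> 1 + q * (v - 1)" if "v > 0" for v
      using powr_tangent(2)[OF that, of q] q by (cases "q = 0 \<or> q = 1") (use that in auto)
    have "l * r powr q + (1 - l) * s powr q \<le> l * (1 + q * (r - 1)) + (1 - l) * (1 + q * (s - 1))"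
      using l rs t by (intro add_mono mult_left_mono) auto
    then have "l * r powr q + (1 - l) * s powr q \<le> 1" unfolding lin .
    then show ?thesis unfolding ch using mult_left_mono[of _ 1 "y powr q"] by simp
  qed
qed

text \<open>A chord is affine, so its value at \<open>X\<close> can be written down without
  functional calculus.\<close>

definition chord_op :: "real \<Rightarrow> real \<Rightarrow> 'a::chilbert_space bop \<Rightarrow> 'a bop"
  where "chord_op u q X = (sinh (q * u) / sinh u) *\<^sub>R X - (sinh ((q - 1) * u) / sinh u) *\<^sub>R 1"

lemma inner_chord_op:
  "x \<bullet> bop_apply (chord_op u q X) x = sinh (q * u) / sinh u * (x \<bullet> bop_apply X x) - sinh ((q - 1) * u) / sinh u * (norm x)\<^sup>2"
  by (simp add: chord_op_def inner_diff_right dot_square_norm)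

lemma chord_eq: "u > 0 \<Longrightarrow> chord u q y = sinh (q * u) / sinh u * y - sinh ((q - 1) * u) / sinh u"
  by (simp add: chord_def diff_divide_distrib mult.commute)

lemma inner_chord_op_ge:
  assumes "u > 0" "q \<ge> 0" "y * (norm x)\<^sup>2 \<le> x \<bullet> bop_apply X x"
  shows "chord u q y * (norm x)\<^sup>2 \<le> x \<bullet> bop_apply (chord_op u q X) x"
proof -
  have "sinh (q * u) / sinh u * (y * (norm x)\<^sup>2) \<le> sinh (q * u) / sinh u * (x \<bullet> bop_apply X x)"
    using assms by (intro mult_left_mono) auto
  then show ?thesis unfolding inner_chord_op chord_eq[OF assms(1)] by (simp add: left_diff_distrib mult.assoc)
qed

lemma inner_chord_op_le:
  assumes "u > 0" "q \<ge> 0" "x \<bullet> bop_apply X x \<le> y * (norm x)\<^sup>2"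
  shows "x \<bullet> bop_apply (chord_op u q X) x \<le> chord u q y * (norm x)\<^sup>2"
proof -
  have "sinh (q * u) / sinh u * (x \<bullet> bop_apply X x) \<le> sinh (q * u) / sinh u * (y * (norm x)\<^sup>2)"
    using assms by (intro mult_left_mono) auto
  then show ?thesis unfolding inner_chord_op chord_eq[OF assms(1)] by (simp add: left_diff_distrib mult.assoc)
qed

subsection \<open>Lower bound on spectral subspaces\<close>

text \<open>\<open>X\<close> preserves the range of \<open>F\<close>, and \<open>B\<close> is
  measured there by its compression to that range, for which Cauchy-Schwarz suffices.
  \<open>A\<close> then acts on a vector that has left the range; its square is linearised with
  parameter \<open>m\<close>.\<close>

lemma product_lower_bound:
  fixes X A B F :: "'a::chilbert_space bop"
  assumes u: "u > 0" and F: "projection F" "F * X = X * F"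
    and Xl: "\<And>x. exp (- u) * (norm x)\<^sup>2 \<le> x \<bullet> bop_apply X x"
    and FX: "\<And>x. bop_apply F x = x \<Longrightarrow> y * (norm x)\<^sup>2 \<le> x \<bullet> bop_apply X x"
    and A: "self_adjoint A" "\<And>x. x \<bullet> bop_apply (chord_op u a X) x \<le> x \<bullet> bop_apply A x"
    and B: "\<And>x. x \<bullet> bop_apply (chord_op u b X) x \<le> x \<bullet> bop_apply B x"
    and ab: "0 \<le> a" "0 \<le> b" and y: "exp (- u) \<le> y"
    and v: "bop_apply F v = v"
  shows "y * chord u b y * sqrt (square_bound u a y) * norm v \<le> norm (bop_apply (A * B * X) v)"
proof -
  have FXc: "bop_apply F (bop_apply X x) = bop_apply X (bop_apply F x)" for x
    using F(2) by (metis bop_apply_simps(6))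
  have y0: "y > 0" using y exp_gt_zero[of "- u"] by linarith
  have ch: "chord u q y > 0" if "q \<ge> 0" for q
    using chord_pos[OF u that y] exp_gt_zero[of "- (q * u)"] by linarith
  have cs: "c * norm s \<le> norm t" if "c * (norm s)\<^sup>2 \<le> s \<bullet> t" for c and s t :: 'a
  proof (cases "s = 0")
    case False
    have "norm s * (c * norm s) \<le> norm s * norm t"
      using that norm_cauchy_schwarz[of s t] by (simp add: power2_eq_square mult_ac)
    then show ?thesis by (rule mult_left_le_imp_le) (use False in simp)
  qed simp
  define w where "w = bop_apply X v"
  define \<eta> where "\<eta> = bop_apply B w"
  have Fw: "bop_apply F w = w" by (simp add: w_def FXc v)
  have vw: "y * norm v \<le> norm w" unfolding w_def by (rule cs[OF FX[OF v]])
  have w\<eta>: "chord u b y * norm w \<le> norm (bop_apply F \<eta>)"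
  proof (rule cs)
    have "chord u b y * (norm w)\<^sup>2 \<le> w \<bullet> bop_apply (chord_op u b X) w"
      by (rule inner_chord_op_ge[OF u ab(2) FX[OF Fw]])
    also have "\<dots> \<le> w \<bullet> \<eta>" unfolding \<eta>_def by (rule B)
    also have "\<dots> = w \<bullet> bop_apply F \<eta>" using projectionD(1)[OF F(1), of w \<eta>] Fw by simp
    finally show "chord u b y * (norm w)\<^sup>2 \<le> w \<bullet> bop_apply F \<eta>" .
  qed
  define m where "m = cutoff u a y"
  have m: "0 < m" "m \<le> 2 * exp (- (a * u))"
  proof -
    show "0 < m" using ch[OF ab(1)] by (simp add: m_def cutoff_def[OF u])
    have "m \<le> 1 / cosh (a * u)" by (simp add: m_def cutoff_def[OF u])
    also have "\<dots> \<le> 1 / (exp (a * u) / 2)"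
      by (intro divide_left_mono) (auto simp: cosh_def intro!: mult_pos_pos add_pos_pos)
    also have "\<dots> = 2 * exp (- (a * u))"
      by (simp add: exp_minus field_simps)
    finally show "m \<le> 2 * exp (- (a * u))" .
  qed
  let ?p = "bop_apply F \<eta>" and ?q = "\<eta> - bop_apply F \<eta>"
  have "bop_apply A \<eta> \<bullet> \<eta> = \<eta> \<bullet> bop_apply A \<eta>" by (rule inner_commute)
  then have "0 \<le> (norm (bop_apply A \<eta>))\<^sup>2 - 2 * m * (\<eta> \<bullet> bop_apply A \<eta>) + m\<^sup>2 * (norm \<eta>)\<^sup>2"
    using zero_le_power2[of "norm (bop_apply A \<eta> - m *\<^sub>R \<eta>)"]
    unfolding norm_diff_scaleR_sq by (simp add: dot_square_norm)
  moreover have "m * (\<eta> \<bullet> bop_apply (chord_op u a X) \<eta>) \<le> m * (\<eta> \<bullet> bop_apply A \<eta>)"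
    using A(2) m(1) by simp
  \<comment> \<open>The chord operator commutes with \<open>F\<close>, so its form splits: level
    \<open>y\<close> inside the range of \<open>F\<close>, and only the bottom level
    \<open>exp (- u)\<close> outside.\<close>
  moreover have "chord u a y * (norm ?p)\<^sup>2 + exp (- (a * u)) * (norm ?q)\<^sup>2 \<le> \<eta> \<bullet> bop_apply (chord_op u a X) \<eta>"
  proof -
    have p: "chord u a y * (norm ?p)\<^sup>2 \<le> ?p \<bullet> bop_apply (chord_op u a X) ?p"
      by (rule inner_chord_op_ge[OF u ab(1) FX]) (rule projectionD(2)[OF F(1)])
    have q: "exp (- (a * u)) * (norm ?q)\<^sup>2 \<le> ?q \<bullet> bop_apply (chord_op u a X) ?q"
      using inner_chord_op_ge[OF u ab(1) Xl, of ?q] u by (simp add: chord_exp)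
    have FC: "bop_apply F (bop_apply (chord_op u a X) x) = bop_apply (chord_op u a X) (bop_apply F x)" for x
      by (simp add: chord_op_def bop_apply_diff bop_apply_scaleR FXc)
    let ?C = "bop_apply (chord_op u a X)"
    have "?p \<bullet> ?C ?p = \<eta> \<bullet> ?C ?p"
      using projectionD(3)[OF F(1), of \<eta> "?C ?p"] by (simp add: FC projectionD(2)[OF F(1)])
    moreover have "?p \<bullet> ?C \<eta> = \<eta> \<bullet> ?C ?p"
      using projectionD(1)[OF F(1), of \<eta> "?C \<eta>"] by (simp add: FC)
    ultimately have "\<eta> \<bullet> ?C \<eta> = ?p \<bullet> ?C ?p + ?q \<bullet> ?C ?q"
      by (simp add: bop_apply_diff inner_diff_left inner_diff_right)
    then show ?thesis using p q by simp
  qed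
  then have "m * (chord u a y * (norm ?p)\<^sup>2 + exp (- (a * u)) * (norm ?q)\<^sup>2) \<le> m * (\<eta> \<bullet> bop_apply (chord_op u a X) \<eta>)"
    using m(1) by simp
  moreover have "(norm \<eta>)\<^sup>2 = (norm ?p)\<^sup>2 + (norm ?q)\<^sup>2" by (rule projection_pythagoras[OF F(1)])
  moreover have "0 \<le> m * (2 * exp (- (a * u)) - m) * (norm ?q)\<^sup>2" using m by simp
  ultimately have sq: "square_bound u a y * (norm ?p)\<^sup>2 \<le> (norm (bop_apply A \<eta>))\<^sup>2"
    by (simp add: square_bound_def[OF u] m_def[symmetric] algebra_simps power2_eq_square)
  have sb: "0 \<le> square_bound u a y"
  proof -
    have "m \<le> chord u a y" by (simp add: m_def cutoff_def[OF u])
    then show ?thesis using m(1) by (simp add: square_bound_def[OF u] m_def[symmetric])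
  qed
  have A\<eta>: "sqrt (square_bound u a y) * norm ?p \<le> norm (bop_apply A \<eta>)"
  proof (rule power2_le_imp_le)
    have "(sqrt (square_bound u a y) * norm ?p)\<^sup>2 = square_bound u a y * (norm ?p)\<^sup>2"
      using sb by (simp add: power_mult_distrib)
    then show "(sqrt (square_bound u a y) * norm ?p)\<^sup>2 \<le> (norm (bop_apply A \<eta>))\<^sup>2" using sq by simp
  qed simp
  have "y * chord u b y * sqrt (square_bound u a y) * norm v = sqrt (square_bound u a y) * (chord u b y * (y * norm v))" by simp
  also have "\<dots> \<le> sqrt (square_bound u a y) * (chord u b y * norm w)"
    using vw ch[OF ab(2)] sb by (intro mult_left_mono) auto
  also have "\<dots> \<le> sqrt (square_bound u a y) * norm ?p"
    using w\<eta> sb by (intro mult_left_mono) auto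
  also have "\<dots> \<le> norm (bop_apply A \<eta>)" by (rule A\<eta>)
  finally show ?thesis by (simp add: \<eta>_def w_def)
qed

text \<open>The difference of the two sides is continuous and positive on a compact interval, so its
  minimum serves as \<open>e\<close>. It pays for both the mesh of the partition and the factor
  \<open>1 + d\<close>.\<close>

lemma uniform_slack:
  assumes u: "u > 0" and ab: "0 \<le> a" "0 \<le> b" and K: "K > 0"
    and strict: "\<And>y. exp (- u) \<le> y \<Longrightarrow> (chord u p y)\<^sup>2 < K\<^sup>2 * y\<^sup>2 * (chord u b y)\<^sup>2 * square_bound u a y"
  obtains e where "e > 0" "\<And>y. y \<in> {exp (- u)..exp u} \<Longrightarrow> chord u p y + e \<le> K * (y * chord u b y * sqrt (square_bound u a y))"
proof -
  define f where "f = (\<lambda>y. K * (y * chord u b y * sqrt (square_bound u a y)) - chord u p y)"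
  have cont: "continuous_on {exp (- u)..exp u} f"
    unfolding f_def square_bound_def[OF u] cutoff_def[OF u] chord_def[OF u] using u by (intro continuous_intros) auto
  have pos: "f y > 0" if y: "y \<in> {exp (- u)..exp u}" for y
  proof -
    have y1: "exp (- u) \<le> y" using y by simp
    have y0: "y > 0" using y1 exp_gt_zero[of "- u"] by linarith
    have chb: "chord u b y > 0"
      using chord_pos[OF u ab(2) y1] exp_gt_zero[of "- (b * u)"] by linarith
    have "0 < K\<^sup>2 * y\<^sup>2 * (chord u b y)\<^sup>2 * square_bound u a y"
      using strict[OF y1] zero_le_power2[of "chord u p y"] by linarith
    then have sb: "square_bound u a y > 0" by (rule zero_less_mult_pos) (use K y0 chb in simp)
    have "(chord u p y)\<^sup>2 < (K * (y * chord u b y * sqrt (square_bound u a y)))\<^sup>2"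
      using strict[OF y1] sb by (simp add: power_mult_distrib mult.assoc)
    moreover have "0 \<le> K * (y * chord u b y * sqrt (square_bound u a y))" using K y0 chb sb by simp
    ultimately have "chord u p y < K * (y * chord u b y * sqrt (square_bound u a y))"
      using power2_less_imp_less by blast
    then show ?thesis by (simp add: f_def)
  qed
  have ne: "{exp (- u)..exp u} \<noteq> {}" using u by simp
  obtain y where y: "y \<in> {exp (- u)..exp u}" "\<And>z. z \<in> {exp (- u)..exp u} \<Longrightarrow> f y \<le> f z"
    using continuous_attains_inf[OF compact_Icc ne cont] by blast
  show thesis
  proof (rule that)
    show "f y > 0" by (rule pos[OF y(1)])
    show "chord u p z + f y \<le> K * (z * chord u b z * sqrt (square_bound u a z))" if "z \<in> {exp (- u)..exp u}" for z
      using y(2)[OF that] by (simp add: f_def)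
  qed
qed

text \<open>On the block between \<open>t i\<close> and \<open>t (Suc i)\<close> the chord of
  exponent \<open>p\<close> is bounded by its value at the upper end, while the product is bounded
  below only at the lower end \<open>t i\<close>; the slack \<open>e\<close> absorbs the
  mismatch.\<close>

lemma product_domination:
  fixes X A B P G :: "'a::chilbert_space bop"
  assumes u: "u > 0" and X: "numerical_bounds (exp (- u)) (exp u) X"
    and A: "self_adjoint A" "\<And>x. x \<bullet> bop_apply (chord_op u a X) x \<le> x \<bullet> bop_apply A x"
    and B: "\<And>x. x \<bullet> bop_apply (chord_op u b X) x \<le> x \<bullet> bop_apply B x"
    and P: "\<And>x. x \<bullet> bop_apply P x \<le> x \<bullet> bop_apply (chord_op u p X) x"
    and abp: "0 \<le> a" "0 \<le> b" "0 \<le> p" and K: "K > 0"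
    and strict: "\<And>y. exp (- u) \<le> y \<Longrightarrow> (chord u p y)\<^sup>2 < K\<^sup>2 * y\<^sup>2 * (chord u b y)\<^sup>2 * square_bound u a y"
    and G: "positive_op G" "\<And>v. norm (bop_apply G v) = norm (bop_apply (A * B * X) v)"
  shows "\<exists>W W'. adjoint_pair W W' \<and> W' * W = 1 \<and>
    (\<forall>x. x \<bullet> bop_apply P x \<le> K * (bop_apply W x \<bullet> bop_apply G (bop_apply W x)))"
proof -
  let ?l = "exp (- u)" and ?h = "exp u"
  have Xl: "?l * (norm x)\<^sup>2 \<le> x \<bullet> bop_apply X x" and Xh: "x \<bullet> bop_apply X x \<le> ?h * (norm x)\<^sup>2" for x
    using X by (auto simp: numerical_bounds_def)
  obtain F where F: "\<And>c. projection (F c)" "\<And>c. F c * X = X * F c"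
    "\<And>c x. bop_apply (F c) x = x \<Longrightarrow> c * (norm x)\<^sup>2 \<le> x \<bullet> bop_apply X x"
    "\<And>c x. bop_apply (F c) x = 0 \<Longrightarrow> x \<bullet> bop_apply X x \<le> c * (norm x)\<^sup>2"
    "\<And>c d. c \<le> d \<Longrightarrow> F c * F d = F d" "\<And>c. c \<le> ?l \<Longrightarrow> F c = 1"
    by (rule spectral_projections[OF X]) blast
  obtain e where e: "e > 0" "\<And>y. y \<in> {?l..?h} \<Longrightarrow> chord u p y + e \<le> K * (y * chord u b y * sqrt (square_bound u a y))"
    using uniform_slack[OF u abp(1,2) K strict] by blast
  \<comment> \<open>The slope of the chord of exponent \<open>p\<close>; \<open>s * D\<close> is its
    increment over one cell. The quantities \<open>s * D\<close>, \<open>d * M\<close> and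
    \<open>d * (s * D)\<close> each cost at most \<open>e / 4\<close>.\<close>
  define s where "s = sinh (p * u) / sinh u"
  have s: "s \<ge> 0" using u abp by (simp add: s_def)
  define M where "M = chord u p ?h"
  have M: "M > 0" using u by (simp add: M_def chord_exp)
  define d where "d = min 1 (e / (4 * M))"
  have d: "d > 0" "d \<le> 1" "d * M \<le> e / 4" using e M by (auto simp: d_def min_def field_simps)
  have lh: "?l < ?h" using u by simp
  obtain n where n: "s * (?h - ?l) * 4 / e < real n" using reals_Archimedean2 by blast
  define D where "D = (?h - ?l) / real (Suc n)"
  have D: "D > 0" using lh by (simp add: D_def)
  have sD: "s * D \<le> e / 4"
  proof -
    have "s * (?h - ?l) * 4 \<le> real (Suc n) * e" using n e(1) by (simp add: field_simps)
    then show ?thesis by (simp add: D_def field_simps)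
  qed
  define t where "t = (\<lambda>i. ?l + real i * D)"
  have t_Suc: "t (Suc i) = t i + D" for i by (simp add: t_def algebra_simps)
  have t_mono: "t i \<le> t j" if "i \<le> j" for i j using that D by (simp add: t_def mult_right_mono)
  have t_last: "t (Suc n) = ?h" by (simp add: t_def D_def)
  have t_0: "t 0 = ?l" by (simp add: t_def)
  have t_in: "t i \<in> {?l..?h}" if "i \<le> Suc n" for i
    using t_mono[of 0 i] t_mono[OF that] t_0 t_last by simp
  define Q where "Q = (\<lambda>i. if i \<le> n then F (t i) else 0)"
  have nestQ: "nest Q n"
  proof
    show "projection (Q i)" for i by (simp add: Q_def F projection_zero)
    show "Q i * Q (Suc i) = Q (Suc i)" for i using F(5) t_mono[of i "Suc i"] by (simp add: Q_def)
    show "Q (Suc n) = 0" by (simp add: Q_def)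
  qed
  then interpret Q: nest Q n .
  have Q0: "Q 0 = 1" using F(6)[of "t 0"] t_0 by (simp add: Q_def)
  define c where "c = (\<lambda>i. chord u p (t (Suc i)) / K)"
  have c: "mono c" "0 < c 0"
  proof -
    show "mono c" unfolding c_def
      by (intro monoI divide_right_mono chord_mono[OF u abp(3)] t_mono) (use K in auto)
    have "exp (- (p * u)) \<le> chord u p (t (Suc 0))"
      using chord_pos[OF u abp(3)] t_in[of "Suc 0"] by simp
    then show "0 < c 0" unfolding c_def using K exp_gt_zero[of "- (p * u)"] by (intro divide_pos_pos) linarith+
  qed
  have large: "(1 + d) * c i * norm v \<le> norm (bop_apply G v)" if i: "i \<le> n" and v: "bop_apply (Q i) v = v" for i v
  proof -
    have ti: "t i \<in> {?l..?h}" using t_in[of i] i by simp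
    have Fv: "bop_apply (F (t i)) v = v" using v i by (simp add: Q_def)
    have "chord u p (t (Suc i)) = chord u p (t i) + s * D"
      by (simp add: t_Suc chord_eq[OF u] s_def distrib_left)
    moreover have "chord u p (t i) \<le> M" unfolding M_def using chord_mono[OF u abp(3)] ti by simp
    then have "d * chord u p (t i) \<le> e / 4" using d mult_left_mono[of "chord u p (t i)" M d] by linarith
    moreover have "d * (s * D) \<le> 1 * (s * D)" using d s D by (intro mult_right_mono) auto
    ultimately have "(1 + d) * chord u p (t (Suc i)) \<le> chord u p (t i) + e"
      using sD e(1) by (simp add: algebra_simps)
    also have "\<dots> \<le> K * (t i * chord u b (t i) * sqrt (square_bound u a (t i)))" by (rule e(2)[OF ti])
    finally have "(1 + d) * c i \<le> t i * chord u b (t i) * sqrt (square_bound u a (t i))"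
      using K by (simp add: c_def field_simps)
    then have "(1 + d) * c i * norm v \<le> t i * chord u b (t i) * sqrt (square_bound u a (t i)) * norm v"
      by (rule mult_right_mono) simp
    also have "\<dots> \<le> norm (bop_apply (A * B * X) v)"
      by (rule product_lower_bound[OF u F(1) F(2) Xl F(3) A B abp(1,2) _ Fv]) (use ti in auto)
    finally show ?thesis by (simp only: G(2))
  qed
  obtain W W' where W: "adjoint_pair W W'" "W' * W = 1"
    "\<And>x. (\<Sum>i\<le>n. c i * (norm (bop_apply (Q.E i) x))\<^sup>2) \<le> bop_apply W x \<bullet> bop_apply G (bop_apply W x)"
    using nest_domination[OF G(1) nestQ Q0 c d(1) large] by blast
  have "x \<bullet> bop_apply P x \<le> K * (bop_apply W x \<bullet> bop_apply G (bop_apply W x))" for x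
  proof -
    let ?C = "bop_apply (chord_op u p X)"
    have QX: "bop_apply (Q.E i) (bop_apply X z) = bop_apply X (bop_apply (Q.E i) z)" for i z
    proof -
      have "bop_apply (Q j) (bop_apply X z) = bop_apply X (bop_apply (Q j) z)" for j
        using F(2)[of "t j"] by (cases "j \<le> n") (auto simp: Q_def, metis bop_apply_simps(6))
      then show ?thesis by (simp add: Q.E_def bop_apply_diff)
    qed
    have QC: "bop_apply (Q.E i) (?C z) = ?C (bop_apply (Q.E i) z)" for i z
      by (simp add: chord_op_def bop_apply_diff bop_apply_scaleR QX)
    have sumE: "(\<Sum>i\<le>n. bop_apply (Q.E i) z) = z" for z
      using Q.sum_E Q0 sum_bop_apply[of Q.E "{..n}" z] by simp
    have "x \<bullet> ?C x = x \<bullet> (\<Sum>i\<le>n. bop_apply (Q.E i) (?C x))" by (simp only: sumE)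
    also have "\<dots> = (\<Sum>i\<le>n. bop_apply (Q.E i) x \<bullet> ?C (bop_apply (Q.E i) x))"
    proof -
      have "x \<bullet> bop_apply (Q.E i) (?C x) = bop_apply (Q.E i) x \<bullet> ?C (bop_apply (Q.E i) x)" for i
        using projectionD(3)[OF Q.proj_E, of i x "?C x"] by (simp add: QC)
      then show ?thesis by (simp only: inner_sum_right)
    qed
    also have "\<dots> \<le> (\<Sum>i\<le>n. chord u p (t (Suc i)) * (norm (bop_apply (Q.E i) x))\<^sup>2)"
    proof (intro sum_mono inner_chord_op_le[OF u abp(3)])
      fix i assume "i \<in> {..n}"
      then consider "i < n" | "i = n" by force
      then show "bop_apply (Q.E i) x \<bullet> bop_apply X (bop_apply (Q.E i) x) \<le> t (Suc i) * (norm (bop_apply (Q.E i) x))\<^sup>2"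
      proof cases
        case 1
        have "bop_apply (Q (Suc i)) (bop_apply (Q.E i) x) = 0"
        proof -
          have "Q (Suc i) * Q i = Q (Suc i)" by (rule Q.nested_ge) simp
          moreover have "Q (Suc i) * Q (Suc i) = Q (Suc i)" using Q.proj by (simp add: projection_def)
          ultimately have "Q (Suc i) * Q.E i = 0" by (simp add: Q.E_def algebra_simps)
          then show ?thesis by (metis bop_apply_simps(1,6))
        qed
        then show ?thesis using F(4)[of "t (Suc i)" "bop_apply (Q.E i) x"] 1 by (simp add: Q_def)
      next
        \<comment> \<open>The nest ends with 0 rather than with \<open>F (t (Suc n))\<close>, so the
          last block relies on the upper bound of \<open>X\<close>.\<close>
        case 2
        then show ?thesis using Xh t_last by simp
      qed
    qed
    also have "\<dots> = K * (\<Sum>i\<le>n. c i * (norm (bop_apply (Q.E i) x))\<^sup>2)"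
      using K by (simp add: c_def sum_distrib_left)
    also have "\<dots> \<le> K * (bop_apply W x \<bullet> bop_apply G (bop_apply W x))" using W(3) K by simp
    finally show ?thesis using P[of x] by linarith
  qed
  then show ?thesis using W(1,2) by blast
qed

text \<open>Uniqueness of positive square roots. With \<open>G = abs_op T\<close>, commutation gives
  \<open>(G - T) * (G + T) = 0\<close>, so the form of \<open>G + T\<close> vanishes on the range of
  \<open>G - T\<close>; both summands kill that range, and \<open>(G - T)^2 = 0\<close>.\<close>

lemma abs_op_positive:
  assumes T: "positive_op T"
  shows "abs_op T = T"
proof -
  let ?G = "abs_op T"
  have sa: "self_adjoint T" using T by (simp add: positive_op_iff)
  note G = abs_op_properties[OF sa]
  have comm: "T * ?G = ?G * T" by (rule G(4)) (simp add: mult.assoc)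
  have saG: "self_adjoint ?G" using G(1) by (simp add: positive_op_iff)
  have saD: "self_adjoint (?G - T)" by (rule adjoint_pair_diff[OF saG sa])
  have prod: "(?G - T) * (?G + T) = 0" using G(2) comm by (simp add: algebra_simps)
  have "bop_apply (?G - T) v = bop_apply 0 v" for v
  proof -
    let ?w = "bop_apply (?G - T) v"
    have "?w \<bullet> bop_apply (?G + T) ?w = bop_apply (?G + T) ?w \<bullet> ?w" by (rule inner_commute)
    also have "\<dots> = bop_apply ((?G - T) * (?G + T)) ?w \<bullet> v"
      using adjoint_pairD[OF saD, of "bop_apply (?G + T) ?w" v] by simp
    also have "\<dots> = 0" unfolding prod by simp
    finally have "?w \<bullet> bop_apply ?G ?w + ?w \<bullet> bop_apply T ?w = 0" by (simp add: inner_add_right)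
    moreover have "0 \<le> ?w \<bullet> bop_apply ?G ?w" "0 \<le> ?w \<bullet> bop_apply T ?w"
      using G(1) T unfolding positive_op_iff by blast+
    ultimately have "?w \<bullet> bop_apply ?G ?w = 0" "?w \<bullet> bop_apply T ?w = 0" by linarith+
    then have "bop_apply ?G ?w = 0" "bop_apply T ?w = 0"
      using positive_op_norm_sq_le[OF G(1), of ?w] positive_op_norm_sq_le[OF T, of ?w] by simp_all
    then have "bop_apply (?G - T) ?w = 0" by simp
    then have "?w \<bullet> ?w = 0" using adjoint_pairD[OF saD, of v ?w] by simp
    then show ?thesis by simp
  qed
  then have "?G - T = 0" by (rule bop_eqI)
  then show ?thesis by simp
qed

text \<open>The witness is \<open>W'\<close>, the adjoint of the isometry \<open>W\<close>: a vector
  orthogonal to its kernel has the same norm as its image because \<open>x - W (W' x)\<close> lies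
  in that kernel.\<close>

lemma partial_isometry_conclusion:
  fixes G P W :: "'a::chilbert_space bop"
  assumes W: "adjoint_pair W W'" "W' * W = 1" and G: "self_adjoint G" and P: "self_adjoint P"
    and le: "\<And>x. x \<bullet> bop_apply P x \<le> K * (bop_apply W x \<bullet> bop_apply G (bop_apply W x))"
  shows "\<exists>U. partial_isometry U \<and> P \<le> K *\<^sub>R (U * G * adj_op U)"
proof (intro exI conjI)
  show "partial_isometry W'"
    unfolding partial_isometry_def
  proof (intro allI impI)
    fix x assume perp: "\<forall>y. bop_apply W' y = 0 \<longrightarrow> cinner y x = 0"
    let ?y = "x - bop_apply W (bop_apply W' x)"
    have "bop_apply W' (bop_apply W z) = z" for z using W(2) by (metis bop_apply_simps(2,6))
    then have "bop_apply W' ?y = 0" by (simp add: bop_apply_diff)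
    then have "?y \<bullet> x = 0" using perp by (simp add: inner_eq_Re_cinner)
    then have "x \<bullet> x = bop_apply W' x \<bullet> bop_apply W' x"
      using adjoint_pairD[OF W(1), of "bop_apply W' x" x] by (simp add: inner_diff_left)
    then show "norm (bop_apply W' x) = norm x" by (simp add: norm_eq_sqrt_inner)
  qed
  have adj: "adj_op W' = W" by (rule adj_op_eqI[OF adjoint_pair_sym[OF W(1)]])
  have sa: "self_adjoint (K *\<^sub>R (W' * G * W))"
    using adjoint_pair_mult[OF adjoint_pair_mult[OF adjoint_pair_sym[OF W(1)] G] W(1)]
    by (intro adjoint_pair_scaleR) (simp add: mult.assoc)
  show "P \<le> K *\<^sub>R (W' * G * adj_op W')"
    unfolding adj bop_le_iff[OF P sa] using le by (simp add: adjoint_pairD[OF W(1)])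
qed

section \<open>Transporting scalar inequalities through a positive linear map\<close>

lemma linear_map_scaleR: "linear_map \<Phi> \<Longrightarrow> \<Phi> (r *\<^sub>R T) = r *\<^sub>R \<Phi> T"
  unfolding linear_map_def by (metis scaleC_of_real_bop)

lemma linear_map_diff: "linear_map \<Phi> \<Longrightarrow> \<Phi> (S - T) = \<Phi> S - \<Phi> T"
proof -
  assume l: "linear_map \<Phi>"
  then have "\<Phi> ((S - T) + T) = \<Phi> (S - T) + \<Phi> T" unfolding linear_map_def by blast
  then show ?thesis by simp
qed

lemma positive_map_mono: "linear_map \<Phi> \<Longrightarrow> positive_map \<Phi> \<Longrightarrow> S \<le> T \<Longrightarrow> \<Phi> S \<le> \<Phi> T"
  by (simp add: less_eq_bop_def positive_map_def flip: linear_map_diff)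

lemma positive_op_powr_op:
  assumes "numerical_bounds m M A" "0 < m"
  shows "continuous_on {m..M} (\<lambda>t. t powr q)" "positive_op (powr_op A q)"
proof -
  show c: "continuous_on {m..M} (\<lambda>t. t powr q)" using assms by (intro continuous_intros) auto
  show "positive_op (powr_op A q)"
    unfolding powr_op_def by (rule positive_op_cfc[OF assms(1) c]) simp
qed

context
  fixes \<Phi> :: "'a::chilbert_space bop \<Rightarrow> 'b::chilbert_space bop" and A :: "'a bop" and m M \<gamma> :: real
  assumes \<Phi>: "linear_map \<Phi>" "positive_map \<Phi>" "unital_map \<Phi>"
    and A: "numerical_bounds m M A" and mM: "0 < m" "m < M" and \<gamma>: "\<gamma> > 0"
begin

text \<open>Dividing \<open>\<Phi> (A\<^sup>q\<^sup>\<gamma>)\<close> by the \<open>q\<gamma>\<close>-th power of the geometric mean of \<open>m\<close> and \<open>M\<close> moves the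
  spectral interval for \<open>q = 1\<close> to \<open>[e\<^sup>-\<^sup>u, e\<^sup>u]\<close>.\<close>

definition half_log :: real where "half_log = \<gamma> * ln (M / m) / 2"
definition scale :: "real \<Rightarrow> real" where "scale q = (m * M) powr (q * \<gamma> / 2)"
definition normalized :: "real \<Rightarrow> 'b bop" where "normalized q = (1 / scale q) *\<^sub>R \<Phi> (powr_op A (q * \<gamma>))"

lemma half_log_pos: "half_log > 0"
  unfolding half_log_def using mM \<gamma> by simp

lemma scale_pos: "scale q > 0"
  unfolding scale_def using mM by simp

lemma scale_add: "scale (p + q) = scale p * scale q"
  unfolding scale_def by (simp add: add_divide_distrib distrib_right flip: powr_add)

lemma Phi_eq: "\<Phi> (powr_op A (q * \<gamma>)) = scale q *\<^sub>R normalized q"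
  using scale_pos[of q] by (simp add: normalized_def)

lemma positive_Phi: "positive_op (\<Phi> (powr_op A q))"
  using \<Phi>(2) positive_op_powr_op(2)[OF A mM(1)] by (simp add: positive_map_def)

lemma self_adjoint_normalized: "self_adjoint (normalized q)"
  unfolding normalized_def using positive_Phi by (intro adjoint_pair_scaleR) (simp add: positive_op_iff)

lemma point_bounds:
  assumes t: "t \<in> {m..M}"
  shows "exp (- half_log) \<le> t powr \<gamma> / scale 1" "t powr \<gamma> / scale 1 \<le> exp half_log"
    and "(t powr \<gamma> / scale 1) powr q = t powr (q * \<gamma>) / scale q"
proof -
  have t0: "t > 0" using t mM by simp
  have y: "t powr \<gamma> / scale 1 = exp (\<gamma> * (ln t - (ln m + ln M) / 2))"
    using t0 mM by (simp add: scale_def powr_def ln_mult algebra_simps flip: exp_diff)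
  have hl: "half_log = \<gamma> * ((ln M - ln m) / 2)" using mM by (simp add: half_log_def ln_div)
  have "ln m \<le> ln t" "ln t \<le> ln M" using t mM by auto
  then have "\<gamma> * (- ((ln M - ln m) / 2)) \<le> \<gamma> * (ln t - (ln m + ln M) / 2)"
    "\<gamma> * (ln t - (ln m + ln M) / 2) \<le> \<gamma> * ((ln M - ln m) / 2)"
    using \<gamma> by (intro mult_left_mono; simp add: field_simps)+
  then show "exp (- half_log) \<le> t powr \<gamma> / scale 1" "t powr \<gamma> / scale 1 \<le> exp half_log"
    unfolding y hl by simp_all
  have "(t powr \<gamma> / scale 1) powr q = (t powr \<gamma>) powr q / (scale 1) powr q"
    by (rule powr_divide)
  then show "(t powr \<gamma> / scale 1) powr q = t powr (q * \<gamma>) / scale q"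
    by (simp add: scale_def powr_powr mult.commute)
qed

text \<open>Affine functions of two powers cover everything needed: one coefficient zero gives the
  bounds on \<open>normalized 1\<close>, and the general case gives the chord estimates.\<close>

lemma normalized_le:
  assumes "\<And>t. t \<in> {m..M} \<Longrightarrow> r * (t powr (p * \<gamma>) / scale p) + s \<le> r' * (t powr (q * \<gamma>) / scale q) + s'"
  shows "r *\<^sub>R normalized p + s *\<^sub>R 1 \<le> r' *\<^sub>R normalized q + s' *\<^sub>R 1"
proof -
  note cont = positive_op_powr_op(1)[OF A mM(1)]
  have lin: "cfc (\<lambda>t. r * (t powr (p * \<gamma>) / scale p) + s) A = (r / scale p) *\<^sub>R powr_op A (p * \<gamma>) + s *\<^sub>R 1"
    and clin: "continuous_on {m..M} (\<lambda>t. r * (t powr (p * \<gamma>) / scale p) + s)" for r p s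
  proof -
    have c: "continuous_on {m..M} (\<lambda>t. (r / scale p) * t powr (p * \<gamma>))" by (intro continuous_intros cont)
    have "cfc (\<lambda>t. (r / scale p) * t powr (p * \<gamma>) + s) A = cfc (\<lambda>t. (r / scale p) * t powr (p * \<gamma>)) A + cfc (\<lambda>t. s) A"
      by (rule cfc_add[OF A c]) simp
    also have "\<dots> = (r / scale p) *\<^sub>R powr_op A (p * \<gamma>) + s *\<^sub>R 1"
      by (simp only: cfc_cmult[OF A cont] cfc_const[OF A] powr_op_def)
    finally show "cfc (\<lambda>t. r * (t powr (p * \<gamma>) / scale p) + s) A = (r / scale p) *\<^sub>R powr_op A (p * \<gamma>) + s *\<^sub>R 1"
      by simp
    show "continuous_on {m..M} (\<lambda>t. r * (t powr (p * \<gamma>) / scale p) + s)"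
      using scale_pos[of p] by (intro continuous_intros cont) auto
  qed
  have "(r / scale p) *\<^sub>R powr_op A (p * \<gamma>) + s *\<^sub>R 1 \<le> (r' / scale q) *\<^sub>R powr_op A (q * \<gamma>) + s' *\<^sub>R 1"
    unfolding lin[symmetric] by (rule cfc_mono[OF A clin clin assms])
  from positive_map_mono[OF \<Phi>(1,2) this]
  have "\<Phi> ((r / scale p) *\<^sub>R powr_op A (p * \<gamma>) + s *\<^sub>R 1) \<le> \<Phi> ((r' / scale q) *\<^sub>R powr_op A (q * \<gamma>) + s' *\<^sub>R 1)" .
  moreover have "\<Phi> ((r / scale p) *\<^sub>R powr_op A (p * \<gamma>) + s *\<^sub>R 1) = r *\<^sub>R normalized p + s *\<^sub>R 1" for r p s
  proof -
    have "\<Phi> ((r / scale p) *\<^sub>R powr_op A (p * \<gamma>) + s *\<^sub>R 1) = \<Phi> ((r / scale p) *\<^sub>R powr_op A (p * \<gamma>)) + \<Phi> (s *\<^sub>R 1)"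
      using \<Phi>(1) unfolding linear_map_def by blast
    then show ?thesis
      using \<Phi>(3) by (simp add: linear_map_scaleR[OF \<Phi>(1)] normalized_def unital_map_def)
  qed
  ultimately show ?thesis by simp
qed

lemma normalized_bounds: "numerical_bounds (exp (- half_log)) (exp half_log) (normalized 1)"
proof -
  have "0 *\<^sub>R normalized 1 + exp (- half_log) *\<^sub>R 1 \<le> 1 *\<^sub>R normalized 1 + 0 *\<^sub>R 1"
    "1 *\<^sub>R normalized 1 + 0 *\<^sub>R 1 \<le> 0 *\<^sub>R normalized 1 + exp half_log *\<^sub>R 1"
    by (rule normalized_le; use point_bounds in simp)+
  then show ?thesis
    using bop_leD self_adjoint_normalized by (fastforce simp: numerical_bounds_def dot_square_norm)
qed

lemma chord_op_le_normalized: "0 \<le> q \<Longrightarrow> q \<le> 1 \<Longrightarrow> chord_op half_log q (normalized 1) \<le> normalized q"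
  and normalized_le_chord_op: "1 \<le> q \<Longrightarrow> normalized q \<le> chord_op half_log q (normalized 1)"
proof -
  let ?s = "sinh (q * half_log) / sinh half_log" and ?r = "- (sinh ((q - 1) * half_log) / sinh half_log)"
  have op: "chord_op half_log q (normalized 1) = ?s *\<^sub>R normalized 1 + ?r *\<^sub>R 1"
    by (simp add: chord_op_def)
  have pt: "?s * (t powr (1 * \<gamma>) / scale 1) + ?r = chord half_log q (t powr \<gamma> / scale 1)" for t
    using chord_eq[OF half_log_pos] by simp
  have nq: "normalized q = 1 *\<^sub>R normalized q + 0 *\<^sub>R 1" by simp
  show "chord_op half_log q (normalized 1) \<le> normalized q" if q: "0 \<le> q" "q \<le> 1"
    unfolding op
  proof (subst nq, rule normalized_le)
    fix t assume t: "t \<in> {m..M}"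
    show "?s * (t powr (1 * \<gamma>) / scale 1) + ?r \<le> 1 * (t powr (q * \<gamma>) / scale q) + 0"
      unfolding pt point_bounds(3)[OF t, of q, symmetric]
      using chord_powr(2)[OF half_log_pos point_bounds(1,2)[OF t] q] by simp
  qed
  show "normalized q \<le> chord_op half_log q (normalized 1)" if q: "1 \<le> q"
    unfolding op
  proof (subst nq, rule normalized_le)
    fix t assume t: "t \<in> {m..M}"
    show "1 * (t powr (q * \<gamma>) / scale q) + 0 \<le> ?s * (t powr (1 * \<gamma>) / scale 1) + ?r"
      unfolding pt point_bounds(3)[OF t, of q, symmetric]
      using chord_powr(1)[OF half_log_pos point_bounds(1,2)[OF t] q] by simp
  qed
qed

lemma Phi_product: "\<Phi> (powr_op A (a * \<gamma>)) * \<Phi> (powr_op A (b * \<gamma>)) * \<Phi> (powr_op A \<gamma>)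
    = scale (1 + (a + b)) *\<^sub>R (normalized a * normalized b * normalized 1)"
  using Phi_eq[of a] Phi_eq[of b] Phi_eq[of 1] by (simp add: scale_add mult_ac)

lemma Phi_domination:
  assumes a: "0 \<le> a" "a \<le> 1" and b: "0 \<le> b" "b \<le> 1" and ab: "min a b \<le> 1/2"
    and K: "K = cosh (a * half_log) * cosh (b * half_log) * kappa half_log (2 * b) powr (- 1/2)
      * kappa half_log (2 * a) powr (- 1/2) * kappa half_log (1 + (a + b))"
  shows "\<exists>W W'. adjoint_pair W W' \<and> W' * W = 1 \<and> (\<forall>x.
    x \<bullet> bop_apply (\<Phi> (powr_op A ((1 + (a + b)) * \<gamma>))) x
      \<le> K * (bop_apply W x \<bullet> bop_apply (abs_op (\<Phi> (powr_op A (a * \<gamma>)) * \<Phi> (powr_op A (b * \<gamma>)) * \<Phi> (powr_op A \<gamma>))) (bop_apply W x)))"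
proof -
  let ?T = "\<Phi> (powr_op A (a * \<gamma>)) * \<Phi> (powr_op A (b * \<gamma>)) * \<Phi> (powr_op A \<gamma>)"
  let ?p = "1 + (a + b)" and ?u = half_log
  note u = half_log_pos
  have saPhi: "self_adjoint (\<Phi> (powr_op A q))" for q using positive_Phi by (simp add: positive_op_iff)
  \<comment> \<open>The spectrum stays away from 0 since \<open>m > 0\<close>, so the convention
    \<open>0 powr 0 = 0\<close> does no harm.\<close>
  have Phi0: "\<Phi> (powr_op A (0 * \<gamma>)) = 1"
  proof -
    have "powr_op A 0 = cfc (\<lambda>t. 1) A"
      unfolding powr_op_def by (rule cfc_cong[OF A positive_op_powr_op(1)[OF A mM(1)]]) (use mM in auto)
    then show ?thesis using \<Phi>(3) by (simp add: cfc_const[OF A] unital_map_def)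
  qed
  have trivial: ?thesis if pos: "positive_op ?T"
    and le: "\<And>x. x \<bullet> bop_apply (\<Phi> (powr_op A (?p * \<gamma>))) x \<le> K * (x \<bullet> bop_apply ?T x)"
    using le by (intro exI[of _ 1]) (simp add: adjoint_pair_one abs_op_positive[OF pos])
  have square: ?thesis if T: "?T = \<Phi> (powr_op A \<gamma>) * \<Phi> (powr_op A \<gamma>)" and p: "?p = 2" and K2: "K = (cosh ?u)\<^sup>2"
  proof (rule trivial)
    have TT: "x \<bullet> bop_apply ?T x = (norm (bop_apply (\<Phi> (powr_op A \<gamma>)) x))\<^sup>2" for x
      unfolding T by (rule self_adjoint_norm_sq[OF saPhi, symmetric])
    have "self_adjoint ?T" unfolding T by (rule adjoint_pair_mult[OF saPhi saPhi])
    then show "positive_op ?T" unfolding positive_op_iff TT by simp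
    fix x
    let ?X = "bop_apply (normalized 1) x"
    have "x \<bullet> bop_apply (normalized 2) x \<le> x \<bullet> bop_apply (chord_op ?u 2 (normalized 1)) x"
      by (rule bop_leD[OF normalized_le_chord_op]) simp
    also have "\<dots> = 2 * cosh ?u * (x \<bullet> ?X) - (norm x)\<^sup>2"
      using u by (simp add: inner_chord_op sinh_double)
    also have "\<dots> \<le> (cosh ?u)\<^sup>2 * (norm ?X)\<^sup>2"
      using zero_le_power2[of "norm (x - cosh ?u *\<^sub>R ?X)"]
      unfolding norm_diff_scaleR_sq by (simp add: dot_square_norm)
    finally have "scale 2 * (x \<bullet> bop_apply (normalized 2) x) \<le> scale 2 * ((cosh ?u)\<^sup>2 * (norm ?X)\<^sup>2)"
      using scale_pos[of 2] by (intro mult_left_mono) auto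
    moreover have "scale 2 = (scale 1)\<^sup>2" using scale_add[of 1 1] by (simp add: power2_eq_square)
    moreover have "bop_apply (\<Phi> (powr_op A \<gamma>)) x = scale 1 *\<^sub>R ?X" using Phi_eq[of 1] by simp
    ultimately show "x \<bullet> bop_apply (\<Phi> (powr_op A (?p * \<gamma>))) x \<le> K * (x \<bullet> bop_apply ?T x)"
      unfolding TT p K2 Phi_eq[of 2] using scale_pos[of 1] by (simp add: power_mult_distrib mult_ac)
  qed
  have kk: "(cosh ?u)\<^sup>2 powr (- 1/2) = 1 / cosh ?u"
  proof -
    have "(cosh ?u)\<^sup>2 powr (- 1/2) = ((cosh ?u) powr 2) powr (- 1/2)" by simp
    also have "\<dots> = cosh ?u powr (- 1)" by (simp only: powr_powr) simp
    finally show ?thesis by (simp add: powr_minus_divide)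
  qed
  have nz: "sinh ?u \<noteq> 0" using u by simp
  consider "a = 0 \<and> b = 0" | "a = 1 \<and> b = 0" | "a = 0 \<and> b = 1" |
    "\<not> (a = 0 \<and> b = 0)" "\<not> (a = 1 \<and> b = 0)" "\<not> (a = 0 \<and> b = 1)" by blast
  then show ?thesis
  proof cases
    case 1
    then have "K = 1" using K by (simp add: kappa_0[OF u] kappa_1[OF u])
    then show ?thesis using 1 Phi0 positive_Phi by (intro trivial) simp_all
  next
    case 2
    then have "K = (cosh ?u)\<^sup>2"
      using K kk by (simp add: kappa_0[OF u] kappa_2[OF u] power2_eq_square)
    then show ?thesis using 2 Phi0 by (intro square) simp_all
  next
    case 3
    then have "K = (cosh ?u)\<^sup>2"
      using K kk by (simp add: kappa_0[OF u] kappa_2[OF u] power2_eq_square)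
    then show ?thesis using 3 Phi0 by (intro square) simp_all
  next
    case 4
    let ?s = "scale ?p"
    have s: "?s > 0" by (rule scale_pos)
    have TT': "adjoint_pair ?T (\<Phi> (powr_op A \<gamma>) * (\<Phi> (powr_op A (b * \<gamma>)) * \<Phi> (powr_op A (a * \<gamma>))))"
      by (intro adjoint_pair_mult saPhi)
    note abs = abs_op_properties[OF TT']
    \<comment> \<open>Dividing by the scale of the left-hand side matches the homogeneity of the
      product, so both sides rescale together.\<close>
    define G where "G = (1 / ?s) *\<^sub>R abs_op ?T"
    have absG: "abs_op ?T = ?s *\<^sub>R G" using s by (simp add: G_def)
    have posG: "positive_op G"
      using abs(1) s unfolding positive_op_iff G_def by (auto intro: adjoint_pair_scaleR)
    have normG: "norm (bop_apply G v) = norm (bop_apply (normalized a * normalized b * normalized 1) v)" for v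
    proof -
      have "norm (bop_apply G v) = norm (bop_apply (abs_op ?T) v) / ?s" using s by (simp add: G_def)
      also have "\<dots> = norm (bop_apply ?T v) / ?s" unfolding abs(3) ..
      also have "\<dots> = norm (bop_apply (normalized a * normalized b * normalized 1) v)"
        unfolding Phi_product using s by simp
      finally show ?thesis .
    qed
    have "\<exists>W W'. adjoint_pair W W' \<and> W' * W = 1 \<and>
      (\<forall>x. x \<bullet> bop_apply (normalized ?p) x \<le> K * (bop_apply W x \<bullet> bop_apply G (bop_apply W x)))"
    proof (rule product_domination[OF u normalized_bounds self_adjoint_normalized _ _ _ a(1) b(1) _ _ _ posG normG])
      show "x \<bullet> bop_apply (chord_op ?u a (normalized 1)) x \<le> x \<bullet> bop_apply (normalized a) x" for x
        by (rule bop_leD[OF chord_op_le_normalized[OF a]])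
      show "x \<bullet> bop_apply (chord_op ?u b (normalized 1)) x \<le> x \<bullet> bop_apply (normalized b) x" for x
        by (rule bop_leD[OF chord_op_le_normalized[OF b]])
      show "x \<bullet> bop_apply (normalized ?p) x \<le> x \<bullet> bop_apply (chord_op ?u ?p (normalized 1)) x" for x
        by (rule bop_leD[OF normalized_le_chord_op]) (use a b in simp)
      show "0 \<le> ?p" using a b by simp
      show "K > 0" by (rule scalar_inequality(2)[OF u a b ab 4 order_refl K])
      show "(chord ?u ?p y)\<^sup>2 < K\<^sup>2 * y\<^sup>2 * (chord ?u b y)\<^sup>2 * square_bound ?u a y" if "exp (- ?u) \<le> y" for y
        by (rule scalar_inequality(1)[OF u a b ab 4 that K])
    qed
    then obtain W W' where W: "adjoint_pair W W'" "W' * W = 1"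
      "\<And>x. x \<bullet> bop_apply (normalized ?p) x \<le> K * (bop_apply W x \<bullet> bop_apply G (bop_apply W x))" by blast
    have "x \<bullet> bop_apply (\<Phi> (powr_op A (?p * \<gamma>))) x \<le> K * (bop_apply W x \<bullet> bop_apply (abs_op ?T) (bop_apply W x))" for x
      using mult_left_mono[OF W(3)[of x], of ?s] s unfolding Phi_eq[of ?p] absG by (simp add: mult_ac)
    then show ?thesis using W(1,2) by blast
  qed
qed

end

section \<open>Assembly, with the degenerate spectral intervals\<close>

theorem theorem3p5:
  fixes \<Phi> :: "'a::chilbert_space bop \<Rightarrow> 'b::chilbert_space bop"
    and \<alpha> \<beta> \<gamma> m M h K :: real
    and A :: "'a bop"
  assumes "linear_map \<Phi>" and "positive_map \<Phi>" and "unital_map \<Phi>"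
    and "\<alpha> \<ge> 0" and "\<beta> \<ge> 0" and "\<gamma> > 0"
    and "min \<alpha> \<beta> \<le> \<gamma> / 2" and "max \<alpha> \<beta> \<le> \<gamma>"
    and "positive_op A" and "invertible_op A"
    and "m > 0" and "M > 0"
    and "m *\<^sub>R 1 \<le> A" and "A \<le> M *\<^sub>R 1"
    and "h = M / m"
    and "K = kantorovich (h powr \<alpha>) 2 powr (1/2)
           * kantorovich (h powr \<beta>) 2 powr (1/2)
           * kantorovich (h powr \<gamma>) (2 * \<beta> / \<gamma>) powr (-1/2)
           * kantorovich (h powr \<gamma>) (2 * \<alpha> / \<gamma>) powr (-1/2)
           * kantorovich (h powr \<gamma>) (1 + (\<alpha> + \<beta>) / \<gamma>)"
  shows "\<exists>U :: 'b bop. partial_isometry U \<and>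
    \<Phi> (powr_op A (\<alpha> + \<beta> + \<gamma>))
      \<le> K *\<^sub>R (U * abs_op (\<Phi> (powr_op A \<alpha>) * \<Phi> (powr_op A \<beta>) * \<Phi> (powr_op A \<gamma>)) * adj_op U)"
proof -
  let ?P = "\<Phi> (powr_op A (\<alpha> + \<beta> + \<gamma>))"
  let ?T = "\<Phi> (powr_op A \<alpha>) * \<Phi> (powr_op A \<beta>) * \<Phi> (powr_op A \<gamma>)"
  note \<Phi> = assms(1-3)
  have A: "numerical_bounds m M A"
    using assms(9) bop_leD[OF assms(13)] bop_leD[OF assms(14)]
    by (simp add: numerical_bounds_def positive_op_iff dot_square_norm)
  note cont = positive_op_powr_op(1)[OF A \<open>m > 0\<close>]
  have pos: "positive_op (\<Phi> (powr_op A q))" for q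
    using assms(2) positive_op_powr_op(2)[OF A \<open>m > 0\<close>] by (simp add: positive_map_def)
  then have sa: "self_adjoint (\<Phi> (powr_op A q))" for q by (simp add: positive_op_iff)
  have saG: "self_adjoint (abs_op ?T)"
    using abs_op_properties(1)[OF adjoint_pair_mult[OF adjoint_pair_mult[OF sa sa] sa]] by (simp add: positive_op_iff)
  have "\<exists>W W'. adjoint_pair W W' \<and> W' * W = 1 \<and>
    (\<forall>x. x \<bullet> bop_apply ?P x \<le> K * (bop_apply W x \<bullet> bop_apply (abs_op ?T) (bop_apply W x)))"
  proof (cases "m < M")
    case True
    define a where "a = \<alpha> / \<gamma>"
    define b where "b = \<beta> / \<gamma>"
    let ?u = "half_log m M \<gamma>"
    note u = half_log_pos[OF \<Phi> A \<open>m > 0\<close> True \<open>\<gamma> > 0\<close>]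
    have eqs: "\<alpha> = a * \<gamma>" "\<beta> = b * \<gamma>" using \<open>\<gamma> > 0\<close> by (simp_all add: a_def b_def)
    have ab: "0 \<le> a" "a \<le> 1" "0 \<le> b" "b \<le> 1" "min a b \<le> 1/2"
      using assms(4-8) by (auto simp: a_def b_def field_simps min_def split: if_splits)
    \<comment> \<open>\<open>half_log\<close> is chosen so that \<open>h powr \<gamma>\<close> is
      the exponential of \<open>2 * ?u\<close>, the form in which \<open>kappa\<close> is
      defined.\<close>
    have hp: "h powr (q * \<gamma>) = exp (2 * (q * ?u))" for q
      using assms(11,12,15) by (simp add: powr_def half_log_def[OF \<Phi> A \<open>m > 0\<close> True \<open>\<gamma> > 0\<close>])
    have sq: "((cosh v)\<^sup>2) powr (1/2) = cosh v" for v :: real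
      by (simp add: powr_half_sqrt)
    have "K = cosh (a * ?u) * cosh (b * ?u) * kappa ?u (2 * b) powr (- 1/2) * kappa ?u (2 * a) powr (- 1/2) * kappa ?u (1 + (a + b))"
    proof -
      have "kantorovich (h powr \<alpha>) 2 powr (1/2) = cosh (a * ?u)" "kantorovich (h powr \<beta>) 2 powr (1/2) = cosh (b * ?u)"
        unfolding eqs hp kantorovich_exp_two sq by simp_all
      moreover have "kantorovich (h powr \<gamma>) q = kappa ?u q" for q
        using hp[of 1] by (simp add: kappa_def[OF u])
      moreover have "2 * \<beta> / \<gamma> = 2 * b" "2 * \<alpha> / \<gamma> = 2 * a" "1 + (\<alpha> + \<beta>) / \<gamma> = 1 + (a + b)"
        by (simp_all add: a_def b_def add_divide_distrib)
      ultimately show ?thesis using assms(16) by simp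
    qed
    moreover have "\<alpha> + \<beta> + \<gamma> = (1 + (a + b)) * \<gamma>" by (simp add: eqs algebra_simps)
    ultimately show ?thesis
      using Phi_domination[OF \<Phi> A \<open>m > 0\<close> True \<open>\<gamma> > 0\<close> ab(1,2,3,4,5)] unfolding eqs by simp
  next
    case False
    show ?thesis
    proof (cases "m = M")
      case True
      \<comment> \<open>A one-point interval makes every power a scalar, so both sides agree and all
        Kantorovich constants are 1.\<close>
      have pw: "\<Phi> (powr_op A q) = (m powr q) *\<^sub>R 1" for q
      proof -
        have "powr_op A q = cfc (\<lambda>t. m powr q) A"
          unfolding powr_op_def by (rule cfc_cong[OF A cont]) (use True in simp)
        then show ?thesis
          using assms(3) by (simp add: cfc_const[OF A] linear_map_scaleR[OF \<Phi>(1)] unital_map_def)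
      qed
      have T: "?T = ?P" unfolding pw by (simp add: add.commute add.left_commute flip: powr_add)
      have "h = 1" using True assms(11,15) by simp
      then have "K = 1" using assms(16) by (simp add: kantorovich_def)
      then show ?thesis
        by (intro exI[of _ 1]) (simp add: T abs_op_positive[OF pos] adjoint_pair_one)
    next
      case neq: False
      \<comment> \<open>Here \<open>m > M\<close>, which is possible only on the zero space;
        unitality of \<open>\<Phi>\<close> then forces the target space to be zero as well.\<close>
      have "x = 0" for x :: 'a
      proof -
        have "m * (norm x)\<^sup>2 \<le> M * (norm x)\<^sup>2" using A unfolding numerical_bounds_def by (meson order_trans)
        then show ?thesis using False neq by (simp add: mult_le_cancel_right)
      qed
      then have "(1 :: 'a bop) = 0 *\<^sub>R 1" by (intro bop_eqI) metis
      then have "(1 :: 'b bop) = 0 *\<^sub>R 1"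
        using assms(3) linear_map_scaleR[OF \<Phi>(1), of 0 1] by (simp add: unital_map_def)
      then have zero: "bop_apply S x = 0" for S :: "'b bop" and x
        by (metis bop_apply_simps(1,2) bop_apply_zero scaleR_zero_left)
      show ?thesis
        by (rule exI[of _ 1], rule exI[of _ 1]) (simp add: zero adjoint_pair_one)
    qed
  qed
  then obtain W W' where W: "adjoint_pair W W'" "W' * W = 1"
    "\<And>x. x \<bullet> bop_apply ?P x \<le> K * (bop_apply W x \<bullet> bop_apply (abs_op ?T) (bop_apply W x))" by blast
  show ?thesis by (rule partial_isometry_conclusion[OF W(1,2) saG sa W(3)])
qed

end
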